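(* Let $Z=(Z^1,\dots,Z^n)=X+iY$, with $X=(X^1,\dots,X^n)$, $Y=(Y^1,\dots,Y^n)$ real, be a $\mathbb{C}^n$-valued continuous conformal martingale starting at zero, on a filtered probability space satisfying the usual conditions, with the orthogonality property. Then for $p=2^k$, $k\in\mathbb{N}$, \[ \big\|\,\|Y\|_{\ell^2}\big\|_p\le\cot\Big(\frac{\pi}{2p}\Big)\big\|\,\|X\|_{\ell^2}\big\|_p . \]
   Context: A $\mathbb{C}$-valued continuous martingale $Z^k=X^k+iY^k$ is conformal if $\langle X^k\rangle_t=\langle Y^k\rangle_t$ and $\langle X^k,Y^k\rangle_t=0$ for all $t$; a $\mathbb{C}^n$-valued martingale is conformal if each coordinate is. It has the orthogonality property if $\langle Z^k,Z^j\rangle_t=0$ for all $j,k$ and $t$, where the bracket is complex bilinear: $\langle Z^k,Z^j\rangle=\langle X^k,X^j\rangle-\langle Y^k,Y^j\rangle+i(\langle X^k,Y^j\rangle+\langle Y^k,X^j\rangle)$. $\|X_t\|_{\ell^2}=(\sum_{k=1}^n|X^k_t|^2)^{1/2}$, and for a process $W$, $\|W\|_p=\sup_{t>0}\|W_t\|_{L^p(\mathbb{P})}$. *)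

theory Defs
  imports "HOL-Probability.Probability"
begin

definition usual_filtration :: "'a measure \<Rightarrow> (real \<Rightarrow> 'a measure) \<Rightarrow> bool" where
  "usual_filtration M F \<longleftrightarrow>
     (\<forall>t\<ge>0. subalgebra M (F t)) \<and>
     (\<forall>s t. 0 \<le> s \<longrightarrow> s \<le> t \<longrightarrow> sets (F s) \<subseteq> sets (F t)) \<and>
     (\<forall>t\<ge>0. sets (F t) = (\<Inter>s\<in>{t<..}. sets (F s))) \<and>
     (\<forall>N\<in>null_sets M. \<forall>A. A \<subseteq> N \<longrightarrow> A \<in> sets (F 0))"

definition adapted_proc :: "(real \<Rightarrow> 'a measure) \<Rightarrow> (real \<Rightarrow> 'a \<Rightarrow> real) \<Rightarrow> bool" where
  "adapted_proc F X \<longleftrightarrow> (\<forall>t\<ge>0. X t \<in> borel_measurable (F t))"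

definition continuous_proc :: "'a measure \<Rightarrow> (real \<Rightarrow> 'a \<Rightarrow> real) \<Rightarrow> bool" where
  "continuous_proc M X \<longleftrightarrow> (\<forall>\<omega>\<in>space M. continuous_on {0..} (\<lambda>t. X t \<omega>))"

definition real_martingale :: "'a measure \<Rightarrow> (real \<Rightarrow> 'a measure) \<Rightarrow> (real \<Rightarrow> 'a \<Rightarrow> real) \<Rightarrow> bool" where
  "real_martingale M F X \<longleftrightarrow>
     adapted_proc F X \<and> (\<forall>t\<ge>0. integrable M (X t)) \<and>
     (\<forall>s t. 0 \<le> s \<longrightarrow> s \<le> t \<longrightarrow> (AE \<omega> in M. real_cond_exp M (F s) (X t) \<omega> = X s \<omega>))"

definition stopping_time_R :: "'a measure \<Rightarrow> (real \<Rightarrow> 'a measure) \<Rightarrow> ('a \<Rightarrow> real) \<Rightarrow> bool" where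
  "stopping_time_R M F \<tau> \<longleftrightarrow> (\<forall>\<omega>\<in>space M. 0 \<le> \<tau> \<omega>) \<and>
     (\<forall>t\<ge>0. {\<omega>\<in>space M. \<tau> \<omega> \<le> t} \<in> sets (F t))"

definition real_local_martingale :: "'a measure \<Rightarrow> (real \<Rightarrow> 'a measure) \<Rightarrow> (real \<Rightarrow> 'a \<Rightarrow> real) \<Rightarrow> bool" where
  "real_local_martingale M F X \<longleftrightarrow> adapted_proc F X \<and>
     (\<exists>\<tau>::nat \<Rightarrow> 'a \<Rightarrow> real. (\<forall>m. stopping_time_R M F (\<tau> m)) \<and>
        (\<forall>\<omega>\<in>space M. mono (\<lambda>m. \<tau> m \<omega>) \<and> filterlim (\<lambda>m. \<tau> m \<omega>) at_top sequentially) \<and>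
        (\<forall>m. real_martingale M F (\<lambda>t \<omega>. X (min t (\<tau> m \<omega>)) \<omega> - X 0 \<omega>)))"

definition finite_variation :: "(real \<Rightarrow> real) \<Rightarrow> bool" where
  "finite_variation f \<longleftrightarrow> (\<forall>T\<ge>0. \<exists>B. \<forall>(n::nat) (s::nat \<Rightarrow> real).
      0 \<le> s 0 \<longrightarrow> (\<forall>i<n. s i \<le> s (Suc i)) \<longrightarrow> s n \<le> T \<longrightarrow>
      (\<Sum>i<n. \<bar>f (s (Suc i)) - f (s i)\<bar>) \<le> B)"

text \<open>A is (a version of) the quadratic covariation \<langle>X,Y\<rangle>: the continuous adapted
  finite-variation process vanishing at 0 such that XY - A is a local martingale
  (unique up to indistinguishability).\<close>
definition is_covariation ::
  "'a measure \<Rightarrow> (real \<Rightarrow> 'a measure) \<Rightarrow> (real \<Rightarrow> 'a \<Rightarrow> real) \<Rightarrow> (real \<Rightarrow> 'a \<Rightarrow> real)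
     \<Rightarrow> (real \<Rightarrow> 'a \<Rightarrow> real) \<Rightarrow> bool" where
  "is_covariation M F X Y A \<longleftrightarrow>
     (\<forall>\<omega>\<in>space M. A 0 \<omega> = 0) \<and> adapted_proc F A \<and> continuous_proc M A \<and>
     (\<forall>\<omega>\<in>space M. finite_variation (\<lambda>t. A t \<omega>)) \<and>
     real_local_martingale M F (\<lambda>t \<omega>. X t \<omega> * Y t \<omega> - A t \<omega>)"

definition Lp_norm :: "'a measure \<Rightarrow> real \<Rightarrow> ('a \<Rightarrow> real) \<Rightarrow> ennreal" where
  "Lp_norm M p f = (let I = (\<integral>\<^sup>+ \<omega>. ennreal (\<bar>f \<omega>\<bar> powr p) \<partial>M) in
     if I = \<infinity> then \<infinity> else ennreal (enn2real I powr (1 / p)))"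

definition proc_norm :: "'a measure \<Rightarrow> real \<Rightarrow> (real \<Rightarrow> 'a \<Rightarrow> real) \<Rightarrow> ennreal" where
  "proc_norm M p W = (SUP t\<in>{0<..}. Lp_norm M p (W t))"

end

theory Submission
  imports Defs
begin

text \<open>Let \<open>W = \<Sum>j<n. (Z j)\<^sup>2\<close>, so that \<open>Re W = |X|\<^sup>2 - |Y|\<^sup>2\<close> and \<open>|Im W| \<le> 2 |X| |Y|\<close>. If \<open>W\<close>
  satisfies \<open>\<parallel>Re W\<parallel>\<^sub>q \<le> c \<parallel>Im W\<parallel>\<^sub>q\<close>, then \<open>u = \<parallel>Y\<parallel> / \<parallel>X\<parallel>\<close> (norms in \<open>L\<close> with exponent \<open>2q\<close>) satisfies
  \<open>u\<^sup>2 \<le> 1 + 2 c u\<close>, whose positive root is \<open>cot (\<theta> / 2)\<close> when \<open>c = cot \<theta>\<close>. Applying this repeatedly to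
  \<open>W, W\<^sup>2, W\<^sup>4, \<dots>\<close> reduces the inequality at a fixed time to the single fact that \<open>W\<close> raised to
  the power \<open>p/2\<close> has mean zero. After stopping, \<open>Z\<close> is bounded and all \<open>Z j\<close> and \<open>Z j * Z l\<close> are
  martingales; hence every monomial in the \<open>Z j\<close> has constant mean, by a second-order expansion along
  a time grid. The stopping is removed with Fatou's lemma and the submartingale property of \<open>|X|\<close>
  to the power \<open>p\<close>.\<close>

section \<open>A moment inequality for complex random variables\<close>

text \<open>Powers of two enter because the bound for exponent \<open>2 * q\<close> is derived from
  the one for \<open>q\<close>, at twice the angle. The recursion ends at exponent 2, where mean
  zero of \<open>Re W\<close> says that \<open>|X|\<close> and \<open>|Y|\<close> have equal second
  moments, and \<open>cot (pi / 4) = 1\<close>. The claim bounds the imaginary side by the real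
  side, whereas its derivation needs \<open>Re W\<close> bounded by \<open>Im W\<close>; this is the
  same claim for \<open>- W\<^sup>2\<close>, whose real part is the square of \<open>Im W\<close>
  minus that of \<open>Re W\<close>. Norms are never formed: every estimate is linear in moments,
  with weights that give equality at \<open>|Y| = C |X|\<close>, so no quadratic has to be solved.

  Orthogonality is bilinear, without conjugates. It concerns \<open>Z j * Z l\<close>, not
  \<open>Z j * cnj (Z l)\<close>, and powers of \<open>W\<close> contain only monomials of the
  former kind. Brackets are never computed: they cancel in the real and imaginary parts of
  \<open>Z j * Z l\<close>, leaving local martingales. This is why boundedness must be gained by
  stopping before means can be compared. Since the moments of \<open>X\<close> may be infinite, the
  comparisons that survive the removal of the stopping are stated for nonnegative integrals.\<close>

lemma (in prob_space) integrable_bounded: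
  fixes f :: "'a \<Rightarrow> 'b::{banach, second_countable_topology}"
  assumes "f \<in> borel_measurable M" "\<And>\<omega>. \<omega> \<in> space M \<Longrightarrow> norm (f \<omega>) \<le> B"
  shows "integrable M f"
  using assms by (intro integrable_const_bound[where B=B]) auto

lemma integrable_indicator_mult:
  fixes f :: "'a \<Rightarrow> real"
  shows "A \<in> sets M \<Longrightarrow> integrable M f \<Longrightarrow> integrable M (\<lambda>\<omega>. indicator A \<omega> * f \<omega>)"
  using integrable_mult_indicator[of A M f] by simp

text \<open>Jensen for the even power at the convex combination of \<open>x / l\<close> and
  \<open>y / (1 - l)\<close>. It stands in for the triangle inequality of the norm. Equality holds
  when \<open>x / l = y / (1 - l)\<close>, which dictates the later choice of
  \<open>l\<close>.\<close>

lemma power_add_le_weighted: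
  fixes x y l :: real
  assumes "even q" "0 < l" "l < 1"
  shows "(x + y) ^ q \<le> l * (x / l) ^ q + (1 - l) * (y / (1 - l)) ^ q"
proof -
  have "convex_on UNIV (\<lambda>x::real. x ^ q)"
    using assms(1) by (rule convex_power_even)
  from convex_onD[OF this, of "1 - l" "x / l" "y / (1 - l)"] assms show ?thesis
    by simp
qed

text \<open>By the double-angle formulas, \<open>(cot t)\<^sup>2 - 1\<close> and
  \<open>2 * cot (2 * t) * cot t\<close> both equal
  \<open>cos (2 * t) / (sin t)\<^sup>2\<close>.\<close>

lemma cot_half_quadratic:
  fixes t :: real
  assumes "0 < t" "t < pi / 2"
  shows "(cot t)\<^sup>2 = 1 + 2 * cot (2 * t) * cot t"
proof -
  have s: "sin t > 0" and c: "cos t > 0"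
    using assms by (auto intro!: sin_gt_zero cos_gt_zero)
  then show ?thesis
    unfolding cot_def sin_double cos_double
    by (simp add: field_simps power2_eq_square)
qed

lemma cot_pos: "0 < t \<Longrightarrow> t < pi / 2 \<Longrightarrow> 0 < cot t" for t :: real
  unfolding cot_def by (intro divide_pos_pos sin_gt_zero cos_gt_zero) auto

text \<open>Meant for \<open>a = |X|\<close>, \<open>b = |Y|\<close>, \<open>V = W\<close> at a
  fixed time. The hypotheses survive the passage from \<open>(a, b, V)\<close> to
  \<open>(|Im V|, |Re V|, - V\<^sup>2)\<close>, which drives the induction. Only an inequality is
  asked of \<open>Im V\<close>, because for vectors it comes from Cauchy-Schwarz. The bound
  \<open>B\<close> makes all moments finite.\<close>

lemma (in prob_space) cot_moment_bound:
  fixes a b :: "'a \<Rightarrow> real" and V :: "'a \<Rightarrow> complex"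
  assumes "a \<in> borel_measurable M" "b \<in> borel_measurable M" "V \<in> borel_measurable M"
    and "\<And>\<omega>. \<omega> \<in> space M \<Longrightarrow> 0 \<le> a \<omega> \<and> a \<omega> \<le> B"
    and "\<And>\<omega>. \<omega> \<in> space M \<Longrightarrow> 0 \<le> b \<omega> \<and> b \<omega> \<le> B"
    and "\<And>\<omega>. \<omega> \<in> space M \<Longrightarrow> Re (V \<omega>) = (a \<omega>)\<^sup>2 - (b \<omega>)\<^sup>2"
    and "\<And>\<omega>. \<omega> \<in> space M \<Longrightarrow> \<bar>Im (V \<omega>)\<bar> \<le> 2 * a \<omega> * b \<omega>"
    and "expectation (\<lambda>\<omega>. Re (V \<omega> ^ 2 ^ j)) = 0"
  shows "expectation (\<lambda>\<omega>. b \<omega> ^ 2 ^ Suc j)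
    \<le> cot (pi / (2 * 2 ^ Suc j)) ^ 2 ^ Suc j * expectation (\<lambda>\<omega>. a \<omega> ^ 2 ^ Suc j)"
  using assms
proof (induction j arbitrary: a b V B)
  case 0
  note [measurable] = 0(1,2)
  have "integrable M (\<lambda>\<omega>. (a \<omega>)\<^sup>2)" "integrable M (\<lambda>\<omega>. (b \<omega>)\<^sup>2)"
    using 0(4,5) by (auto intro!: integrable_bounded[where B="B\<^sup>2"] power_mono)
  moreover have "expectation (\<lambda>\<omega>. (a \<omega>)\<^sup>2 - (b \<omega>)\<^sup>2) = 0"
    using 0(8) by (subst Bochner_Integration.integral_cong[OF refl 0(6)[symmetric]]) auto
  moreover have "cot (pi / 4) = (1::real)"
    by (simp add: cot_def sin_45 cos_45)
  ultimately show ?case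
    by simp
next
  case (Suc j)
  note [measurable] = Suc.prems(1,2,3)
  \<comment> \<open>The target exponent is \<open>2 * q\<close>; \<open>c\<close> and
    \<open>C\<close> are the constants for the exponents \<open>q\<close> and \<open>2 * q\<close>,
    the cotangents of an angle and of its half.\<close>
  define q :: nat where "q = 2 ^ Suc j"
  define c where "c = cot (pi / (2 * 2 ^ Suc j))"
  define C where "C = cot (pi / (2 * 2 ^ Suc (Suc j)))"
  have q: "even q" and q2: "2 ^ Suc (Suc j) = 2 * q"
    by (auto simp: q_def)
  have two: "(2::real) ^ Suc j > 1"
    by (rule one_less_power) auto
  have ang: "0 < pi / (2 * 2 ^ Suc (Suc j))" "pi / (2 * 2 ^ Suc (Suc j)) < pi / 2"
      "0 < pi / (2 * 2 ^ Suc j)" "pi / (2 * 2 ^ Suc j) < pi / 2"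
    using two by (auto simp: field_simps)
  have C0: "0 < C" and c0: "0 < c"
    unfolding C_def c_def using ang by (auto intro: cot_pos)
  have CC: "C\<^sup>2 = 1 + 2 * c * C"
    using cot_half_quadratic[OF ang(1,2)] by (simp add: C_def c_def)
  \<comment> \<open>The two convexity weights: \<open>1 / C\<^sup>2\<close> for
    \<open>a\<^sup>2\<close> and \<open>2 * c / C\<close> for \<open>|Re V|\<close>. That they add
    up to 1 is the quadratic \<open>CC\<close>.\<close>
  have l: "0 < 1 / C\<^sup>2" "1 / C\<^sup>2 < 1" "1 - 1 / C\<^sup>2 = 2 * c / C"
  proof -
    have "C\<^sup>2 > 1"
      using CC mult_pos_pos[OF c0 C0] by linarith
    then show "0 < 1 / C\<^sup>2" "1 / C\<^sup>2 < 1"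
      using C0 by (auto simp: divide_less_eq)
    have "1 - 1 / C\<^sup>2 = (C\<^sup>2 - 1) / C\<^sup>2"
      using C0 by (simp add: diff_divide_distrib)
    also have "\<dots> = 2 * c * C / C\<^sup>2"
      using CC by simp
    also have "\<dots> = 2 * c / C"
      by (simp add: power2_eq_square)
    finally show "1 - 1 / C\<^sup>2 = 2 * c / C" .
  qed
  \<comment> \<open>Positivity of the factor \<open>1 - c / C\<close> that is cancelled at the very
    end.\<close>
  have cC: "c / C < 1"
  proof -
    have "C * (2 * c) < C * C" using CC by (simp add: power2_eq_square)
    then have "2 * c < C" using C0 by simp
    then show ?thesis using C0 c0 by simp
  qed
  have bnd: "\<bar>Re (V \<omega>)\<bar> \<le> 2 * B\<^sup>2" "\<bar>Im (V \<omega>)\<bar> \<le> 2 * B\<^sup>2" if w: "\<omega> \<in> space M" for \<omega>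
  proof -
    have "(a \<omega>)\<^sup>2 \<le> B\<^sup>2" "(b \<omega>)\<^sup>2 \<le> B\<^sup>2" "a \<omega> * b \<omega> \<le> B * B"
      using Suc.prems(4,5)[OF w] by (auto intro!: power_mono mult_mono)
    moreover have "0 \<le> (a \<omega>)\<^sup>2" "0 \<le> (b \<omega>)\<^sup>2" "B * B = B\<^sup>2" "0 \<le> B\<^sup>2"
      by (auto simp: power2_eq_square)
    ultimately have "\<bar>(a \<omega>)\<^sup>2 - (b \<omega>)\<^sup>2\<bar> \<le> 2 * B\<^sup>2" "2 * a \<omega> * b \<omega> \<le> 2 * B\<^sup>2"
      by linarith+
    then show "\<bar>Re (V \<omega>)\<bar> \<le> 2 * B\<^sup>2" "\<bar>Im (V \<omega>)\<bar> \<le> 2 * B\<^sup>2"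
      unfolding Suc.prems(6)[OF w] using Suc.prems(7)[OF w] by linarith+
  qed
  have int: "integrable M (\<lambda>\<omega>. a \<omega> ^ m)" "integrable M (\<lambda>\<omega>. b \<omega> ^ m)"
      "integrable M (\<lambda>\<omega>. \<bar>Re (V \<omega>)\<bar> ^ m)" "integrable M (\<lambda>\<omega>. \<bar>Im (V \<omega>)\<bar> ^ m)" for m
  proof -
    show "integrable M (\<lambda>\<omega>. a \<omega> ^ m)" "integrable M (\<lambda>\<omega>. b \<omega> ^ m)"
      using Suc.prems(4,5) by (auto intro!: integrable_bounded[where B="B ^ m"] power_mono simp: power_abs)
    show "integrable M (\<lambda>\<omega>. \<bar>Re (V \<omega>)\<bar> ^ m)" "integrable M (\<lambda>\<omega>. \<bar>Im (V \<omega>)\<bar> ^ m)"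
      using power_mono[OF bnd(1), of _ m] power_mono[OF bnd(2), of _ m]
      by (auto intro!: integrable_bounded[where B="(2 * B\<^sup>2) ^ m"])
  qed
  have "expectation (\<lambda>\<omega>. \<bar>Re (V \<omega>)\<bar> ^ q) \<le> c ^ q * expectation (\<lambda>\<omega>. \<bar>Im (V \<omega>)\<bar> ^ q)"
    unfolding q_def c_def
  proof (rule Suc.IH[of "\<lambda>\<omega>. \<bar>Im (V \<omega>)\<bar>" "\<lambda>\<omega>. \<bar>Re (V \<omega>)\<bar>" "\<lambda>\<omega>. - (V \<omega>)\<^sup>2" "2 * B\<^sup>2"])
    \<comment> \<open>The sign survives only for \<open>j = 0\<close>, and it does not matter for a
      mean that is zero.\<close>
    have "(- (z\<^sup>2)) ^ 2 ^ j = (if j = 0 then - 1 else 1) * z ^ 2 ^ Suc j" for z :: complex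
      by (cases j) (auto simp: power_mult power_minus_even)
    then show "expectation (\<lambda>\<omega>. Re ((- (V \<omega>)\<^sup>2) ^ 2 ^ j)) = 0"
      using Suc.prems(8) by auto
  qed (use bnd in \<open>auto simp: power2_eq_square abs_mult\<close>)
  \<comment> \<open>The weighted arithmetic-geometric mean inequality replaces Cauchy-Schwarz. The
    weight \<open>C ^ q\<close> gives equality where \<open>b = C * a\<close>.\<close>
  moreover have "expectation (\<lambda>\<omega>. \<bar>Im (V \<omega>)\<bar> ^ q)
      \<le> expectation (\<lambda>\<omega>. 2 ^ q / 2 * (C ^ q * a \<omega> ^ (2 * q) + b \<omega> ^ (2 * q) / C ^ q))"
  proof (rule integral_mono)
    fix \<omega> assume w: "\<omega> \<in> space M"
    have "\<bar>Im (V \<omega>)\<bar> ^ q \<le> (2 * a \<omega> * b \<omega>) ^ q"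
      using Suc.prems(7)[OF w] by (intro power_mono) auto
    also have "\<dots> = 2 ^ q * (a \<omega> ^ q * b \<omega> ^ q)"
      by (simp add: power_mult_distrib)
    also have "a \<omega> ^ q * b \<omega> ^ q \<le> (C ^ q * a \<omega> ^ (2 * q) + b \<omega> ^ (2 * q) / C ^ q) / 2"
    proof -
      define u v where "u = a \<omega> ^ q" and "v = b \<omega> ^ q"
      have "0 \<le> (C ^ q * u - v)\<^sup>2" by simp
      then have "2 * (u * v) * C ^ q \<le> C ^ q * (C ^ q * u\<^sup>2) + v\<^sup>2"
        by (simp add: power2_eq_square algebra_simps)
      then have "2 * (u * v) \<le> C ^ q * u\<^sup>2 + v\<^sup>2 / C ^ q"
        using C0 by (simp add: field_simps)
      then show ?thesis
        by (simp add: u_def v_def power_mult[symmetric] mult.commute)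
    qed
    finally show "\<bar>Im (V \<omega>)\<bar> ^ q \<le> 2 ^ q / 2 * (C ^ q * a \<omega> ^ (2 * q) + b \<omega> ^ (2 * q) / C ^ q)"
      by simp
  qed (use int in auto)
  \<comment> \<open>From \<open>b\<^sup>2 \<le> a\<^sup>2 + |Re V|\<close> and convexity. Where
    \<open>b = C * a\<close> and \<open>|Re V| = b\<^sup>2 - a\<^sup>2\<close>, both weighted
    arguments equal \<open>C\<^sup>2 * a\<^sup>2\<close>, so nothing is lost.\<close>
  moreover have "expectation (\<lambda>\<omega>. b \<omega> ^ (2 * q))
      \<le> expectation (\<lambda>\<omega>. 1 / C\<^sup>2 * C ^ (2 * q) * a \<omega> ^ (2 * q) + 2 * c / C * (C / (2 * c)) ^ q * \<bar>Re (V \<omega>)\<bar> ^ q)"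
  proof (rule integral_mono)
    fix \<omega> assume w: "\<omega> \<in> space M"
    have "b \<omega> ^ (2 * q) = ((b \<omega>)\<^sup>2) ^ q"
      by (simp add: power_mult)
    also have "\<dots> \<le> ((a \<omega>)\<^sup>2 + \<bar>Re (V \<omega>)\<bar>) ^ q"
      using Suc.prems(6)[OF w] by (intro power_mono) auto
    also have "\<dots> \<le> 1 / C\<^sup>2 * ((a \<omega>)\<^sup>2 / (1 / C\<^sup>2)) ^ q + (2 * c / C) * (\<bar>Re (V \<omega>)\<bar> / (2 * c / C)) ^ q"
      using power_add_le_weighted[OF q l(1,2), of "(a \<omega>)\<^sup>2" "\<bar>Re (V \<omega>)\<bar>"] unfolding l(3) by simp
    also have "\<dots> = 1 / C\<^sup>2 * C ^ (2 * q) * a \<omega> ^ (2 * q) + 2 * c / C * (C / (2 * c)) ^ q * \<bar>Re (V \<omega>)\<bar> ^ q"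
      by (simp add: power_mult_distrib power_divide power_mult[symmetric] mult_ac)
    finally show "b \<omega> ^ (2 * q) \<le> \<dots>" .
  qed (use int in auto)
  moreover define Ea Eb ER EI where "Ea = expectation (\<lambda>\<omega>. a \<omega> ^ (2 * q))"
    and "Eb = expectation (\<lambda>\<omega>. b \<omega> ^ (2 * q))" and "ER = expectation (\<lambda>\<omega>. \<bar>Re (V \<omega>)\<bar> ^ q)"
    and "EI = expectation (\<lambda>\<omega>. \<bar>Im (V \<omega>)\<bar> ^ q)"
  ultimately have 1: "ER \<le> c ^ q * EI" and 2: "EI \<le> 2 ^ q / 2 * (C ^ q * Ea + Eb / C ^ q)"
    and 3: "Eb \<le> 1 / C\<^sup>2 * C ^ (2 * q) * Ea + 2 * c / C * (C / (2 * c)) ^ q * ER"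
    using int by simp_all
  have "2 * c / C * (C / (2 * c)) ^ q * ER
      \<le> 2 * c / C * (C / (2 * c)) ^ q * (c ^ q * (2 ^ q / 2 * (C ^ q * Ea + Eb / C ^ q)))"
    using order_trans[OF 1 mult_left_mono[OF 2]] c0 C0 by (intro mult_left_mono) auto
  also have "\<dots> = c / C * (C ^ (2 * q) * Ea + Eb)"
  proof -
    have "(C / (2 * c)) ^ q * (c ^ q * 2 ^ q) = (C / (2 * c) * (c * 2)) ^ q"
      by (simp only: power_mult_distrib)
    also have "\<dots> = C ^ q"
      using c0 by simp
    finally have key: "(C / (2 * c)) ^ q * (c ^ q * 2 ^ q) = C ^ q" .
    have "2 * c / C * (C / (2 * c)) ^ q * (c ^ q * (2 ^ q / 2 * (C ^ q * Ea + Eb / C ^ q)))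
        = c / C * ((C / (2 * c)) ^ q * (c ^ q * 2 ^ q)) * (C ^ q * Ea + Eb / C ^ q)"
      by simp
    also have "\<dots> = c / C * (C ^ q * C ^ q * Ea + C ^ q * (Eb / C ^ q))"
      unfolding key by (simp only: distrib_left mult.assoc)
    also have "\<dots> = c / C * (C ^ (2 * q) * Ea + Eb)"
      using C0 by (simp add: mult_2 power_add)
    finally show ?thesis .
  qed
  \<comment> \<open>The term \<open>c / C * Eb\<close> from the right is absorbed on the left; by
    the choice of the weights the two remaining factors coincide.\<close>
  finally have "(1 - c / C) * Eb \<le> (1 / C\<^sup>2 + c / C) * (C ^ (2 * q) * Ea)"
    using 3 by (simp add: algebra_simps)
  also have "1 / C\<^sup>2 + c / C = 1 - c / C"
    using l(3) by simp
  finally have "Eb \<le> C ^ (2 * q) * Ea"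
    using cC by simp
  then show ?case
    unfolding q2 Ea_def Eb_def C_def by simp
qed

section \<open>Optional stopping\<close>

text \<open>Fatou's lemma in the form used to remove truncations, grids and stopping: neither a
  majorant nor finiteness of \<open>c\<close> is required.\<close>

lemma nn_integral_LIMSEQ_le:
  fixes f :: "nat \<Rightarrow> 'a \<Rightarrow> ennreal"
  assumes [measurable]: "\<And>i. f i \<in> borel_measurable M"
    and lim: "\<And>\<omega>. \<omega> \<in> space M \<Longrightarrow> (\<lambda>i. f i \<omega>) \<longlonglongrightarrow> g \<omega>"
    and le: "\<And>i. (\<integral>\<^sup>+ \<omega>. f i \<omega> \<partial>M) \<le> c"
  shows "(\<integral>\<^sup>+ \<omega>. g \<omega> \<partial>M) \<le> c"
proof -
  have "(\<integral>\<^sup>+ \<omega>. g \<omega> \<partial>M) = (\<integral>\<^sup>+ \<omega>. liminf (\<lambda>i. f i \<omega>) \<partial>M)"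
    using lim by (intro nn_integral_cong lim_imp_Liminf[symmetric]) auto
  also have "\<dots> \<le> liminf (\<lambda>i. \<integral>\<^sup>+ \<omega>. f i \<omega> \<partial>M)"
    by (rule nn_integral_liminf) auto
  also have "\<dots> \<le> limsup (\<lambda>i. \<integral>\<^sup>+ \<omega>. f i \<omega> \<partial>M)"
    by (rule Liminf_le_Limsup) simp
  also have "\<dots> \<le> c"
    using le by (intro Limsup_bounded) auto
  finally show ?thesis .
qed

section \<open>Equidistant grids and times rounded up to them\<close>

definition grid :: "real \<Rightarrow> nat \<Rightarrow> nat \<Rightarrow> real" where
  "grid T m i = T * real i / real (Suc m)"

lemma grid_nonneg [simp]: "0 \<le> T \<Longrightarrow> 0 \<le> grid T m i"
  by (simp add: grid_def)

lemma grid_mono: "0 \<le> T \<Longrightarrow> i \<le> j \<Longrightarrow> grid T m i \<le> grid T m j"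
  unfolding grid_def by (intro divide_right_mono mult_left_mono) auto

lemma grid_0 [simp]: "grid T m 0 = 0"
  by (simp add: grid_def)

lemma grid_Suc [simp]: "grid T m (Suc m) = T"
  by (simp add: grid_def field_simps del: of_nat_Suc)

lemma grid_le: "0 \<le> T \<Longrightarrow> i \<le> Suc m \<Longrightarrow> grid T m i \<le> T"
  using grid_mono[of T i "Suc m" m] by simp

lemma grid_less: "0 < T \<Longrightarrow> i < Suc m \<Longrightarrow> grid T m i < T"
  unfolding grid_def by (subst pos_divide_less_eq) (auto simp del: of_nat_Suc)

text \<open>Rounding up, as opposed to down, keeps the discretized time a stopping time.\<close>

definition stop_index :: "real \<Rightarrow> nat \<Rightarrow> real \<Rightarrow> nat" where
  "stop_index T m x = nat \<lceil>real (Suc m) * min T x / T\<rceil>"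

text \<open>The defining property of the ceiling; it turns events about the rounded time into events
  about the original one, up to the cap at \<open>T\<close>.\<close>

lemma stop_index_le_iff:
  assumes "0 < T" "0 \<le> x"
  shows "stop_index T m x \<le> i \<longleftrightarrow> min T x \<le> grid T m i"
proof -
  have "stop_index T m x \<le> i \<longleftrightarrow> real (Suc m) * min T x / T \<le> real i"
    unfolding stop_index_def by (simp add: nat_le_iff ceiling_le_iff)
  also have "\<dots> \<longleftrightarrow> min T x \<le> grid T m i"
    using assms by (simp add: grid_def field_simps)
  finally show ?thesis .
qed

lemma stop_index_zero: "stop_index 0 m x = 0"
  by (simp add: stop_index_def)

lemma stop_index_le:
  assumes "0 \<le> T" "0 \<le> x"
  shows "stop_index T m x \<le> Suc m"
proof (cases "T = 0")
  case False
  then show ?thesis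
    using assms by (subst stop_index_le_iff) auto
qed (simp add: stop_index_zero)

text \<open>Rounding up moves a time by at most one cell, of length
  \<open>T / (m + 1)\<close>.\<close>

lemma grid_stop_index_LIMSEQ:
  assumes "0 \<le> T" "0 \<le> x"
  shows "(\<lambda>m. grid T m (stop_index T m x)) \<longlonglongrightarrow> min T x"
proof (cases "T = 0")
  case True
  then show ?thesis using assms by (simp add: grid_def)
next
  case False
  then have T: "0 < T" using assms by simp
  show ?thesis
  proof (rule tendsto_sandwich)
    show "(\<lambda>m. min T x) \<longlonglongrightarrow> min T x" by simp
    have "(\<lambda>m. min T x + T * inverse (real (Suc m))) \<longlonglongrightarrow> min T x + T * 0"
      by (intro tendsto_intros LIMSEQ_inverse_real_of_nat)
    then show "(\<lambda>m. min T x + T * inverse (real (Suc m))) \<longlonglongrightarrow> min T x" by simp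
    have "min T x \<le> grid T m (stop_index T m x)" for m
      using stop_index_le_iff[OF T assms(2), of m "stop_index T m x"] by simp
    then show "\<forall>\<^sub>F m in sequentially. min T x \<le> grid T m (stop_index T m x)" by simp
    have "grid T m (stop_index T m x) \<le> min T x + T * inverse (real (Suc m))" for m
    proof -
      have nn: "0 \<le> real (Suc m) * min T x / T" using T assms by auto
      have "real (stop_index T m x) = of_int \<lceil>real (Suc m) * min T x / T\<rceil>"
        unfolding stop_index_def using nn by (subst of_nat_nat) (auto simp: order_trans[OF _ ceiling_mono[OF nn]])
      also have "\<dots> \<le> real (Suc m) * min T x / T + 1"
        by linarith
      finally have "T * real (stop_index T m x) \<le> real (Suc m) * min T x + T"
        using T by (simp add: field_simps)
      then show ?thesis
        by (simp add: grid_def field_simps del: of_nat_Suc)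
    qed
    then show "\<forall>\<^sub>F m in sequentially. grid T m (stop_index T m x) \<le> min T x + T * inverse (real (Suc m))" by simp
  qed
qed

section \<open>Martingales tested against bounded factors, and Jensen's inequality\<close>

locale filtered_prob_space = prob_space M for M :: "'a measure" +
  fixes F :: "real \<Rightarrow> 'a measure"
  assumes subalg: "0 \<le> t \<Longrightarrow> subalgebra M (F t)"
    and sets_F_mono: "0 \<le> s \<Longrightarrow> s \<le> t \<Longrightarrow> sets (F s) \<subseteq> sets (F t)"
begin

lemma space_F: "0 \<le> t \<Longrightarrow> space (F t) = space M"
  using subalg by (simp add: subalgebra_def)

lemma sets_F: "0 \<le> t \<Longrightarrow> A \<in> sets (F t) \<Longrightarrow> A \<in> sets M"
  using subalg by (auto simp: subalgebra_def)

lemma measurable_F: "0 \<le> t \<Longrightarrow> f \<in> borel_measurable (F t) \<Longrightarrow> f \<in> borel_measurable M"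
  using subalg measurable_from_subalg by blast

lemma measurable_F_mono:
  "0 \<le> s \<Longrightarrow> s \<le> t \<Longrightarrow> f \<in> borel_measurable (F s) \<Longrightarrow> f \<in> borel_measurable (F t)"
  by (rule measurable_from_subalg[of _ "F s"]) (auto simp: subalgebra_def space_F dest: sets_F_mono)

lemma sigma_finite_subalgebra_F: "0 \<le> t \<Longrightarrow> sigma_finite_subalgebra M (F t)"
  by (intro finite_measure_subalgebra_is_sigma_finite finite_measure_subalgebra.intro
      finite_measure_subalgebra_axioms.intro subalg finite_measure_axioms)

text \<open>Since \<open>g\<close> is known at time \<open>s\<close>, it can be moved across the
  conditional expectation, which replaces \<open>N t\<close> by \<open>N s\<close>. Boundedness of
  \<open>g\<close> keeps the products integrable.\<close>

lemma martingale_mult_increment: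
  assumes N: "real_martingale M F N" and st: "0 \<le> s" "s \<le> t"
    and g: "g \<in> borel_measurable (F s)" "\<And>\<omega>. \<omega> \<in> space M \<Longrightarrow> \<bar>g \<omega>\<bar> \<le> B"
  shows "integrable M (\<lambda>\<omega>. g \<omega> * (N t \<omega> - N s \<omega>))"
    and "(\<integral>\<omega>. g \<omega> * (N t \<omega> - N s \<omega>) \<partial>M) = 0"
proof -
  interpret sigma_finite_subalgebra M "F s"
    using st by (intro sigma_finite_subalgebra_F)
  have [measurable]: "g \<in> borel_measurable M"
    using g st by (auto intro: measurable_F)
  have N': "integrable M (N t)" "integrable M (N s)"
    using N st by (auto simp: real_martingale_def)
  have int: "integrable M (\<lambda>\<omega>. g \<omega> * N u \<omega>)" if "integrable M (N u)" for u
  proof (rule Bochner_Integration.integrable_bound)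
    show "integrable M (\<lambda>\<omega>. B * N u \<omega>)" using that by simp
    show "(\<lambda>\<omega>. g \<omega> * N u \<omega>) \<in> borel_measurable M" using that by measurable
    show "AE \<omega> in M. norm (g \<omega> * N u \<omega>) \<le> norm (B * N u \<omega>)"
      using g(2) by (intro AE_I2) (force simp: abs_mult intro!: mult_right_mono)
  qed
  show "integrable M (\<lambda>\<omega>. g \<omega> * (N t \<omega> - N s \<omega>))"
    using int N' by (simp add: right_diff_distrib)
  have "(\<integral>\<omega>. g \<omega> * N t \<omega> \<partial>M) = (\<integral>\<omega>. g \<omega> * real_cond_exp M (F s) (N t) \<omega> \<partial>M)"
    using int N' g(1) by (intro real_cond_exp_intg(2)[symmetric]) auto
  also have "\<dots> = (\<integral>\<omega>. g \<omega> * N s \<omega> \<partial>M)"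
  proof (rule integral_cong_AE)
    have "AE \<omega> in M. real_cond_exp M (F s) (N t) \<omega> = N s \<omega>"
      using N st by (simp add: real_martingale_def)
    then show "AE \<omega> in M. g \<omega> * real_cond_exp M (F s) (N t) \<omega> = g \<omega> * N s \<omega>"
      by eventually_elim simp
  qed (use N' in auto)
  finally show "(\<integral>\<omega>. g \<omega> * (N t \<omega> - N s \<omega>) \<partial>M) = 0"
    using int N' by (simp add: right_diff_distrib)
qed

lemma martingale_indicator:
  assumes N: "real_martingale M F N" and st: "0 \<le> s" "s \<le> t" and A: "A \<in> sets (F s)"
  shows "(\<integral>\<omega>. indicator A \<omega> * N t \<omega> \<partial>M) = (\<integral>\<omega>. indicator A \<omega> * N s \<omega> \<partial>M)"
proof -
  have [measurable]: "A \<in> sets M" using A st by (auto intro: sets_F)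
  have "(\<integral>\<omega>. indicator A \<omega> * (N t \<omega> - N s \<omega>) \<partial>M) = 0"
    using A by (intro martingale_mult_increment(2)[OF N st, where B=1]) (auto simp: indicator_def)
  moreover have "integrable M (N t)" "integrable M (N s)"
    using N st by (auto simp: real_martingale_def)
  then have "integrable M (\<lambda>\<omega>. indicator A \<omega> * N t \<omega>)" "integrable M (\<lambda>\<omega>. indicator A \<omega> * N s \<omega>)"
    by (auto intro!: integrable_indicator_mult)
  ultimately show ?thesis by (simp add: right_diff_distrib)
qed

text \<open>The hypothesis on \<open>G\<close> says that it is a subgradient, so this is Jensen's inequality.\<close>

lemma martingale_subgradient_le:
  assumes J: "finite J" "\<And>j. j \<in> J \<Longrightarrow> real_martingale M F (N j)" and st: "0 \<le> s" "s \<le> t"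
    and A: "A \<in> sets (F s)"
    and meas: "hs \<in> borel_measurable (F s)" "ht \<in> borel_measurable M"
      "\<And>j. j \<in> J \<Longrightarrow> G j \<in> borel_measurable (F s)"
    and nn: "\<And>\<omega>. \<omega> \<in> space M \<Longrightarrow> 0 \<le> hs \<omega>" "\<And>\<omega>. \<omega> \<in> space M \<Longrightarrow> 0 \<le> ht \<omega>"
    and sub: "\<And>\<omega>. \<omega> \<in> space M \<Longrightarrow> hs \<omega> + (\<Sum>j\<in>J. G j \<omega> * (N j t \<omega> - N j s \<omega>)) \<le> ht \<omega>"
  shows "(\<integral>\<^sup>+\<omega>. indicator A \<omega> * ennreal (hs \<omega>) \<partial>M) \<le> (\<integral>\<^sup>+\<omega>. indicator A \<omega> * ennreal (ht \<omega>) \<partial>M)"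
proof (cases "(\<integral>\<^sup>+\<omega>. indicator A \<omega> * ennreal (ht \<omega>) \<partial>M) = \<infinity>")
  case False
  have AM[measurable]: "A \<in> sets M" using A st by (auto intro: sets_F)
  have [measurable]: "ht \<in> borel_measurable M" "hs \<in> borel_measurable M"
    using meas st by (auto intro: measurable_F)
  \<comment> \<open>The coefficients \<open>G j\<close> need not be bounded, so the increments
    cannot be tested directly. On \<open>S R\<close> they are bounded by \<open>R\<close>, and
    \<open>S R\<close> still belongs to \<open>F s\<close>. As \<open>R\<close> grows,
    \<open>S R\<close> exhausts \<open>A\<close>, and Fatou gives the claim.\<close>
  define S where "S R = {\<omega> \<in> space M. \<omega> \<in> A \<and> hs \<omega> \<le> real R \<and> (\<forall>j\<in>J. \<bar>G j \<omega>\<bar> \<le> real R)}" for R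
  have SF: "S R \<in> sets (F s)" for R
  proof -
    note [measurable] = A meas(1,3)
    have "{\<omega> \<in> space (F s). \<omega> \<in> A \<and> hs \<omega> \<le> real R \<and> (\<forall>j\<in>J. \<bar>G j \<omega>\<bar> \<le> real R)} \<in> sets (F s)"
      using J(1) by measurable
    then show ?thesis by (simp add: S_def space_F[OF st(1)])
  qed
  then have [measurable]: "S R \<in> sets M" for R using st by (auto intro: sets_F)
  have iA: "integrable M (\<lambda>\<omega>. indicator A \<omega> * ht \<omega>)"
  proof (rule integrableI_nonneg)
    have "(\<integral>\<^sup>+\<omega>. ennreal (indicator A \<omega> * ht \<omega>) \<partial>M) = (\<integral>\<^sup>+\<omega>. indicator A \<omega> * ennreal (ht \<omega>) \<partial>M)"
      using nn by (intro nn_integral_cong) (auto simp: indicator_def)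
    then show "(\<integral>\<^sup>+\<omega>. ennreal (indicator A \<omega> * ht \<omega>) \<partial>M) < \<infinity>"
      using False by (simp add: top.not_eq_extremum)
  qed (use nn in auto)
  have bound: "(\<integral>\<^sup>+\<omega>. indicator (S R) \<omega> * ennreal (hs \<omega>) \<partial>M) \<le> (\<integral>\<^sup>+\<omega>. indicator A \<omega> * ennreal (ht \<omega>) \<partial>M)" for R
  proof -
    have ihs: "integrable M (\<lambda>\<omega>. indicator (S R) \<omega> * hs \<omega>)"
      proof (rule integrable_bounded[where B="real R"])
      show "norm (indicator (S R) \<omega> * hs \<omega>) \<le> real R" if "\<omega> \<in> space M" for \<omega>
        using nn(1)[OF that] by (auto simp: S_def indicator_def)
    qed measurable
    have iht: "integrable M (\<lambda>\<omega>. indicator (S R) \<omega> * ht \<omega>)"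
      proof (rule Bochner_Integration.integrable_bound[OF iA])
      show "AE \<omega> in M. norm (indicator (S R) \<omega> * ht \<omega>) \<le> norm (indicator A \<omega> * ht \<omega>)"
        by (auto simp: S_def indicator_def)
    qed measurable
    have G: "integrable M (\<lambda>\<omega>. (indicator (S R) \<omega> * G j \<omega>) * (N j t \<omega> - N j s \<omega>))"
      "(\<integral>\<omega>. (indicator (S R) \<omega> * G j \<omega>) * (N j t \<omega> - N j s \<omega>) \<partial>M) = 0" if j: "j \<in> J" for j
    proof -
      have "(\<lambda>\<omega>. indicator (S R) \<omega> * G j \<omega>) \<in> borel_measurable (F s)"
        using meas(3)[OF j] SF by measurable
      moreover have "\<bar>indicator (S R) \<omega> * G j \<omega>\<bar> \<le> real R" for \<omega>
        using j by (auto simp: S_def indicator_def)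
      ultimately show "integrable M (\<lambda>\<omega>. (indicator (S R) \<omega> * G j \<omega>) * (N j t \<omega> - N j s \<omega>))"
        "(\<integral>\<omega>. (indicator (S R) \<omega> * G j \<omega>) * (N j t \<omega> - N j s \<omega>) \<partial>M) = 0"
        using martingale_mult_increment[OF J(2)[OF j] st] by blast+
    qed
    have "(\<integral>\<omega>. indicator (S R) \<omega> * hs \<omega> \<partial>M)
        = (\<integral>\<omega>. indicator (S R) \<omega> * hs \<omega> + (\<Sum>j\<in>J. (indicator (S R) \<omega> * G j \<omega>) * (N j t \<omega> - N j s \<omega>)) \<partial>M)"
      using ihs G by (subst Bochner_Integration.integral_add) auto
    also have "\<dots> \<le> (\<integral>\<omega>. indicator (S R) \<omega> * ht \<omega> \<partial>M)"
      using ihs G iht sub by (intro integral_mono) (auto simp: indicator_def)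
    finally have "(\<integral>\<omega>. indicator (S R) \<omega> * hs \<omega> \<partial>M) \<le> (\<integral>\<omega>. indicator (S R) \<omega> * ht \<omega> \<partial>M)" .
    moreover have "(\<integral>\<^sup>+\<omega>. indicator (S R) \<omega> * ennreal (hs \<omega>) \<partial>M) = ennreal (\<integral>\<omega>. indicator (S R) \<omega> * hs \<omega> \<partial>M)"
      using nn by (subst nn_integral_eq_integral[OF ihs, symmetric])
        (auto intro!: nn_integral_cong simp: indicator_def)
    moreover have "(\<integral>\<^sup>+\<omega>. indicator (S R) \<omega> * ennreal (ht \<omega>) \<partial>M) = ennreal (\<integral>\<omega>. indicator (S R) \<omega> * ht \<omega> \<partial>M)"
      using nn by (subst nn_integral_eq_integral[OF iht, symmetric])
        (auto intro!: nn_integral_cong simp: indicator_def)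
    moreover have "(\<integral>\<^sup>+\<omega>. indicator (S R) \<omega> * ennreal (ht \<omega>) \<partial>M) \<le> (\<integral>\<^sup>+\<omega>. indicator A \<omega> * ennreal (ht \<omega>) \<partial>M)"
      by (intro nn_integral_mono) (auto simp: S_def indicator_def)
    ultimately show ?thesis
      by (simp add: ennreal_leI order_trans[OF ennreal_leI])
  qed
  show ?thesis
  proof (rule nn_integral_LIMSEQ_le[OF _ _ bound])
    fix \<omega> assume w: "\<omega> \<in> space M"
    obtain R0 :: nat where R0: "hs \<omega> + (\<Sum>j\<in>J. \<bar>G j \<omega>\<bar>) \<le> real R0"
      using real_arch_simple by blast
    have "indicator (S R) \<omega> * ennreal (hs \<omega>) = indicator A \<omega> * ennreal (hs \<omega>)" if "R0 \<le> R" for R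
    proof -
      have "\<bar>G j \<omega>\<bar> \<le> real R" if "j \<in> J" for j
        using R0 nn(1)[OF w] member_le_sum[of j J "\<lambda>j. \<bar>G j \<omega>\<bar>"] J(1) that \<open>R0 \<le> R\<close> by auto
      moreover have "hs \<omega> \<le> real R"
        using R0 \<open>R0 \<le> R\<close> sum_nonneg[of J "\<lambda>j. \<bar>G j \<omega>\<bar>"] of_nat_mono[OF \<open>R0 \<le> R\<close>, where 'a=real]
        by linarith
      ultimately show ?thesis using w by (auto simp: S_def indicator_def)
    qed
    then show "(\<lambda>R. indicator (S R) \<omega> * ennreal (hs \<omega>)) \<longlonglongrightarrow> indicator A \<omega> * ennreal (hs \<omega>)"
      by (intro tendsto_eventually eventually_sequentiallyI[of R0])
  qed auto
qed auto

section \<open>Optional stopping at a stopping time capped at \<open>T\<close>\<close>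

context
  fixes \<sigma> :: "'a \<Rightarrow> real" and T :: real
  assumes stop: "stopping_time_R M F \<sigma>" and T: "0 \<le> T"
begin

lemma stop_index_sets: "{\<omega> \<in> space M. stop_index T m (\<sigma> \<omega>) = i} \<in> sets (F (grid T m i))"
proof -
  have pos: "\<omega> \<in> space M \<Longrightarrow> 0 \<le> \<sigma> \<omega>" for \<omega>
    using stop by (simp add: stopping_time_R_def)
  have grid0: "0 \<le> grid T m i" for i using T by simp
  have le: "{\<omega> \<in> space M. stop_index T m (\<sigma> \<omega>) \<le> i} \<in> sets (F (grid T m i))" for i
  \<comment> \<open>From the last grid point on, the cap at \<open>T\<close> makes the event the
    whole space. Before it the grid point lies below \<open>T\<close>, the cap is inactive, and the
    event is one that the stopping time controls.\<close>
  proof (cases "T = 0 \<or> i \<ge> Suc m")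
    case True
    then have "{\<omega> \<in> space M. stop_index T m (\<sigma> \<omega>) \<le> i} = space (F (grid T m i))"
      using order_trans[OF stop_index_le[OF T pos]] by (auto simp: stop_index_zero space_F T)
    then show ?thesis by simp
  next
    case False
    then have "0 < T" "grid T m i < T"
      using T by (auto intro: grid_less)
    then have "{\<omega> \<in> space M. stop_index T m (\<sigma> \<omega>) \<le> i} = {\<omega> \<in> space M. \<sigma> \<omega> \<le> grid T m i}"
      using pos by (auto simp: stop_index_le_iff simp del: of_nat_Suc)
    then show ?thesis
      using stop grid0 by (simp add: stopping_time_R_def)
  qed
  show ?thesis
  proof (cases i)
    case 0
    then show ?thesis using le[of 0] by simp
  next
    case (Suc k)
    have "{\<omega> \<in> space M. stop_index T m (\<sigma> \<omega>) \<le> k} \<in> sets (F (grid T m i))"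
      using le[of k] sets_F_mono[OF grid0[of k], of "grid T m i"] grid_mono[OF T, of k i m] Suc
      by auto
    then have "{\<omega> \<in> space M. stop_index T m (\<sigma> \<omega>) \<le> i} - {\<omega> \<in> space M. stop_index T m (\<sigma> \<omega>) \<le> k} \<in> sets (F (grid T m i))"
      using le[of i] by auto
    also have "{\<omega> \<in> space M. stop_index T m (\<sigma> \<omega>) \<le> i} - {\<omega> \<in> space M. stop_index T m (\<sigma> \<omega>) \<le> k}
        = {\<omega> \<in> space M. stop_index T m (\<sigma> \<omega>) = i}"
      using Suc by auto
    finally show ?thesis .
  qed
qed

text \<open>The rounded time has finitely many values, so a process evaluated there is a finite sum
  of fixed-time values over level sets. The general semiring allows both \<open>real\<close> and
  \<open>ennreal\<close> summands.\<close>

lemma stop_index_sum: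
  fixes H :: "real \<Rightarrow> 'a \<Rightarrow> 'b::semiring_1"
  assumes "\<omega> \<in> space M"
  shows "H (grid T m (stop_index T m (\<sigma> \<omega>))) \<omega>
    = (\<Sum>i\<le>Suc m. indicator {\<omega> \<in> space M. stop_index T m (\<sigma> \<omega>) = i} \<omega> * H (grid T m i) \<omega>)"
proof -
  have "stop_index T m (\<sigma> \<omega>) \<le> Suc m"
    using stop assms T by (intro stop_index_le) (auto simp: stopping_time_R_def)
  then have "(\<Sum>i\<le>Suc m. if stop_index T m (\<sigma> \<omega>) = i then H (grid T m i) \<omega> else 0)
      = H (grid T m (stop_index T m (\<sigma> \<omega>))) \<omega>"
    by (subst sum.delta') auto
  then show ?thesis
    using assms by (auto simp: indicator_def intro!: sum.cong elim!: subst)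
qed

lemma measurable_stop_index:
  assumes "adapted_proc F N"
  shows "(\<lambda>\<omega>. N (grid T m (stop_index T m (\<sigma> \<omega>))) \<omega>) \<in> borel_measurable (F T)"
proof -
  have "(\<lambda>\<omega>. \<Sum>i\<le>Suc m. indicator {\<omega> \<in> space M. stop_index T m (\<sigma> \<omega>) = i} \<omega> * N (grid T m i) \<omega>)
      \<in> borel_measurable (F T)"
  proof (rule borel_measurable_sum)
    fix i assume "i \<in> {..Suc m}"
    then have *: "0 \<le> grid T m i" "grid T m i \<le> T" using T grid_le[OF T] by auto
    have "(\<lambda>\<omega>. indicator {\<omega> \<in> space M. stop_index T m (\<sigma> \<omega>) = i} \<omega> * N (grid T m i) \<omega>) \<in> borel_measurable (F (grid T m i))"
      using assms * stop_index_sets[of m i] unfolding adapted_proc_def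
      by (intro borel_measurable_times borel_measurable_indicator) auto
    then show "(\<lambda>\<omega>. indicator {\<omega> \<in> space M. stop_index T m (\<sigma> \<omega>) = i} \<omega> * N (grid T m i) \<omega>) \<in> borel_measurable (F T)"
      by (rule measurable_F_mono[OF *])
  qed
  then show ?thesis
    by (subst measurable_cong[OF stop_index_sum]) (simp add: space_F T)
qed

lemma stopped_LIMSEQ:
  assumes "continuous_proc M N" "\<omega> \<in> space M"
  shows "(\<lambda>m. N (grid T m (stop_index T m (\<sigma> \<omega>))) \<omega>) \<longlonglongrightarrow> N (min T (\<sigma> \<omega>)) \<omega>"
proof (rule continuous_on_tendsto_compose[where f="\<lambda>t. N t \<omega>" and s="{0..}"])
  have "0 \<le> \<sigma> \<omega>" using stop assms by (simp add: stopping_time_R_def)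
  then show "(\<lambda>m. grid T m (stop_index T m (\<sigma> \<omega>))) \<longlonglongrightarrow> min T (\<sigma> \<omega>)" "min T (\<sigma> \<omega>) \<in> {0..}"
    using T by (auto intro: grid_stop_index_LIMSEQ)
qed (use assms T in \<open>auto simp: continuous_proc_def\<close>)

lemma measurable_stopped:
  assumes "adapted_proc F N" "continuous_proc M N"
  shows "(\<lambda>\<omega>. N (min T (\<sigma> \<omega>)) \<omega>) \<in> borel_measurable (F T)"
  by (rule borel_measurable_LIMSEQ_real[OF stopped_LIMSEQ[OF assms(2)] measurable_stop_index[OF assms(1)]])
    (simp add: space_F T)

text \<open>The event that the rounded time is the \<open>i\<close>-th grid point is known at that
  point, so \<open>sub\<close> compares this time with \<open>T\<close> on that event; summing over
  \<open>i\<close> recovers the whole space.\<close>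

lemma submartingale_stop_index_le:
  assumes meas: "adapted_proc F H"
    and sub: "\<And>s A. 0 \<le> s \<Longrightarrow> s \<le> T \<Longrightarrow> A \<in> sets (F s) \<Longrightarrow>
      (\<integral>\<^sup>+\<omega>. indicator A \<omega> * ennreal (H s \<omega>) \<partial>M) \<le> (\<integral>\<^sup>+\<omega>. indicator A \<omega> * ennreal (H T \<omega>) \<partial>M)"
  shows "(\<integral>\<^sup>+\<omega>. ennreal (H (grid T m (stop_index T m (\<sigma> \<omega>))) \<omega>) \<partial>M) \<le> (\<integral>\<^sup>+\<omega>. ennreal (H T \<omega>) \<partial>M)"
proof -
  let ?S = "\<lambda>i. {\<omega> \<in> space M. stop_index T m (\<sigma> \<omega>) = i}"
  have [measurable]: "?S i \<in> sets M" for i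
    using stop_index_sets[of m i] T by (auto intro!: sets_F[of "grid T m i"])
  have [measurable]: "H (grid T m i) \<in> borel_measurable M" "H T \<in> borel_measurable M" for i
    using meas T measurable_F[of "grid T m i" "H (grid T m i)"] measurable_F[of T "H T"]
    by (auto simp: adapted_proc_def)
  have "(\<integral>\<^sup>+\<omega>. ennreal (H (grid T m (stop_index T m (\<sigma> \<omega>))) \<omega>) \<partial>M)
      = (\<integral>\<^sup>+\<omega>. (\<Sum>i\<le>Suc m. indicator (?S i) \<omega> * ennreal (H (grid T m i) \<omega>)) \<partial>M)"
    by (rule nn_integral_cong, rule stop_index_sum[where H="\<lambda>t \<omega>. ennreal (H t \<omega>)"])
  also have "\<dots> = (\<Sum>i\<le>Suc m. \<integral>\<^sup>+\<omega>. indicator (?S i) \<omega> * ennreal (H (grid T m i) \<omega>) \<partial>M)"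
    by (rule nn_integral_sum) measurable
  also have "\<dots> \<le> (\<Sum>i\<le>Suc m. \<integral>\<^sup>+\<omega>. indicator (?S i) \<omega> * ennreal (H T \<omega>) \<partial>M)"
    using T grid_le[OF T] by (intro sum_mono sub stop_index_sets) auto
  also have "\<dots> = (\<integral>\<^sup>+\<omega>. (\<Sum>i\<le>Suc m. indicator (?S i) \<omega> * ennreal (H T \<omega>)) \<partial>M)"
    by (rule nn_integral_sum[symmetric]) measurable
  also have "\<dots> = (\<integral>\<^sup>+\<omega>. ennreal (H T \<omega>) \<partial>M)"
    by (rule nn_integral_cong, rule stop_index_sum[where H="\<lambda>t \<omega>. ennreal (H T \<omega>)", symmetric])
  finally show ?thesis .
qed

lemma submartingale_stopped_le:
  assumes meas: "adapted_proc F H" and cont: "continuous_proc M H"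
    and sub: "\<And>s A. 0 \<le> s \<Longrightarrow> s \<le> T \<Longrightarrow> A \<in> sets (F s) \<Longrightarrow>
      (\<integral>\<^sup>+\<omega>. indicator A \<omega> * ennreal (H s \<omega>) \<partial>M) \<le> (\<integral>\<^sup>+\<omega>. indicator A \<omega> * ennreal (H T \<omega>) \<partial>M)"
  shows "(\<integral>\<^sup>+\<omega>. ennreal (H (min T (\<sigma> \<omega>)) \<omega>) \<partial>M) \<le> (\<integral>\<^sup>+\<omega>. ennreal (H T \<omega>) \<partial>M)"
proof (rule nn_integral_LIMSEQ_le[OF _ _ submartingale_stop_index_le[OF meas sub]])
  show "(\<lambda>\<omega>. ennreal (H (grid T m (stop_index T m (\<sigma> \<omega>))) \<omega>)) \<in> borel_measurable M" for m
    using measurable_F[OF T measurable_stop_index[OF meas]] by measurable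
  show "(\<lambda>m. ennreal (H (grid T m (stop_index T m (\<sigma> \<omega>))) \<omega>)) \<longlonglongrightarrow> ennreal (H (min T (\<sigma> \<omega>)) \<omega>)"
    if "\<omega> \<in> space M" for \<omega>
    using stopped_LIMSEQ[OF cont that] by (rule tendsto_ennrealI)
qed

text \<open>The function \<open>max 0 (|x| - K)\<close> is convex, with subgradient 0 on
  \<open>|x| \<le> K\<close> and \<open>sgn x\<close> outside. \<open>K = 0\<close> yields
  integrability of the stopped value; large \<open>K\<close> yields uniform integrability.\<close>

lemma martingale_excess_le:
  assumes N: "real_martingale M F N" and K: "0 \<le> K" and s: "0 \<le> s" "s \<le> T" and A: "A \<in> sets (F s)"
  shows "(\<integral>\<^sup>+\<omega>. indicator A \<omega> * ennreal (max 0 (\<bar>N s \<omega>\<bar> - K)) \<partial>M)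
    \<le> (\<integral>\<^sup>+\<omega>. indicator A \<omega> * ennreal (max 0 (\<bar>N T \<omega>\<bar> - K)) \<partial>M)"
proof (rule martingale_subgradient_le[where J="{()}" and N="\<lambda>_. N" and s=s and t=T
      and G="\<lambda>_ \<omega>. if \<bar>N s \<omega>\<bar> \<le> K then 0 else sgn (N s \<omega>)"])
  have m: "N s \<in> borel_measurable (F s)" "N T \<in> borel_measurable (F T)"
    using N s T by (auto simp: real_martingale_def adapted_proc_def)
  show "(\<lambda>\<omega>. max 0 (\<bar>N s \<omega>\<bar> - K)) \<in> borel_measurable (F s)" using m by measurable
  show "(\<lambda>\<omega>. max 0 (\<bar>N T \<omega>\<bar> - K)) \<in> borel_measurable M"
    using measurable_F[OF T m(2)] by measurable
  show "(\<lambda>\<omega>. if \<bar>N s \<omega>\<bar> \<le> K then 0 else sgn (N s \<omega>)) \<in> borel_measurable (F s)"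
    using m by measurable
qed (use N s A K in \<open>auto simp: sgn_if\<close>)

text \<open>The rounded values \<open>D m\<close> all have the mean of \<open>N T\<close> and
  converge to the stopped value, but no majorant is at hand. Uniform integrability takes its place:
  the excess of \<open>D m\<close> over \<open>K\<close> is at most that of \<open>N T\<close>, for
  all \<open>m\<close> at once.\<close>

lemma martingale_stopped_expectation:
  assumes N: "real_martingale M F N" and cont: "continuous_proc M N"
  shows "integrable M (\<lambda>\<omega>. N (min T (\<sigma> \<omega>)) \<omega>)"
    and "(\<integral>\<omega>. N (min T (\<sigma> \<omega>)) \<omega> \<partial>M) = (\<integral>\<omega>. N T \<omega> \<partial>M)"
proof -
  let ?S = "\<lambda>m i. {\<omega> \<in> space M. stop_index T m (\<sigma> \<omega>) = i}"
  define D where "D m \<omega> = N (grid T m (stop_index T m (\<sigma> \<omega>))) \<omega>" for m \<omega>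
  define E where "E \<omega> = N (min T (\<sigma> \<omega>)) \<omega>" for \<omega>
  have ad: "adapted_proc F N" and intN: "\<And>t. 0 \<le> t \<Longrightarrow> integrable M (N t)"
    using N by (auto simp: real_martingale_def)
  have DE: "(\<lambda>m. D m \<omega>) \<longlonglongrightarrow> E \<omega>" if "\<omega> \<in> space M" for \<omega>
    unfolding D_def E_def using stopped_LIMSEQ[OF cont that] .
  have [measurable]: "D m \<in> borel_measurable M" for m
    unfolding D_def using measurable_F[OF T measurable_stop_index[OF ad]] .
  have [measurable]: "E \<in> borel_measurable M"
    unfolding E_def using measurable_F[OF T measurable_stopped[OF ad cont]] .
  have [measurable]: "?S m i \<in> sets M" for m i
    using stop_index_sets[of m i] T by (auto intro!: sets_F[of "grid T m i"])
  have iT: "integrable M (N T)" using intN T by simp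
  have adK: "adapted_proc F (\<lambda>t \<omega>. max 0 (\<bar>N t \<omega>\<bar> - K))" for K
    using ad unfolding adapted_proc_def by auto
  have "(\<integral>\<^sup>+\<omega>. ennreal (max 0 (\<bar>E \<omega>\<bar> - 0)) \<partial>M) \<le> (\<integral>\<^sup>+\<omega>. ennreal (max 0 (\<bar>N T \<omega>\<bar> - 0)) \<partial>M)"
    unfolding E_def
  proof (rule submartingale_stopped_le[OF adK])
    show "continuous_proc M (\<lambda>t \<omega>. max 0 (\<bar>N t \<omega>\<bar> - 0))"
      using cont unfolding continuous_proc_def by (auto intro!: continuous_intros)
  qed (rule martingale_excess_le[OF N], auto)
  also have "\<dots> < \<infinity>"
    using iT by (simp add: integrable_iff_bounded)
  finally have iE: "integrable M E"
    by (simp add: integrable_iff_bounded)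
  then show "integrable M (\<lambda>\<omega>. N (min T (\<sigma> \<omega>)) \<omega>)" by (simp add: E_def[abs_def])
  have intS: "integrable M (\<lambda>\<omega>. indicator (?S m i) \<omega> * N t \<omega>)" if "0 \<le> t" for m i t
    using intN[OF that] by (intro integrable_indicator_mult) auto
  have Dsum: "D m \<omega> = (\<Sum>i\<le>Suc m. indicator (?S m i) \<omega> * N (grid T m i) \<omega>)" if "\<omega> \<in> space M" for m \<omega>
    unfolding D_def by (rule stop_index_sum[OF that])
  have iD: "integrable M (D m)" for m
    by (subst Bochner_Integration.integrable_cong[OF refl Dsum], assumption)
      (intro Bochner_Integration.integrable_sum intS grid_nonneg T)
  have ED: "(\<integral>\<omega>. D m \<omega> \<partial>M) = (\<integral>\<omega>. N T \<omega> \<partial>M)" for m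
  proof -
    have "(\<integral>\<omega>. D m \<omega> \<partial>M) = (\<Sum>i\<le>Suc m. \<integral>\<omega>. indicator (?S m i) \<omega> * N (grid T m i) \<omega> \<partial>M)"
      by (subst Bochner_Integration.integral_cong[OF refl Dsum], assumption)
        (intro Bochner_Integration.integral_sum intS grid_nonneg T)
    also have "\<dots> = (\<Sum>i\<le>Suc m. \<integral>\<omega>. indicator (?S m i) \<omega> * N T \<omega> \<partial>M)"
      using T grid_le[OF T] stop_index_sets by (intro sum.cong refl martingale_indicator[OF N, symmetric]) auto
    also have "\<dots> = (\<integral>\<omega>. (\<Sum>i\<le>Suc m. indicator (?S m i) \<omega> * N T \<omega>) \<partial>M)"
      by (intro Bochner_Integration.integral_sum[symmetric] intS T)
    also have "\<dots> = (\<integral>\<omega>. N T \<omega> \<partial>M)"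
      by (rule Bochner_Integration.integral_cong[OF refl], rule stop_index_sum[where H="\<lambda>t \<omega>. N T \<omega>", symmetric])
    finally show ?thesis .
  qed
  \<comment> \<open>What truncation at level \<open>K\<close> removes from \<open>x\<close> is
    exactly the excess \<open>max 0 (|x| - K)\<close>. For fixed \<open>K\<close> the grid is
    refined by bounded convergence at cost \<open>e K\<close>; afterwards \<open>K\<close> tends to
    infinity and \<open>e K\<close> to 0.\<close>
  define clip where "clip K x = max (- real K) (min (real K) x)" for K :: nat and x :: real
  define e where "e K = (\<integral>\<omega>. max 0 (\<bar>N T \<omega>\<bar> - real K) \<partial>M)" for K :: nat
  have clip_bound: "\<bar>clip K x\<bar> \<le> real K" "\<bar>clip K x\<bar> \<le> \<bar>x\<bar>" "\<bar>x - clip K x\<bar> = max 0 (\<bar>x\<bar> - real K)" for K x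
    by (auto simp: clip_def)
  have clip_meas[measurable]: "clip K \<in> borel_measurable borel" for K
    unfolding clip_def by measurable
  have clipE: "\<bar>(\<integral>\<omega>. N T \<omega> \<partial>M) - (\<integral>\<omega>. clip K (E \<omega>) \<partial>M)\<bar> \<le> e K" for K
  proof -
    have iC: "integrable M (\<lambda>\<omega>. clip K (D m \<omega>))" for m
      by (rule integrable_bounded[where B="real K"]) (auto intro: clip_bound)
    have "\<bar>(\<integral>\<omega>. N T \<omega> \<partial>M) - (\<integral>\<omega>. clip K (D m \<omega>) \<partial>M)\<bar> \<le> e K" for m
    proof -
      have "\<bar>(\<integral>\<omega>. N T \<omega> \<partial>M) - (\<integral>\<omega>. clip K (D m \<omega>) \<partial>M)\<bar> = \<bar>\<integral>\<omega>. D m \<omega> - clip K (D m \<omega>) \<partial>M\<bar>"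
        using iC iD ED by simp
      also have "\<dots> \<le> (\<integral>\<omega>. \<bar>D m \<omega> - clip K (D m \<omega>)\<bar> \<partial>M)"
        by (rule integral_abs_bound)
      also have "\<dots> = (\<integral>\<omega>. max 0 (\<bar>D m \<omega>\<bar> - real K) \<partial>M)"
        by (simp add: clip_bound)
      finally have 1: "\<bar>(\<integral>\<omega>. N T \<omega> \<partial>M) - (\<integral>\<omega>. clip K (D m \<omega>) \<partial>M)\<bar> \<le> (\<integral>\<omega>. max 0 (\<bar>D m \<omega>\<bar> - real K) \<partial>M)" .
      have i1: "integrable M (\<lambda>\<omega>. max 0 (\<bar>D m \<omega>\<bar> - real K))"
        by (rule Bochner_Integration.integrable_bound[OF iD[of m]]) auto
      have i2: "integrable M (\<lambda>\<omega>. max 0 (\<bar>N T \<omega>\<bar> - real K))"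
        by (rule Bochner_Integration.integrable_bound[OF iT]) (use iT in auto)
      have "(\<integral>\<^sup>+\<omega>. ennreal (max 0 (\<bar>D m \<omega>\<bar> - real K)) \<partial>M) \<le> (\<integral>\<^sup>+\<omega>. ennreal (max 0 (\<bar>N T \<omega>\<bar> - real K)) \<partial>M)"
        unfolding D_def
        by (rule submartingale_stop_index_le[OF adK], rule martingale_excess_le[OF N]) auto
      then have "ennreal (\<integral>\<omega>. max 0 (\<bar>D m \<omega>\<bar> - real K) \<partial>M) \<le> ennreal (e K)"
        unfolding e_def by (subst (1 2) nn_integral_eq_integral[symmetric]) (auto intro: i1 i2 simp del: ennreal_max_0)
      then have "(\<integral>\<omega>. max 0 (\<bar>D m \<omega>\<bar> - real K) \<partial>M) \<le> e K"
        by (subst (asm) ennreal_le_iff) (auto simp: e_def intro!: integral_nonneg_AE)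
      with 1 show ?thesis by simp
    qed
    moreover have "(\<lambda>m. \<integral>\<omega>. clip K (D m \<omega>) \<partial>M) \<longlonglongrightarrow> (\<integral>\<omega>. clip K (E \<omega>) \<partial>M)"
    proof (rule integral_dominated_convergence[where w="\<lambda>_. real K"])
      show "AE \<omega> in M. (\<lambda>m. clip K (D m \<omega>)) \<longlonglongrightarrow> clip K (E \<omega>)"
        unfolding clip_def by (intro AE_I2 tendsto_intros DE)
    qed (auto intro: clip_bound)
    then have "(\<lambda>m. \<bar>(\<integral>\<omega>. N T \<omega> \<partial>M) - (\<integral>\<omega>. clip K (D m \<omega>) \<partial>M)\<bar>) \<longlonglongrightarrow> \<bar>(\<integral>\<omega>. N T \<omega> \<partial>M) - (\<integral>\<omega>. clip K (E \<omega>) \<partial>M)\<bar>"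
      by (intro tendsto_intros)
    ultimately show ?thesis
      by (intro LIMSEQ_le_const2) auto
  qed
  have "(\<lambda>K. \<integral>\<omega>. clip K (E \<omega>) \<partial>M) \<longlonglongrightarrow> (\<integral>\<omega>. E \<omega> \<partial>M)"
  proof (rule integral_dominated_convergence[where w="\<lambda>\<omega>. \<bar>E \<omega>\<bar>"])
    have "(\<lambda>K. clip K x) \<longlonglongrightarrow> x" for x
    proof -
      obtain K0 :: nat where "\<bar>x\<bar> \<le> real K0" using real_arch_simple by blast
      then show ?thesis
        by (intro tendsto_eventually eventually_sequentiallyI[of K0]) (auto simp: clip_def)
    qed
    then show "AE \<omega> in M. (\<lambda>K. clip K (E \<omega>)) \<longlonglongrightarrow> E \<omega>" by simp
  qed (use iE in \<open>auto intro: clip_bound\<close>)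
  then have lim1: "(\<lambda>K. \<bar>(\<integral>\<omega>. N T \<omega> \<partial>M) - (\<integral>\<omega>. clip K (E \<omega>) \<partial>M)\<bar>) \<longlonglongrightarrow> \<bar>(\<integral>\<omega>. N T \<omega> \<partial>M) - (\<integral>\<omega>. E \<omega> \<partial>M)\<bar>"
    by (intro tendsto_intros)
  have "e \<longlonglongrightarrow> (\<integral>\<omega>. 0 \<partial>M)"
    unfolding e_def
  proof (rule integral_dominated_convergence[where w="\<lambda>\<omega>. \<bar>N T \<omega>\<bar>"])
    have "(\<lambda>K. max 0 (\<bar>x\<bar> - real K)) \<longlonglongrightarrow> 0" for x
    proof -
      obtain K0 :: nat where "\<bar>x\<bar> \<le> real K0" using real_arch_simple by blast
      then show ?thesis
        by (intro tendsto_eventually eventually_sequentiallyI[of K0]) auto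
    qed
    then show "AE \<omega> in M. (\<lambda>K. max 0 (\<bar>N T \<omega>\<bar> - real K)) \<longlonglongrightarrow> 0" by simp
  qed (use iT in auto)
  then have "\<bar>(\<integral>\<omega>. N T \<omega> \<partial>M) - (\<integral>\<omega>. E \<omega> \<partial>M)\<bar> \<le> 0"
    using clipE by (intro LIMSEQ_le[OF lim1]) auto
  then show "(\<integral>\<omega>. N (min T (\<sigma> \<omega>)) \<omega> \<partial>M) = (\<integral>\<omega>. N T \<omega> \<partial>M)"
    by (simp add: E_def)
qed

end

lemma stopping_time_min:
  assumes "stopping_time_R M F \<sigma>" "stopping_time_R M F \<tau>"
  shows "stopping_time_R M F (\<lambda>\<omega>. min (\<sigma> \<omega>) (\<tau> \<omega>))"
  unfolding stopping_time_R_def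
proof (intro conjI allI impI)
  fix t :: real assume t: "0 \<le> t"
  have "{\<omega> \<in> space M. min (\<sigma> \<omega>) (\<tau> \<omega>) \<le> t} = {\<omega> \<in> space M. \<sigma> \<omega> \<le> t} \<union> {\<omega> \<in> space M. \<tau> \<omega> \<le> t}"
    by (auto simp: min_le_iff_disj)
  also have "\<dots> \<in> sets (F t)"
    using assms t by (intro sets.Un) (simp_all add: stopping_time_R_def)
  finally show "{\<omega> \<in> space M. min (\<sigma> \<omega>) (\<tau> \<omega>) \<le> t} \<in> sets (F t)" .
qed (use assms in \<open>simp add: stopping_time_R_def\<close>)

lemma stopping_time_two_valued:
  assumes "0 \<le> s" "s \<le> t" "A \<in> sets (F s)"
  shows "stopping_time_R M F (\<lambda>\<omega>. if \<omega> \<in> A then s else t)"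
  unfolding stopping_time_R_def
proof (intro conjI allI impI)
  fix u :: real assume u: "0 \<le> u"
  have "{\<omega> \<in> space M. (if \<omega> \<in> A then s else t) \<le> u} = (if t \<le> u then space M else if s \<le> u then A else {})"
    using assms sets.sets_into_space[OF assms(3)] by (auto simp: space_F)
  moreover have "space M \<in> sets (F u)"
    using sets.top[of "F u"] by (simp add: space_F u)
  moreover have "s \<le> u \<Longrightarrow> A \<in> sets (F u)"
    using assms sets_F_mono by auto
  ultimately show "{\<omega> \<in> space M. (if \<omega> \<in> A then s else t) \<le> u} \<in> sets (F u)"
    by auto
qed (use assms in auto)

text \<open>The martingale property is tested on \<open>A\<close> by applying optional stopping to \<open>\<sigma>\<close> and to the
  stopping time that equals \<open>min \<sigma> s\<close> on \<open>A\<close> and \<open>min \<sigma> t\<close> elsewhere.\<close>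

lemma martingale_stopped:
  assumes N: "real_martingale M F N" and cont: "continuous_proc M N" and stop: "stopping_time_R M F \<sigma>"
  shows "real_martingale M F (\<lambda>t \<omega>. N (min t (\<sigma> \<omega>)) \<omega>)"
  unfolding real_martingale_def
proof (intro conjI allI impI)
  have ad: "adapted_proc F N" using N by (simp add: real_martingale_def)
  show "adapted_proc F (\<lambda>t \<omega>. N (min t (\<sigma> \<omega>)) \<omega>)"
    unfolding adapted_proc_def using measurable_stopped[OF stop _ ad cont] by blast
  show int: "integrable M (\<lambda>\<omega>. N (min t (\<sigma> \<omega>)) \<omega>)" if "0 \<le> t" for t
    using martingale_stopped_expectation(1)[OF stop that N cont] .
  fix s t :: real assume st: "0 \<le> s" "s \<le> t"
  interpret sigma_finite_subalgebra M "F s"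
    using st by (intro sigma_finite_subalgebra_F)
  show "AE \<omega> in M. real_cond_exp M (F s) (\<lambda>\<omega>. N (min t (\<sigma> \<omega>)) \<omega>) \<omega> = N (min s (\<sigma> \<omega>)) \<omega>"
  proof (rule real_cond_exp_charact)
    fix A assume A: "A \<in> sets (F s)"
    then have [measurable]: "A \<in> sets M" using st by (auto intro: sets_F)
    define \<rho> where "\<rho> \<omega> = min (\<sigma> \<omega>) (if \<omega> \<in> A then s else t)" for \<omega>
    have \<rho>: "stopping_time_R M F \<rho>"
      unfolding \<rho>_def by (intro stopping_time_min stop stopping_time_two_valued st A)
    have t: "0 \<le> t" using st by simp
    have indi: "integrable M (\<lambda>\<omega>. indicator A \<omega> * N (min u (\<sigma> \<omega>)) \<omega>)" if "0 \<le> u" for u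
      using int[OF that] by (intro integrable_indicator_mult) auto
    \<comment> \<open>Both sides equal the mean of \<open>N t\<close>. The two stopping times agree
      off \<open>A\<close>, so subtracting the common part leaves the identity of the integrals over
      \<open>A\<close>.\<close>
    have "(\<integral>\<omega>. N (min t (\<sigma> \<omega>)) \<omega> \<partial>M) = (\<integral>\<omega>. N (min t (\<rho> \<omega>)) \<omega> \<partial>M)"
      using martingale_stopped_expectation(2)[OF stop t N cont]
        martingale_stopped_expectation(2)[OF \<rho> t N cont] by simp
    also have "\<dots> = (\<integral>\<omega>. indicator A \<omega> * N (min s (\<sigma> \<omega>)) \<omega> + (N (min t (\<sigma> \<omega>)) \<omega> - indicator A \<omega> * N (min t (\<sigma> \<omega>)) \<omega>) \<partial>M)"
      using st by (intro Bochner_Integration.integral_cong refl)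
        (auto simp: \<rho>_def indicator_def min.commute min.left_commute min.absorb1)
    also have "\<dots> = (\<integral>\<omega>. indicator A \<omega> * N (min s (\<sigma> \<omega>)) \<omega> \<partial>M)
        + ((\<integral>\<omega>. N (min t (\<sigma> \<omega>)) \<omega> \<partial>M) - (\<integral>\<omega>. indicator A \<omega> * N (min t (\<sigma> \<omega>)) \<omega> \<partial>M))"
      using int indi st by simp
    finally show "set_lebesgue_integral M A (\<lambda>\<omega>. N (min t (\<sigma> \<omega>)) \<omega>) = set_lebesgue_integral M A (\<lambda>\<omega>. N (min s (\<sigma> \<omega>)) \<omega>)"
      by (simp add: set_lebesgue_integral_def)
  qed (use int st measurable_stopped[OF stop _ ad cont] in auto)
qed

end

section \<open>Products of bounded orthogonal martingales\<close>

lemma nonpos_if_le_divide: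
  fixes x c :: real
  assumes "\<And>l. 0 < l \<Longrightarrow> x \<le> c / l"
  shows "x \<le> 0"
proof (rule tendsto_lowerbound[of "\<lambda>l. c / l" 0 at_top])
  show "((\<lambda>l. c / l) \<longlongrightarrow> 0) at_top"
    by (intro real_tendsto_divide_at_top[OF tendsto_const filterlim_ident])
  show "\<forall>\<^sub>F l in at_top. x \<le> c / l"
    using eventually_gt_at_top[of 0] by eventually_elim (rule assms)
qed simp

text \<open>A crude Young inequality. A free \<open>l\<close> lets a factor that tends to zero carry
  the large weight, while a factor that is merely bounded in second moment contributes only a
  multiple of \<open>1 / l\<close>.\<close>

lemma mult_le_weighted_squares:
  fixes a b l :: real
  assumes "0 < l"
  shows "a * b \<le> l * a\<^sup>2 + b\<^sup>2 / l"
proof -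
  have "0 \<le> (l * a - b)\<^sup>2 + (l * a)\<^sup>2 + b\<^sup>2" by simp
  then have "a * b * l \<le> l * (l * a\<^sup>2) + b\<^sup>2"
    by (simp add: power2_eq_square algebra_simps)
  then show ?thesis using assms by (simp add: field_simps)
qed

lemma measurable_cnj [measurable]: "cnj \<in> borel_measurable borel"
  by (intro borel_measurable_continuous_onI continuous_intros)

text \<open>The square of the sum is the sum of \<open>2 * e k\<close> times the later terms plus
  \<open>(e k)\<^sup>2\<close>. The first part costs \<open>2 * c\<close> per unit of
  \<open>e k\<close> by \<open>tail\<close>, the second costs \<open>b\<close>, and the total mean
  is at most \<open>c\<close>. In the application \<open>e k\<close> are squared increments.\<close>

lemma (in prob_space) tail_sum_second_moment:
  fixes e :: "nat \<Rightarrow> 'a \<Rightarrow> real"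
  assumes [measurable]: "\<And>k. k < N \<Longrightarrow> e k \<in> borel_measurable M"
    and e: "\<And>k \<omega>. k < N \<Longrightarrow> \<omega> \<in> space M \<Longrightarrow> 0 \<le> e k \<omega> \<and> e k \<omega> \<le> b"
    and tail: "\<And>k. k < N \<Longrightarrow> expectation (\<lambda>\<omega>. e k \<omega> * (\<Sum>l\<in>{Suc k..<N}. e l \<omega>)) \<le> c * expectation (e k)"
    and first: "expectation (\<lambda>\<omega>. \<Sum>k<N. e k \<omega>) \<le> c" and c: "0 \<le> c" "0 \<le> b"
  shows "expectation (\<lambda>\<omega>. (\<Sum>k<N. e k \<omega>)\<^sup>2) \<le> (2 * c + b) * c"
proof -
  define S where "S k \<omega> = (\<Sum>l\<in>{k..<N}. e l \<omega>)" for k \<omega>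
  have [measurable]: "S k \<in> borel_measurable M" for k
    unfolding S_def by measurable
  have S: "0 \<le> S k \<omega>" "S k \<omega> \<le> real N * b" if w: "\<omega> \<in> space M" for k \<omega>
  proof -
    show "0 \<le> S k \<omega>" unfolding S_def using e w by (intro sum_nonneg) auto
    have "S k \<omega> \<le> (\<Sum>l\<in>{k..<N}. b)" unfolding S_def using e w by (intro sum_mono) auto
    also have "\<dots> \<le> real N * b" using c by (auto intro: mult_right_mono)
    finally show "S k \<omega> \<le> real N * b" .
  qed
  have ie: "integrable M (e k)" if "k < N" for k
    using e that by (intro integrable_bounded[where B=b]) auto
  have ieS: "integrable M (\<lambda>\<omega>. e k \<omega> * S (Suc k) \<omega>)" if "k < N" for k
    using e S that by (intro integrable_bounded[where B="b * (real N * b)"])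
      (auto simp: abs_mult intro!: mult_mono c)
  have iee: "integrable M (\<lambda>\<omega>. (e k \<omega>)\<^sup>2)" if "k < N" for k
    using e that by (intro integrable_bounded[where B="b\<^sup>2"]) (auto intro!: power_mono)
  have split: "(\<Sum>k<N. e k \<omega>)\<^sup>2 = (\<Sum>k<N. 2 * (e k \<omega> * S (Suc k) \<omega>) + (e k \<omega>)\<^sup>2)" for \<omega>
  proof -
    have "(\<Sum>k<N. e k \<omega>)\<^sup>2 = (S 0 \<omega>)\<^sup>2 - (S N \<omega>)\<^sup>2"
      by (simp add: S_def lessThan_atLeast0)
    also have "\<dots> = (\<Sum>k<N. (S k \<omega>)\<^sup>2 - (S (Suc k) \<omega>)\<^sup>2)"
      by (rule sum_lessThan_telescope'[symmetric])
    also have "\<dots> = (\<Sum>k<N. 2 * (e k \<omega> * S (Suc k) \<omega>) + (e k \<omega>)\<^sup>2)"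
    proof (rule sum.cong[OF refl])
      fix k assume "k \<in> {..<N}"
      then have "S k \<omega> = e k \<omega> + S (Suc k) \<omega>"
        by (simp add: S_def sum.atLeast_Suc_lessThan)
      then show "(S k \<omega>)\<^sup>2 - (S (Suc k) \<omega>)\<^sup>2 = 2 * (e k \<omega> * S (Suc k) \<omega>) + (e k \<omega>)\<^sup>2"
        by (simp add: power2_eq_square algebra_simps)
    qed
    finally show ?thesis .
  qed
  have "expectation (\<lambda>\<omega>. (\<Sum>k<N. e k \<omega>)\<^sup>2)
      = (\<Sum>k<N. 2 * expectation (\<lambda>\<omega>. e k \<omega> * S (Suc k) \<omega>) + expectation (\<lambda>\<omega>. (e k \<omega>)\<^sup>2))"
    unfolding split using ieS iee by simp
  also have "\<dots> \<le> (\<Sum>k<N. (2 * c + b) * expectation (e k))"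
  proof (rule sum_mono)
    fix k assume k: "k \<in> {..<N}"
    have "expectation (\<lambda>\<omega>. (e k \<omega>)\<^sup>2) \<le> expectation (\<lambda>\<omega>. b * e k \<omega>)"
      using iee ie e k by (intro integral_mono) (auto simp: power2_eq_square intro!: mult_right_mono)
    then show "2 * expectation (\<lambda>\<omega>. e k \<omega> * S (Suc k) \<omega>) + expectation (\<lambda>\<omega>. (e k \<omega>)\<^sup>2) \<le> (2 * c + b) * expectation (e k)"
      using tail[of k] k ie by (simp add: S_def algebra_simps)
  qed
  also have "\<dots> = (2 * c + b) * expectation (\<lambda>\<omega>. \<Sum>k<N. e k \<omega>)"
    using ie by (simp add: sum_distrib_left)
  also have "\<dots> \<le> (2 * c + b) * c"
    using first c by (intro mult_left_mono) auto
  finally show ?thesis .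
qed

context filtered_prob_space
begin

text \<open>The martingale property of a complex process, tested against bounded complex factors.
  Integrability of the increments is not part of it, and a non-integrable integrand satisfies the
  equation by the convention for the Bochner integral; boundedness of the processes supplies
  integrability where it matters.\<close>

definition orthogonal_increments :: "(real \<Rightarrow> 'a \<Rightarrow> complex) \<Rightarrow> bool" where
  "orthogonal_increments V \<longleftrightarrow> (\<forall>s t g B. 0 \<le> s \<longrightarrow> s \<le> t \<longrightarrow> g \<in> borel_measurable (F s) \<longrightarrow>
     (\<forall>\<omega>\<in>space M. norm (g \<omega>) \<le> B) \<longrightarrow> (\<integral>\<omega>. g \<omega> * (V t \<omega> - V s \<omega>) \<partial>M) = 0)"

lemma orthogonal_incrementsD:
  "orthogonal_increments V \<Longrightarrow> 0 \<le> s \<Longrightarrow> s \<le> t \<Longrightarrow> g \<in> borel_measurable (F s) \<Longrightarrow>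
    (\<And>\<omega>. \<omega> \<in> space M \<Longrightarrow> norm (g \<omega>) \<le> B) \<Longrightarrow> (\<integral>\<omega>. g \<omega> * (V t \<omega> - V s \<omega>) \<partial>M) = 0"
  unfolding orthogonal_increments_def by blast

text \<open>The complex product splits into four real products, each of which has mean zero by
  \<open>martingale_mult_increment\<close>.\<close>

lemma martingale_orthogonal_increments:
  assumes "real_martingale M F (\<lambda>t \<omega>. Re (V t \<omega>))" "real_martingale M F (\<lambda>t \<omega>. Im (V t \<omega>))"
  shows "orthogonal_increments V"
  unfolding orthogonal_increments_def
proof (intro allI impI)
  fix s t B and g :: "'a \<Rightarrow> complex"
  assume st: "0 \<le> s" "s \<le> t" and [measurable]: "g \<in> borel_measurable (F s)"
    and B: "\<forall>\<omega>\<in>space M. norm (g \<omega>) \<le> B"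
  have Re: "(\<lambda>\<omega>. Re (g \<omega>)) \<in> borel_measurable (F s)" "\<And>\<omega>. \<omega> \<in> space M \<Longrightarrow> \<bar>Re (g \<omega>)\<bar> \<le> B"
    using B by (auto intro: order_trans[OF abs_Re_le_cmod])
  have Im: "(\<lambda>\<omega>. Im (g \<omega>)) \<in> borel_measurable (F s)" "\<And>\<omega>. \<omega> \<in> space M \<Longrightarrow> \<bar>Im (g \<omega>)\<bar> \<le> B"
    using B by (auto intro: order_trans[OF abs_Im_le_cmod])
  note facts = martingale_mult_increment[OF assms(1) st Re] martingale_mult_increment[OF assms(1) st Im]
    martingale_mult_increment[OF assms(2) st Re] martingale_mult_increment[OF assms(2) st Im]
  have "(\<integral>\<omega>. g \<omega> * (V t \<omega> - V s \<omega>) \<partial>M) =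
    (\<integral>\<omega>. of_real (Re (g \<omega>) * (Re (V t \<omega>) - Re (V s \<omega>)) - Im (g \<omega>) * (Im (V t \<omega>) - Im (V s \<omega>)))
       + \<i> * of_real (Re (g \<omega>) * (Im (V t \<omega>) - Im (V s \<omega>)) + Im (g \<omega>) * (Re (V t \<omega>) - Re (V s \<omega>))) \<partial>M)"
    by (intro Bochner_Integration.integral_cong refl) (auto simp: complex_eq_iff)
  also have "\<dots> = (\<integral>\<omega>. of_real (Re (g \<omega>) * (Re (V t \<omega>) - Re (V s \<omega>)) - Im (g \<omega>) * (Im (V t \<omega>) - Im (V s \<omega>))) \<partial>M)
       + \<i> * (\<integral>\<omega>. of_real (Re (g \<omega>) * (Im (V t \<omega>) - Im (V s \<omega>)) + Im (g \<omega>) * (Re (V t \<omega>) - Re (V s \<omega>))) \<partial>M)"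
    using facts by (subst Bochner_Integration.integral_add) (auto simp del: of_real_mult of_real_diff of_real_add
        intro!: integrable_mult_right integrable_of_real Bochner_Integration.integrable_add Bochner_Integration.integrable_diff)
  also have "\<dots> = 0"
    unfolding integral_complex_of_real using facts by simp
  finally show "(\<integral>\<omega>. g \<omega> * (V t \<omega> - V s \<omega>) \<partial>M) = 0" .
qed

section \<open>Products of a finite family of bounded complex martingales\<close>

context
  fixes I :: "'i set" and z :: "'i \<Rightarrow> real \<Rightarrow> 'a \<Rightarrow> complex" and R :: real
  assumes fin: "finite I"
    and ad: "\<And>i t. i \<in> I \<Longrightarrow> 0 \<le> t \<Longrightarrow> z i t \<in> borel_measurable (F t)"
    and bd: "\<And>i t \<omega>. i \<in> I \<Longrightarrow> 0 \<le> t \<Longrightarrow> \<omega> \<in> space M \<Longrightarrow> norm (z i t \<omega>) \<le> R"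
    and R: "1 \<le> R"
    and orth1: "\<And>i. i \<in> I \<Longrightarrow> orthogonal_increments (z i)"
begin

lemma measurable_z: "i \<in> I \<Longrightarrow> 0 \<le> t \<Longrightarrow> z i t \<in> borel_measurable M"
  using ad measurable_F by blast

lemma measurable_z_mono: "i \<in> I \<Longrightarrow> 0 \<le> s \<Longrightarrow> s \<le> t \<Longrightarrow> z i s \<in> borel_measurable (F t)"
  using ad measurable_F_mono by blast

text \<open>\<open>incr\<close> dominates each single increment, so its cube controls all terms of
  order three and higher. \<open>sq_incr\<close> telescopes in mean along a grid.
  \<open>incr_square_le\<close> links the two.\<close>

definition "incr s t \<omega> = (\<Sum>i\<in>I. norm (z i t \<omega> - z i s \<omega>))"
definition "sq_incr s t \<omega> = (\<Sum>i\<in>I. (norm (z i t \<omega> - z i s \<omega>))\<^sup>2)"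

lemma incr_measurable: "0 \<le> s \<Longrightarrow> 0 \<le> t \<Longrightarrow> incr s t \<in> borel_measurable M"
  unfolding incr_def using measurable_z by measurable

lemma sq_incr_measurable: "0 \<le> s \<Longrightarrow> s \<le> t \<Longrightarrow> sq_incr s t \<in> borel_measurable (F t)"
  unfolding sq_incr_def using measurable_z_mono[of _ s t] ad[of _ t] by measurable

lemma diff_bound: "i \<in> I \<Longrightarrow> 0 \<le> s \<Longrightarrow> 0 \<le> t \<Longrightarrow> \<omega> \<in> space M \<Longrightarrow> norm (z i t \<omega> - z i s \<omega>) \<le> 2 * R"
  using bd[of i s \<omega>] bd[of i t \<omega>] norm_triangle_ineq4[of "z i t \<omega>" "z i s \<omega>"] by simp

lemma incr_bound:
  assumes "0 \<le> s" "0 \<le> t" "\<omega> \<in> space M"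
  shows "0 \<le> incr s t \<omega>" "incr s t \<omega> \<le> 2 * R * real (card I)"
  unfolding incr_def using sum_bounded_above[of I "\<lambda>i. norm (z i t \<omega> - z i s \<omega>)" "2 * R"] diff_bound assms
  by (auto intro!: sum_nonneg simp: mult_ac)

lemma sq_incr_bound:
  assumes "0 \<le> s" "0 \<le> t" "\<omega> \<in> space M"
  shows "0 \<le> sq_incr s t \<omega>" "sq_incr s t \<omega> \<le> 4 * R\<^sup>2 * real (card I)"
proof -
  show "0 \<le> sq_incr s t \<omega>" unfolding sq_incr_def by (intro sum_nonneg) auto
  have "(norm (z i t \<omega> - z i s \<omega>))\<^sup>2 \<le> 4 * R\<^sup>2" if "i \<in> I" for i
    using power_mono[OF diff_bound[OF that assms], of 2] by (simp add: power_mult_distrib)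
  then show "sq_incr s t \<omega> \<le> 4 * R\<^sup>2 * real (card I)"
    unfolding sq_incr_def using sum_bounded_above[of I "\<lambda>i. (norm (z i t \<omega> - z i s \<omega>))\<^sup>2" "4 * R\<^sup>2"]
    by (simp add: mult_ac)
qed

lemma incr_square_le: "(incr s t \<omega>)\<^sup>2 \<le> real (card I) * sq_incr s t \<omega>"
  unfolding incr_def sq_incr_def
  using sum_squared_le_sum_of_squares[of "\<lambda>i. norm (z i t \<omega> - z i s \<omega>)" I] by (simp add: mult.commute)

text \<open>For each coordinate, the squared increment equals the increment of the squared norm
  minus twice the real part of \<open>cnj (z i s) * (z i t - z i s)\<close>. Multiplied by
  \<open>h\<close>, this last term has mean zero, because \<open>h * cnj (z i s)\<close> is bounded
  and known at time \<open>s\<close>.\<close>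

lemma expectation_mult_sq_incr:
  assumes st: "0 \<le> s" "s \<le> t" and h: "h \<in> borel_measurable (F s)" "\<And>\<omega>. \<omega> \<in> space M \<Longrightarrow> \<bar>h \<omega>\<bar> \<le> B"
  shows "expectation (\<lambda>\<omega>. h \<omega> * sq_incr s t \<omega>)
    = expectation (\<lambda>\<omega>. h \<omega> * (\<Sum>i\<in>I. (norm (z i t \<omega>))\<^sup>2)) - expectation (\<lambda>\<omega>. h \<omega> * (\<Sum>i\<in>I. (norm (z i s \<omega>))\<^sup>2))"
proof -
  have [measurable]: "h \<in> borel_measurable M" using h st measurable_F by blast
  have t: "0 \<le> t" using st by simp
  have B: "0 \<le> B" using h(2) not_empty by (metis abs_ge_zero all_not_in_conv order_trans)
  have i2: "integrable M (\<lambda>\<omega>. h \<omega> * (norm (z i u \<omega>))\<^sup>2)" if "i \<in> I" "0 \<le> u" for i u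
    using measurable_z[OF that] h(2) bd[OF that] B
    by (intro integrable_bounded[where B="B * R\<^sup>2"]) (auto simp: abs_mult intro!: mult_mono power_mono)
  have ic: "integrable M (\<lambda>\<omega>. of_real (h \<omega>) * cnj (z i s \<omega>) * (z i t \<omega> - z i s \<omega>))" if i: "i \<in> I" for i
    using measurable_z[OF i st(1)] measurable_z[OF i t] h(2) bd[OF i st(1)] diff_bound[OF i st(1) t] B R
    by (intro integrable_bounded[where B="B * R * (2 * R)"]) (auto simp: norm_mult intro!: mult_mono)
  have one: "expectation (\<lambda>\<omega>. h \<omega> * (norm (z i t \<omega> - z i s \<omega>))\<^sup>2)
      = expectation (\<lambda>\<omega>. h \<omega> * (norm (z i t \<omega>))\<^sup>2) - expectation (\<lambda>\<omega>. h \<omega> * (norm (z i s \<omega>))\<^sup>2)"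
    and int: "integrable M (\<lambda>\<omega>. h \<omega> * (norm (z i t \<omega> - z i s \<omega>))\<^sup>2)" if i: "i \<in> I" for i
  proof -
    define u where "u \<omega> = Re (of_real (h \<omega>) * cnj (z i s \<omega>) * (z i t \<omega> - z i s \<omega>))" for \<omega>
    have eq: "h \<omega> * (norm (z i t \<omega> - z i s \<omega>))\<^sup>2
        = h \<omega> * (norm (z i t \<omega>))\<^sup>2 - h \<omega> * (norm (z i s \<omega>))\<^sup>2 - 2 * u \<omega>" for \<omega>
      unfolding cmod_power2 u_def by (simp add: power2_eq_square algebra_simps)
    have iRe: "integrable M u"
      unfolding u_def by (rule integrable_Re[OF ic[OF i]])
    have "(\<integral>\<omega>. of_real (h \<omega>) * cnj (z i s \<omega>) * (z i t \<omega> - z i s \<omega>) \<partial>M) = 0"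
    proof (rule orthogonal_incrementsD[OF orth1[OF i] st])
      show "(\<lambda>\<omega>. of_real (h \<omega>) * cnj (z i s \<omega>)) \<in> borel_measurable (F s)"
        using h(1) ad[OF i st(1)] by measurable
      show "norm (of_real (h \<omega>) * cnj (z i s \<omega>)) \<le> B * R" if "\<omega> \<in> space M" for \<omega>
        using h(2)[OF that] bd[OF i st(1) that] B by (auto simp: norm_mult intro!: mult_mono)
    qed
    then have "(\<integral>\<omega>. u \<omega> \<partial>M) = 0"
      unfolding u_def by (subst integral_Re[OF ic[OF i]]) simp
    then show "expectation (\<lambda>\<omega>. h \<omega> * (norm (z i t \<omega> - z i s \<omega>))\<^sup>2)
      = expectation (\<lambda>\<omega>. h \<omega> * (norm (z i t \<omega>))\<^sup>2) - expectation (\<lambda>\<omega>. h \<omega> * (norm (z i s \<omega>))\<^sup>2)"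
      unfolding eq using i2[OF i t] i2[OF i st(1)] iRe by simp
    show "integrable M (\<lambda>\<omega>. h \<omega> * (norm (z i t \<omega> - z i s \<omega>))\<^sup>2)"
      unfolding eq using i2[OF i t] i2[OF i st(1)] iRe by simp
  qed
  show ?thesis
    unfolding sq_incr_def sum_distrib_left using int i2 st t one
    by (simp add: sum_subtractf)
qed

text \<open>The means telescope to the sum of squared norms at \<open>T\<close> minus that at grid
  point \<open>k\<close>; the latter is nonnegative and dropped. With \<open>h = 1\<close> this
  bounds the mean quadratic variation; with \<open>h\<close> an earlier squared increment it is the
  tail hypothesis of \<open>tail_sum_second_moment\<close>.\<close>

lemma expectation_mult_sq_incr_grid_le:
  assumes T: "0 \<le> T" and k: "k \<le> Suc m"
    and h: "h \<in> borel_measurable (F (grid T m k))" "\<And>\<omega>. \<omega> \<in> space M \<Longrightarrow> 0 \<le> h \<omega> \<and> h \<omega> \<le> B"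
  shows "expectation (\<lambda>\<omega>. h \<omega> * (\<Sum>l\<in>{k..<Suc m}. sq_incr (grid T m l) (grid T m (Suc l)) \<omega>))
    \<le> (real (card I) * R\<^sup>2) * expectation h"
proof -
  define G where "G u \<omega> = (\<Sum>i\<in>I. (norm (z i u \<omega>))\<^sup>2)" for u \<omega>
  have B: "0 \<le> B" using h(2) not_empty by (metis all_not_in_conv order_trans)
  have habs: "\<bar>h \<omega>\<bar> \<le> B" if "\<omega> \<in> space M" for \<omega> using h(2)[OF that] by auto
  have hM[measurable]: "h \<in> borel_measurable M"
    using measurable_F[OF grid_nonneg[OF T] h(1)] .
  have Gb: "0 \<le> G u \<omega>" "G u \<omega> \<le> real (card I) * R\<^sup>2" if "0 \<le> u" "\<omega> \<in> space M" for u \<omega>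
  proof -
    show "0 \<le> G u \<omega>" unfolding G_def by (intro sum_nonneg) auto
    show "G u \<omega> \<le> real (card I) * R\<^sup>2"
      unfolding G_def using bd that by (intro sum_bounded_above power_mono) auto
  qed
  have Gm[measurable]: "G u \<in> borel_measurable M" if "0 \<le> u" for u
    unfolding G_def using measurable_z that by measurable
  have ihG: "integrable M (\<lambda>\<omega>. h \<omega> * G u \<omega>)" if "0 \<le> u" for u
    using that habs Gb[OF that] Gm[OF that] B
    by (intro integrable_bounded[where B="B * (real (card I) * R\<^sup>2)"]) (auto simp: abs_mult intro!: mult_mono)
  have ih: "integrable M h"
    using habs by (intro integrable_bounded[where B=B]) auto
  have ihs: "integrable M (\<lambda>\<omega>. h \<omega> * sq_incr (grid T m l) (grid T m (Suc l)) \<omega>)" for l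
    using habs sq_incr_bound T B measurable_F[OF _ sq_incr_measurable] grid_mono[OF T, of l "Suc l" m]
    by (intro integrable_bounded[where B="B * (4 * R\<^sup>2 * real (card I))"])
      (auto simp: abs_mult intro!: mult_mono borel_measurable_times)
  have "expectation (\<lambda>\<omega>. h \<omega> * (\<Sum>l\<in>{k..<Suc m}. sq_incr (grid T m l) (grid T m (Suc l)) \<omega>))
      = (\<Sum>l\<in>{k..<Suc m}. expectation (\<lambda>\<omega>. h \<omega> * sq_incr (grid T m l) (grid T m (Suc l)) \<omega>))"
    unfolding sum_distrib_left using ihs by (intro Bochner_Integration.integral_sum) auto
  also have "\<dots> = (\<Sum>l\<in>{k..<Suc m}. expectation (\<lambda>\<omega>. h \<omega> * G (grid T m (Suc l)) \<omega>) - expectation (\<lambda>\<omega>. h \<omega> * G (grid T m l) \<omega>))"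
    unfolding G_def using T habs measurable_F_mono[OF _ grid_mono[OF T] h(1)]
    by (intro sum.cong refl expectation_mult_sq_incr[where B=B]) (auto intro: grid_mono)
  also have "\<dots> = expectation (\<lambda>\<omega>. h \<omega> * G (grid T m (Suc m)) \<omega>) - expectation (\<lambda>\<omega>. h \<omega> * G (grid T m k) \<omega>)"
    using k by (rule sum_Suc_diff')
  also have "\<dots> \<le> expectation (\<lambda>\<omega>. h \<omega> * G (grid T m (Suc m)) \<omega>)"
    using h(2) Gb T by (simp add: integral_nonneg_AE)
  also have "\<dots> \<le> expectation (\<lambda>\<omega>. (real (card I) * R\<^sup>2) * h \<omega>)"
  proof (rule integral_mono)
    show "integrable M (\<lambda>\<omega>. h \<omega> * G (grid T m (Suc m)) \<omega>)" using ihG T by simp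
    show "h \<omega> * G (grid T m (Suc m)) \<omega> \<le> (real (card I) * R\<^sup>2) * h \<omega>" if "\<omega> \<in> space M" for \<omega>
      using h(2)[OF that] Gb(2)[OF _ that, of T] T by (subst mult.commute) (auto intro: mult_right_mono)
  qed (use ih in auto)
  finally show ?thesis using ih by simp
qed

text \<open>Write each factor as its value at \<open>s\<close> plus an increment and expand over the
  set \<open>S\<close> of factors that contribute the increment. One increment has mean zero by
  \<open>orth1\<close>, two by \<open>orth1\<close> and \<open>orth2\<close> together; what remains
  is cubic. The constant is the number of subsets times a power of \<open>L\<close>.\<close>

lemma expectation_prod_increment_le:
  assumes st: "0 \<le> s" "s \<le> t"
    and orth2: "\<And>i j. i \<in> I \<Longrightarrow> j \<in> I \<Longrightarrow> i \<noteq> j \<Longrightarrow> orthogonal_increments (\<lambda>t \<omega>. z i t \<omega> * z j t \<omega>)"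
  shows "norm ((\<integral>\<omega>. (\<Prod>i\<in>I. z i t \<omega>) \<partial>M) - (\<integral>\<omega>. (\<Prod>i\<in>I. z i s \<omega>) \<partial>M))
    \<le> (2 * (2 * R * (1 + real (card I)))) ^ card I * expectation (\<lambda>\<omega>. incr s t \<omega> ^ 3)"
proof -
  \<comment> \<open>A single constant that bounds every value, every increment and
    \<open>incr\<close>; being at least 1, it also allows exponents to be raised to
    \<open>card I\<close>.\<close>
  define L where "L = 2 * R * (1 + real (card I))"
  have t: "0 \<le> t" using st by simp
  have L: "1 \<le> L" "R \<le> L" "2 * R * real (card I) \<le> L" "2 * R \<le> L"
    using R by (auto simp: L_def algebra_simps intro: add_increasing2 mult_nonneg_nonneg)
  define d where "d i \<omega> = z i t \<omega> - z i s \<omega>" for i \<omega>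
  define P where "P S \<omega> = (\<Prod>i\<in>S. d i \<omega>) * (\<Prod>i\<in>I-S. z i s \<omega>)" for S \<omega>
  have dm[measurable]: "i \<in> I \<Longrightarrow> d i \<in> borel_measurable M" for i
    unfolding d_def using measurable_z st t by measurable
  have zm: "(\<lambda>\<omega>. \<Prod>i\<in>S. z i s \<omega>) \<in> borel_measurable (F s)" if "S \<subseteq> I" for S
    using ad[OF _ st(1)] that by (intro borel_measurable_prod) auto
  have dL: "norm (d i \<omega>) \<le> L" "norm (d i \<omega>) \<le> incr s t \<omega>" if "i \<in> I" "\<omega> \<in> space M" for i \<omega>
    using diff_bound[OF that(1) st(1) t that(2)] L that fin
    by (auto simp: d_def incr_def intro!: member_le_sum[where f="\<lambda>i. norm (z i t \<omega> - z i s \<omega>)"])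
  have zb: "norm (\<Prod>i\<in>S. z i s \<omega>) \<le> L ^ card S" if "S \<subseteq> I" "\<omega> \<in> space M" for S \<omega>
  proof -
    have "norm (\<Prod>i\<in>S. z i s \<omega>) \<le> (\<Prod>i\<in>S. L)"
      unfolding prod_norm[symmetric] using that order_trans[OF bd[OF _ st(1)] L(2)] by (intro prod_mono) auto
    then show ?thesis by simp
  qed
  have db: "norm (\<Prod>i\<in>S. d i \<omega>) \<le> L ^ card S" if "S \<subseteq> I" "\<omega> \<in> space M" for S \<omega>
  proof -
    have "norm (\<Prod>i\<in>S. d i \<omega>) \<le> (\<Prod>i\<in>S. L)"
      unfolding prod_norm[symmetric] using that dL by (intro prod_mono) auto
    then show ?thesis by simp
  qed
  have Pm[measurable]: "P S \<in> borel_measurable M" if "S \<subseteq> I" for S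
    unfolding P_def using that
    by (intro borel_measurable_times[OF borel_measurable_prod measurable_F[OF st(1) zm]] dm) auto
  have iP: "integrable M (P S)" if "S \<subseteq> I" for S
  proof (rule integrable_bounded[where B="L ^ card S * L ^ card (I - S)"])
    show "norm (P S \<omega>) \<le> L ^ card S * L ^ card (I - S)" if "\<omega> \<in> space M" for \<omega>
      unfolding P_def norm_mult using db zb \<open>S \<subseteq> I\<close> that L by (intro mult_mono) auto
  qed (use Pm that in auto)
  have i3: "integrable M (\<lambda>\<omega>. incr s t \<omega> ^ 3)"
    using incr_bound[OF st(1) t] incr_measurable[OF st(1) t] L
    by (intro integrable_bounded[where B="L ^ 3"]) (auto simp: power_abs intro!: power_mono intro: order_trans)
  have single: "(\<integral>\<omega>. g \<omega> * d i \<omega> \<partial>M) = 0"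
    if "i \<in> I" "g \<in> borel_measurable (F s)" "\<And>\<omega>. \<omega> \<in> space M \<Longrightarrow> norm (g \<omega>) \<le> B" for g i B
    unfolding d_def using orthogonal_incrementsD[OF orth1[OF that(1)] st that(2,3)] .
  have est: "norm (\<integral>\<omega>. P S \<omega> \<partial>M) \<le> L ^ card I * expectation (\<lambda>\<omega>. incr s t \<omega> ^ 3)"
    if S: "S \<subseteq> I" "S \<noteq> {}" for S
  proof -
    have finS: "finite S" using S fin finite_subset by blast
    have rhs: "0 \<le> L ^ card I * expectation (\<lambda>\<omega>. incr s t \<omega> ^ 3)"
      using L incr_bound[OF st(1) t] by (auto intro!: mult_nonneg_nonneg integral_nonneg_AE AE_I2)
    have "card S \<noteq> 0" using S finS by auto
    then consider "card S = 1" | "card S = 2" | "3 \<le> card S" by linarith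
    then show ?thesis
    proof cases
      case 1
      then obtain i where i: "S = {i}" by (auto simp: card_1_singleton_iff)
      have "(\<integral>\<omega>. (\<Prod>j\<in>I-S. z j s \<omega>) * d i \<omega> \<partial>M) = 0"
        using S i zm[of "I - S"] zb[of "I - S"] by (intro single[of _ _ "L ^ card (I - S)"]) auto
      then show ?thesis using rhs i by (simp add: P_def mult.commute)
    next
      case 2
      then obtain i j where ij: "S = {i, j}" "i \<noteq> j" by (auto simp: card_2_iff)
      define g where "g \<omega> = (\<Prod>k\<in>I-S. z k s \<omega>)" for \<omega>
      have gm: "g \<in> borel_measurable (F s)" unfolding g_def by (rule zm) auto
      have gb: "norm (g \<omega>) \<le> L ^ card (I - S)" if "\<omega> \<in> space M" for \<omega>
        unfolding g_def using that by (intro zb) auto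
      have I: "i \<in> I" "j \<in> I" using S ij by auto
      have [measurable]: "g \<in> borel_measurable M" "z i s \<in> borel_measurable M" "z j s \<in> borel_measurable M"
          "z i t \<in> borel_measurable M" "z j t \<in> borel_measurable M"
        using measurable_F[OF st(1) gm] measurable_z I st t by auto
      have gz: "norm (g \<omega> * z k s \<omega>) \<le> L ^ card (I - S) * L" if "\<omega> \<in> space M" "k \<in> I" for \<omega> k
        unfolding norm_mult using gb[OF that(1)] bd[OF that(2) st(1) that(1)] L by (intro mult_mono) auto
      have gzm: "(\<lambda>\<omega>. g \<omega> * z k s \<omega>) \<in> borel_measurable (F s)" if "k \<in> I" for k
        using gm ad[OF that st(1)] by measurable
      have e1: "(\<integral>\<omega>. g \<omega> * z i s \<omega> * d j \<omega> \<partial>M) = 0" "(\<integral>\<omega>. g \<omega> * z j s \<omega> * d i \<omega> \<partial>M) = 0"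
        using I gz gzm by (auto intro!: single[of _ _ "L ^ card (I - S) * L"])
      have e2: "(\<integral>\<omega>. g \<omega> * (z i t \<omega> * z j t \<omega> - z i s \<omega> * z j s \<omega>) \<partial>M) = 0"
        by (rule orthogonal_incrementsD[OF orth2[OF I ij(2)] st gm gb])
      have i1: "integrable M (\<lambda>\<omega>. g \<omega> * z i s \<omega> * d j \<omega>)" "integrable M (\<lambda>\<omega>. g \<omega> * z j s \<omega> * d i \<omega>)"
      proof -
        have "norm (g \<omega> * z k s \<omega> * d l \<omega>) \<le> L ^ card (I - S) * L * L" if "\<omega> \<in> space M" "k \<in> I" "l \<in> I" for \<omega> k l
          unfolding norm_mult[of _ "d l \<omega>"] using gz[OF that(1,2)] dL(1)[OF that(3,1)] L by (intro mult_mono) auto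
        then show "integrable M (\<lambda>\<omega>. g \<omega> * z i s \<omega> * d j \<omega>)" "integrable M (\<lambda>\<omega>. g \<omega> * z j s \<omega> * d i \<omega>)"
          using I by (auto intro!: integrable_bounded[where B="L ^ card (I - S) * L * L"] borel_measurable_times)
      qed
      have i2: "integrable M (\<lambda>\<omega>. g \<omega> * (z i t \<omega> * z j t \<omega> - z i s \<omega> * z j s \<omega>))"
      proof (rule integrable_bounded[where B="L ^ card (I - S) * (R * R + R * R)"])
        fix \<omega> assume w: "\<omega> \<in> space M"
        have "norm (z i u \<omega> * z j u \<omega>) \<le> R * R" if "0 \<le> u" for u
          unfolding norm_mult using bd that w I R by (intro mult_mono) auto
        then have "norm (z i t \<omega> * z j t \<omega> - z i s \<omega> * z j s \<omega>) \<le> R * R + R * R"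
          using st t by (intro order_trans[OF norm_triangle_ineq4] add_mono) auto
        then show "norm (g \<omega> * (z i t \<omega> * z j t \<omega> - z i s \<omega> * z j s \<omega>)) \<le> L ^ card (I - S) * (R * R + R * R)"
          unfolding norm_mult[of "g \<omega>"] using gb[OF w] L by (intro mult_mono) auto
      qed measurable
      \<comment> \<open>A product of two increments is the increment of the product, minus each
        earlier value times the increment of the other factor. All three parts are increments tested
        against factors known at \<open>s\<close>.\<close>
      have "P S \<omega> = g \<omega> * (z i t \<omega> * z j t \<omega> - z i s \<omega> * z j s \<omega>) - g \<omega> * z i s \<omega> * d j \<omega> - g \<omega> * z j s \<omega> * d i \<omega>" for \<omega>
        unfolding P_def g_def[symmetric] using ij by (simp add: d_def algebra_simps)
      then have "(\<integral>\<omega>. P S \<omega> \<partial>M) = 0"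
        using e1 e2 i1 i2 by simp
      then show ?thesis using rhs by simp
    next
      case 3
      have "norm (\<integral>\<omega>. P S \<omega> \<partial>M) \<le> (\<integral>\<omega>. norm (P S \<omega>) \<partial>M)" by simp
      also have "\<dots> \<le> (\<integral>\<omega>. L ^ card I * incr s t \<omega> ^ 3 \<partial>M)"
      proof (rule integral_mono)
        fix \<omega> assume w: "\<omega> \<in> space M"
        note D = incr_bound[OF st(1) t w]
        have "norm (\<Prod>i\<in>S. d i \<omega>) \<le> (\<Prod>i\<in>S. incr s t \<omega>)"
          unfolding prod_norm[symmetric] using S dL w by (intro prod_mono) auto
        also have "\<dots> = incr s t \<omega> ^ (card S - 3) * incr s t \<omega> ^ 3"
          using 3 by (simp add: power_add[symmetric])
        also have "\<dots> \<le> L ^ (card S - 3) * incr s t \<omega> ^ 3"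
          using D L by (intro mult_right_mono power_mono) auto
        finally have "norm (P S \<omega>) \<le> (L ^ (card S - 3) * incr s t \<omega> ^ 3) * L ^ card (I - S)"
          unfolding P_def norm_mult using zb[of "I - S"] w D L by (intro mult_mono) auto
        also have "\<dots> = L ^ (card S - 3 + card (I - S)) * incr s t \<omega> ^ 3"
          by (simp add: power_add)
        also have "\<dots> \<le> L ^ card I * incr s t \<omega> ^ 3"
          using D L S finS fin card_mono[OF fin S(1)]
          by (intro mult_right_mono power_increasing) (auto simp: card_Diff_subset)
        finally show "norm (P S \<omega>) \<le> L ^ card I * incr s t \<omega> ^ 3" .
      qed (use iP S i3 in auto)
      finally show ?thesis using i3 by simp
    qed
  qed
  have "(\<integral>\<omega>. (\<Prod>i\<in>I. z i t \<omega>) \<partial>M) = (\<integral>\<omega>. (\<Sum>S\<in>Pow I. P S \<omega>) \<partial>M)"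
    unfolding P_def prod_add[OF fin, symmetric] d_def by simp
  also have "\<dots> = (\<Sum>S\<in>Pow I. \<integral>\<omega>. P S \<omega> \<partial>M)"
    using iP by (intro Bochner_Integration.integral_sum) auto
  also have "\<dots> = (\<integral>\<omega>. P {} \<omega> \<partial>M) + (\<Sum>S\<in>Pow I - {{}}. \<integral>\<omega>. P S \<omega> \<partial>M)"
    using fin by (subst sum.remove[of _ "{}"]) auto
  finally have "norm ((\<integral>\<omega>. (\<Prod>i\<in>I. z i t \<omega>) \<partial>M) - (\<integral>\<omega>. (\<Prod>i\<in>I. z i s \<omega>) \<partial>M))
      = norm (\<Sum>S\<in>Pow I - {{}}. \<integral>\<omega>. P S \<omega> \<partial>M)"
    by (simp add: P_def)
  also have "\<dots> \<le> (\<Sum>S\<in>Pow I - {{}}. L ^ card I * expectation (\<lambda>\<omega>. incr s t \<omega> ^ 3))"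
    using est by (intro sum_norm_le) auto
  also have "\<dots> \<le> (\<Sum>S\<in>Pow I. L ^ card I * expectation (\<lambda>\<omega>. incr s t \<omega> ^ 3))"
    using fin L incr_bound[OF st(1) t]
    by (intro sum_mono2) (auto intro!: mult_nonneg_nonneg integral_nonneg_AE AE_I2)
  also have "\<dots> = (2 * L) ^ card I * expectation (\<lambda>\<omega>. incr s t \<omega> ^ 3)"
    using fin by (simp add: card_Pow power_mult_distrib)
  finally show ?thesis unfolding L_def .
qed

text \<open>As a function of two times, \<open>incr\<close> is uniformly continuous on the square
  over \<open>[0, T]\<close> and vanishes on the diagonal; consecutive grid points approach the
  diagonal uniformly.\<close>

lemma max_incr_LIMSEQ:
  assumes T: "0 \<le> T" and cont: "\<And>i. i \<in> I \<Longrightarrow> continuous_on {0..} (\<lambda>t. z i t \<omega>)"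
  shows "(\<lambda>m. Max ((\<lambda>k. incr (grid T m k) (grid T m (Suc k)) \<omega>) ` {..<Suc m})) \<longlonglongrightarrow> 0"
proof (rule LIMSEQ_I)
  fix e :: real assume e: "0 < e"
  define f where "f p = incr (fst p) (snd p) \<omega>" for p
  have "continuous_on ({0..T} \<times> {0..T}) f"
    unfolding f_def incr_def using T
    by (intro continuous_intros continuous_on_compose2[OF cont]) auto
  then have "uniformly_continuous_on ({0..T} \<times> {0..T}) f"
    by (intro compact_uniformly_continuous compact_Times compact_Icc)
  then obtain \<delta> where \<delta>: "0 < \<delta>" and uc: "\<And>p q. p \<in> {0..T} \<times> {0..T} \<Longrightarrow> q \<in> {0..T} \<times> {0..T} \<Longrightarrow>
      dist q p < \<delta> \<Longrightarrow> dist (f q) (f p) < e"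
    using e unfolding uniformly_continuous_on_def by metis
  obtain m0 :: nat where m0: "T / \<delta> < real m0" using reals_Archimedean2 by blast
  show "\<exists>no. \<forall>m\<ge>no. norm (Max ((\<lambda>k. incr (grid T m k) (grid T m (Suc k)) \<omega>) ` {..<Suc m}) - 0) < e"
  proof (intro exI[of _ m0] allI impI)
    fix m assume m: "m0 \<le> m"
    have step: "0 \<le> incr (grid T m k) (grid T m (Suc k)) \<omega> \<and> incr (grid T m k) (grid T m (Suc k)) \<omega> < e"
      if k: "k < Suc m" for k
    proof -
      have "T / \<delta> < real (Suc m)" using m0 m by linarith
      then have "T / real (Suc m) < \<delta>" using \<delta> by (simp add: field_simps del: of_nat_Suc)
      moreover have "grid T m (Suc k) - grid T m k = T / real (Suc m)"
        unfolding grid_def by (simp add: diff_divide_distrib[symmetric] right_diff_distrib[symmetric])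
      ultimately have "dist (grid T m (Suc k)) (grid T m k) < \<delta>"
        using T by (simp add: dist_real_def del: of_nat_Suc)
      then have "dist (grid T m k, grid T m (Suc k)) (grid T m k, grid T m k) < \<delta>"
        by (simp add: dist_Pair_Pair)
      moreover have "grid T m k \<le> T" "grid T m (Suc k) \<le> T"
        using T k by (auto intro!: grid_le)
      ultimately have "dist (f (grid T m k, grid T m (Suc k))) (f (grid T m k, grid T m k)) < e"
        using T by (intro uc) auto
      then show ?thesis
        by (auto simp: f_def incr_def dist_real_def intro!: sum_nonneg)
    qed
    have "Max ((\<lambda>k. incr (grid T m k) (grid T m (Suc k)) \<omega>) ` {..<Suc m})
        \<in> (\<lambda>k. incr (grid T m k) (grid T m (Suc k)) \<omega>) ` {..<Suc m}"
      by (intro Max_in) auto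
    then show "norm (Max ((\<lambda>k. incr (grid T m k) (grid T m (Suc k)) \<omega>) ` {..<Suc m}) - 0) < e"
      using step by auto
  qed
qed

text \<open>Expanding the product over a small time step, the terms with one or two increments have mean
  zero by hypothesis, and the terms with three or more sum to zero in the limit because the paths are
  continuous and the discrete quadratic variation is bounded in \<open>L\<^sup>2\<close>.
  This replaces Ito's formula.\<close>

lemma expectation_prod_eq:
  assumes T: "0 \<le> T"
    and cont: "\<And>i \<omega>. i \<in> I \<Longrightarrow> \<omega> \<in> space M \<Longrightarrow> continuous_on {0..} (\<lambda>t. z i t \<omega>)"
    and orth2: "\<And>i j. i \<in> I \<Longrightarrow> j \<in> I \<Longrightarrow> i \<noteq> j \<Longrightarrow> orthogonal_increments (\<lambda>t \<omega>. z i t \<omega> * z j t \<omega>)"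
  shows "(\<integral>\<omega>. (\<Prod>i\<in>I. z i T \<omega>) \<partial>M) = (\<integral>\<omega>. (\<Prod>i\<in>I. z i 0 \<omega>) \<partial>M)"
proof -
  define n where "n = real (card I)"
  define K where "K = (2 * (2 * R * (1 + real (card I)))) ^ card I"
  define E where "E t = (\<integral>\<omega>. (\<Prod>i\<in>I. z i t \<omega>) \<partial>M)" for t
  define d where "d m k \<omega> = incr (grid T m k) (grid T m (Suc k)) \<omega>" for m k \<omega>
  define e where "e m k \<omega> = sq_incr (grid T m k) (grid T m (Suc k)) \<omega>" for m k \<omega>
  define Q where "Q m \<omega> = (\<Sum>k<Suc m. e m k \<omega>)" for m \<omega>
  define D where "D m \<omega> = Max ((\<lambda>k. d m k \<omega>) ` {..<Suc m})" for m \<omega>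
  \<comment> \<open>\<open>c\<close> bounds the mean quadratic variation remaining after any grid
    point, and \<open>b\<close> bounds one squared increment, where each of the \<open>n\<close>
    terms is at most \<open>(2 * R)\<^sup>2\<close>. Neither depends on the grid.\<close>
  define c where "c = n * R\<^sup>2"
  define b where "b = 4 * R\<^sup>2 * n"
  have nn: "0 \<le> n" "0 \<le> c" "0 \<le> b" "0 \<le> K" using R by (auto simp: n_def c_def b_def K_def)
  have gm: "grid T m k \<le> grid T m (Suc k)" for m k using T by (auto intro: grid_mono)
  have [measurable]: "d m k \<in> borel_measurable M" for m k
    unfolding d_def using T by (intro incr_measurable) auto
  have eF: "e m k \<in> borel_measurable (F (grid T m (Suc k)))" for m k
    unfolding e_def using T gm by (intro sq_incr_measurable) auto
  have [measurable]: "e m k \<in> borel_measurable M" for m k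
    using measurable_F[OF grid_nonneg[OF T] eF] .
  have [measurable]: "Q m \<in> borel_measurable M" "D m \<in> borel_measurable M" for m
    unfolding Q_def D_def by measurable
  have db: "0 \<le> d m k \<omega>" "d m k \<omega> \<le> 2 * R * n" if "\<omega> \<in> space M" for m k \<omega>
    unfolding d_def n_def using incr_bound T that by auto
  have eb: "0 \<le> e m k \<omega>" "e m k \<omega> \<le> b" if "\<omega> \<in> space M" for m k \<omega>
    unfolding e_def b_def n_def using sq_incr_bound T that by auto
  have Db: "0 \<le> D m \<omega>" "D m \<omega> \<le> 2 * R * n" if "\<omega> \<in> space M" for m \<omega>
  proof -
    have "D m \<omega> \<in> (\<lambda>k. d m k \<omega>) ` {..<Suc m}" unfolding D_def by (intro Max_in) auto
    then show "0 \<le> D m \<omega>" "D m \<omega> \<le> 2 * R * n" using db that by auto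
  qed
  have dD: "d m k \<omega> \<le> D m \<omega>" if "k < Suc m" for m k \<omega>
    unfolding D_def using that by (intro Max_ge) auto
  have Qb: "0 \<le> Q m \<omega>" "Q m \<omega> \<le> real (Suc m) * b" if "\<omega> \<in> space M" for m \<omega>
    unfolding Q_def using eb[OF that] sum_bounded_above[of "{..<Suc m}" "\<lambda>k. e m k \<omega>" b]
    by (auto intro!: sum_nonneg simp del: of_nat_Suc sum.lessThan_Suc)
  have iD: "integrable M (\<lambda>\<omega>. (D m \<omega>)\<^sup>2)" for m
    using Db by (intro integrable_bounded[where B="(2 * R * n)\<^sup>2"]) (auto intro!: power_mono simp del: power_mult_distrib)
  have iQ: "integrable M (\<lambda>\<omega>. (Q m \<omega>)\<^sup>2)" for m
    using Qb by (intro integrable_bounded[where B="(real (Suc m) * b)\<^sup>2"])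
      (auto intro!: power_mono simp del: power_mult_distrib of_nat_Suc)
  have id: "integrable M (\<lambda>\<omega>. d m k \<omega> ^ 3)" for m k
    using db by (intro integrable_bounded[where B="(2 * R * n) ^ 3"])
      (auto simp: power_abs intro!: power_mono simp del: power_mult_distrib)
  have Q2: "expectation (\<lambda>\<omega>. (Q m \<omega>)\<^sup>2) \<le> (2 * c + b) * c" for m
    unfolding Q_def
  proof (rule tail_sum_second_moment)
    show "expectation (\<lambda>\<omega>. e m k \<omega> * (\<Sum>l\<in>{Suc k..<Suc m}. e m l \<omega>)) \<le> c * expectation (e m k)"
      if "k < Suc m" for k
      using expectation_mult_sq_incr_grid_le[OF T, of "Suc k" m "e m k" b] eF[of m k] eb that
      by (simp add: c_def n_def e_def[of m l for l, symmetric, abs_def] del: sum.op_ivl_Suc)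
    show "expectation (\<lambda>\<omega>. \<Sum>k<Suc m. e m k \<omega>) \<le> c"
      using expectation_mult_sq_incr_grid_le[OF T, of 0 m "\<lambda>_. 1" 1]
      by (simp add: c_def n_def e_def lessThan_atLeast0 prob_space del: sum.op_ivl_Suc)
  qed (use eb nn in auto)
  \<comment> \<open>The order of the limits matters: for fixed \<open>l\<close>, refining the grid
    removes the \<open>D\<close> term; only afterwards does \<open>l\<close> tend to infinity and
    remove the rest.\<close>
  have bound: "norm (E T - E 0) \<le> K * (n * (l * expectation (\<lambda>\<omega>. (D m \<omega>)\<^sup>2) + (2 * c + b) * c / l))"
    if l: "0 < l" for l m
  proof -
    have "norm (E T - E 0) = norm (\<Sum>k<Suc m. E (grid T m (Suc k)) - E (grid T m k))"
      by (subst sum_lessThan_telescope) simp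
    also have "\<dots> \<le> (\<Sum>k<Suc m. K * expectation (\<lambda>\<omega>. d m k \<omega> ^ 3))"
      unfolding E_def K_def d_def using T gm orth2
      by (intro sum_norm_le expectation_prod_increment_le) auto
    also have "\<dots> = K * expectation (\<lambda>\<omega>. \<Sum>k<Suc m. d m k \<omega> ^ 3)"
      using id by (simp add: sum_distrib_left distrib_left)
    also have "\<dots> \<le> K * expectation (\<lambda>\<omega>. n * (l * (D m \<omega>)\<^sup>2 + (Q m \<omega>)\<^sup>2 / l))"
    proof (intro mult_left_mono integral_mono nn)
      fix \<omega> assume w: "\<omega> \<in> space M"
      \<comment> \<open>One of the three factors is bounded by the largest increment
        \<open>D\<close>; the square of the other two is at most \<open>n\<close> times
        \<open>e\<close>, and the \<open>e\<close> sum to \<open>Q\<close>.\<close>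
      have "(\<Sum>k<Suc m. d m k \<omega> ^ 3) \<le> (\<Sum>k<Suc m. D m \<omega> * (n * e m k \<omega>))"
      proof (rule sum_mono)
        fix k assume "k \<in> {..<Suc m}"
        then show "d m k \<omega> ^ 3 \<le> D m \<omega> * (n * e m k \<omega>)"
          unfolding power3_eq_cube mult.assoc
          using dD db[OF w] Db[OF w] incr_square_le[of "grid T m k" "grid T m (Suc k)" \<omega>]
          by (intro mult_mono[of "d m k \<omega>" "D m \<omega>"]) (auto simp: d_def e_def n_def power2_eq_square)
      qed
      also have "\<dots> = n * (D m \<omega> * Q m \<omega>)"
        unfolding Q_def sum_distrib_left by (intro sum.cong) auto
      also have "\<dots> \<le> n * (l * (D m \<omega>)\<^sup>2 + (Q m \<omega>)\<^sup>2 / l)"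
        using mult_le_weighted_squares[OF l] nn by (intro mult_left_mono) auto
      finally show "(\<Sum>k<Suc m. d m k \<omega> ^ 3) \<le> n * (l * (D m \<omega>)\<^sup>2 + (Q m \<omega>)\<^sup>2 / l)" .
    qed (use id iD iQ in \<open>auto intro!: Bochner_Integration.integrable_add\<close>)
    also have "\<dots> = K * (n * (l * expectation (\<lambda>\<omega>. (D m \<omega>)\<^sup>2) + expectation (\<lambda>\<omega>. (Q m \<omega>)\<^sup>2) / l))"
      using iD iQ by simp
    also have "\<dots> \<le> K * (n * (l * expectation (\<lambda>\<omega>. (D m \<omega>)\<^sup>2) + (2 * c + b) * c / l))"
      using Q2 l nn by (intro mult_left_mono add_left_mono divide_right_mono) auto
    finally show ?thesis .
  qed
  have "(\<lambda>m. expectation (\<lambda>\<omega>. (D m \<omega>)\<^sup>2)) \<longlonglongrightarrow> expectation (\<lambda>\<omega>. 0)"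
  proof (rule integral_dominated_convergence[where w="\<lambda>_. (2 * R * n)\<^sup>2"])
    show "AE \<omega> in M. (\<lambda>m. (D m \<omega>)\<^sup>2) \<longlonglongrightarrow> 0"
    proof (intro AE_I2)
      fix \<omega> assume w: "\<omega> \<in> space M"
      have "(\<lambda>m. D m \<omega>) \<longlonglongrightarrow> 0"
        unfolding D_def d_def using cont[OF _ w] by (intro max_incr_LIMSEQ[OF T]) auto
      from tendsto_power[OF this, of 2] show "(\<lambda>m. (D m \<omega>)\<^sup>2) \<longlonglongrightarrow> 0" by simp
    qed
    show "AE \<omega> in M. norm ((D m \<omega>)\<^sup>2) \<le> (2 * R * n)\<^sup>2" for m
      using Db by (auto intro!: power_mono simp del: power_mult_distrib)
  qed auto
  then have D0: "(\<lambda>m. expectation (\<lambda>\<omega>. (D m \<omega>)\<^sup>2)) \<longlonglongrightarrow> 0" by simp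
  have "norm (E T - E 0) \<le> K * (n * ((2 * c + b) * c)) / l" if l: "0 < l" for l
  proof -
    have "(\<lambda>m. K * (n * (l * expectation (\<lambda>\<omega>. (D m \<omega>)\<^sup>2) + (2 * c + b) * c / l)))
        \<longlonglongrightarrow> K * (n * (l * 0 + (2 * c + b) * c / l))"
      by (intro tendsto_intros D0)
    then have "norm (E T - E 0) \<le> K * (n * (l * 0 + (2 * c + b) * c / l))"
      using bound[OF l] by (intro LIMSEQ_le_const) auto
    then show ?thesis by simp
  qed
  then have "norm (E T - E 0) \<le> 0"
    by (rule nonpos_if_le_divide)
  then show ?thesis by (simp add: E_def)
qed

end

end

section \<open>Localization\<close>

context filtered_prob_space
begin

lemma real_martingale_cong:
  assumes N: "real_martingale M F N"
    and eq: "\<And>t \<omega>. 0 \<le> t \<Longrightarrow> \<omega> \<in> space M \<Longrightarrow> N t \<omega> = N' t \<omega>"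
  shows "real_martingale M F N'"
  unfolding real_martingale_def
proof (intro conjI allI impI)
  show "adapted_proc F N'"
    unfolding adapted_proc_def
  proof (intro allI impI)
    fix t :: real assume t: "0 \<le> t"
    then have "N t \<in> borel_measurable (F t)"
      using N by (simp add: real_martingale_def adapted_proc_def)
    then show "N' t \<in> borel_measurable (F t)"
      using eq t by (subst measurable_cong[of _ _ "N t"]) (auto simp: space_F)
  qed
  show int: "integrable M (N' t)" if "0 \<le> t" for t
    using N eq that by (subst Bochner_Integration.integrable_cong[of _ _ _ "N t"]) (auto simp: real_martingale_def)
  fix s t :: real assume st: "0 \<le> s" "s \<le> t"
  interpret sigma_finite_subalgebra M "F s"
    using st by (intro sigma_finite_subalgebra_F)
  have "AE \<omega> in M. real_cond_exp M (F s) (N t) \<omega> = real_cond_exp M (F s) (N' t) \<omega>"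
  proof (rule real_cond_exp_cong)
    show "AE \<omega> in M. N t \<omega> = N' t \<omega>" using eq st by (intro AE_I2) auto
    have "integrable M (N t)" using N st by (simp add: real_martingale_def)
    then show "N t \<in> borel_measurable M" by simp
    show "N' t \<in> borel_measurable M" using int[of t] st by simp
  qed
  moreover have "AE \<omega> in M. real_cond_exp M (F s) (N t) \<omega> = N s \<omega>"
    using N st by (simp add: real_martingale_def)
  ultimately show "AE \<omega> in M. real_cond_exp M (F s) (N' t) \<omega> = N' s \<omega>"
    using AE_space by eventually_elim (use eq st in auto)
qed

lemma real_martingale_diff:
  assumes N: "real_martingale M F N" "real_martingale M F N'"
  shows "real_martingale M F (\<lambda>t \<omega>. N t \<omega> - N' t \<omega>)"
  unfolding real_martingale_def
proof (intro conjI allI impI)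
  show "adapted_proc F (\<lambda>t \<omega>. N t \<omega> - N' t \<omega>)"
    using N unfolding real_martingale_def adapted_proc_def by (auto intro: borel_measurable_diff)
  show "integrable M (\<lambda>\<omega>. N t \<omega> - N' t \<omega>)" if "0 \<le> t" for t
    using N that by (auto simp: real_martingale_def)
  fix s t :: real assume st: "0 \<le> s" "s \<le> t"
  interpret sigma_finite_subalgebra M "F s"
    using st by (intro sigma_finite_subalgebra_F)
  have "AE \<omega> in M. real_cond_exp M (F s) (\<lambda>\<omega>. N t \<omega> - N' t \<omega>) \<omega>
      = real_cond_exp M (F s) (N t) \<omega> - real_cond_exp M (F s) (N' t) \<omega>"
    using N st by (intro real_cond_exp_diff) (auto simp: real_martingale_def)
  moreover have "AE \<omega> in M. real_cond_exp M (F s) (N t) \<omega> = N s \<omega>"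
    "AE \<omega> in M. real_cond_exp M (F s) (N' t) \<omega> = N' s \<omega>"
    using N st by (auto simp: real_martingale_def)
  ultimately show "AE \<omega> in M. real_cond_exp M (F s) (\<lambda>\<omega>. N t \<omega> - N' t \<omega>) \<omega> = N s \<omega> - N' s \<omega>"
    by eventually_elim simp
qed

lemma real_martingale_add:
  assumes "real_martingale M F N" "real_martingale M F N'"
  shows "real_martingale M F (\<lambda>t \<omega>. N t \<omega> + N' t \<omega>)"
proof -
  \<comment> \<open>The sum written with differences only.\<close>
  have "real_martingale M F (\<lambda>t \<omega>. N t \<omega> - (N' t \<omega> - N' t \<omega> - N' t \<omega>))"
    using assms by (intro real_martingale_diff)
  then show ?thesis by simp
qed

text \<open>Requiring \<open>P\<close> for every stopping time below \<open>\<tau> m\<close>, not only for \<open>\<tau> m\<close> itself, lets localizing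
  sequences be merged by taking minima.\<close>

definition localizable :: "(('a \<Rightarrow> real) \<Rightarrow> bool) \<Rightarrow> bool" where
  "localizable P \<longleftrightarrow> (\<exists>\<tau> :: nat \<Rightarrow> 'a \<Rightarrow> real. (\<forall>m. stopping_time_R M F (\<tau> m)) \<and>
     (\<forall>\<omega>\<in>space M. filterlim (\<lambda>m. \<tau> m \<omega>) at_top sequentially) \<and>
     (\<forall>m \<rho>. stopping_time_R M F \<rho> \<longrightarrow> (\<forall>\<omega>\<in>space M. \<rho> \<omega> \<le> \<tau> m \<omega>) \<longrightarrow> P \<rho>))"

lemma localizableE:
  assumes "localizable P"
  obtains \<tau> :: "nat \<Rightarrow> 'a \<Rightarrow> real" where "\<And>m. stopping_time_R M F (\<tau> m)"
    "\<And>\<omega>. \<omega> \<in> space M \<Longrightarrow> filterlim (\<lambda>m. \<tau> m \<omega>) at_top sequentially" "\<And>m. P (\<tau> m)"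
  using assms unfolding localizable_def by blast

lemma localizable_mono:
  "localizable P \<Longrightarrow> (\<And>\<rho>. stopping_time_R M F \<rho> \<Longrightarrow> P \<rho> \<Longrightarrow> Q \<rho>) \<Longrightarrow> localizable Q"
  unfolding localizable_def by metis

lemma localizable_conj:
  assumes "localizable P" "localizable Q"
  shows "localizable (\<lambda>\<rho>. P \<rho> \<and> Q \<rho>)"
proof -
  obtain \<sigma> where \<sigma>: "\<And>m. stopping_time_R M F (\<sigma> m)"
      "\<And>\<omega>. \<omega> \<in> space M \<Longrightarrow> filterlim (\<lambda>m. \<sigma> m \<omega>) at_top sequentially"
      "\<And>m \<rho>. stopping_time_R M F \<rho> \<Longrightarrow> (\<forall>\<omega>\<in>space M. \<rho> \<omega> \<le> \<sigma> m \<omega>) \<Longrightarrow> P \<rho>"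
    using assms(1) unfolding localizable_def by blast
  obtain \<tau> where \<tau>: "\<And>m. stopping_time_R M F (\<tau> m)"
      "\<And>\<omega>. \<omega> \<in> space M \<Longrightarrow> filterlim (\<lambda>m. \<tau> m \<omega>) at_top sequentially"
      "\<And>m \<rho>. stopping_time_R M F \<rho> \<Longrightarrow> (\<forall>\<omega>\<in>space M. \<rho> \<omega> \<le> \<tau> m \<omega>) \<Longrightarrow> Q \<rho>"
    using assms(2) unfolding localizable_def by blast
  show ?thesis
    unfolding localizable_def
  proof (intro exI[of _ "\<lambda>m \<omega>. min (\<sigma> m \<omega>) (\<tau> m \<omega>)"] conjI allI ballI impI)
    show "stopping_time_R M F (\<lambda>\<omega>. min (\<sigma> m \<omega>) (\<tau> m \<omega>))" for m
      by (intro stopping_time_min \<sigma>(1) \<tau>(1))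
    fix \<omega> assume w: "\<omega> \<in> space M"
    show "filterlim (\<lambda>m. min (\<sigma> m \<omega>) (\<tau> m \<omega>)) at_top sequentially"
      using \<sigma>(2)[OF w] \<tau>(2)[OF w] by (simp add: filterlim_at_top eventually_conj_iff)
  next
    fix m \<rho> assume \<rho>: "stopping_time_R M F \<rho>" "\<forall>\<omega>\<in>space M. \<rho> \<omega> \<le> min (\<sigma> m \<omega>) (\<tau> m \<omega>)"
    show "P \<rho>" by (rule \<sigma>(3)[OF \<rho>(1)]) (use \<rho>(2) in auto)
    show "Q \<rho>" by (rule \<tau>(3)[OF \<rho>(1)]) (use \<rho>(2) in auto)
  qed
qed

lemma localizable_True: "localizable (\<lambda>_. True)"
  unfolding localizable_def
proof (intro exI[of _ "\<lambda>m \<omega>. real m"] conjI allI ballI impI)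
  show "stopping_time_R M F (\<lambda>\<omega>. real m)" for m
    using stopping_time_two_valued[of "real m" "real m" "{}"] by simp
  show "filterlim (\<lambda>m. real m) at_top sequentially"
    by (rule filterlim_real_sequentially)
qed auto

lemma localizable_ball:
  "finite I \<Longrightarrow> (\<And>i. i \<in> I \<Longrightarrow> localizable (P i)) \<Longrightarrow> localizable (\<lambda>\<rho>. \<forall>i\<in>I. P i \<rho>)"
proof (induction I rule: finite_induct)
  case empty
  then show ?case using localizable_True by simp
next
  case (insert i I)
  then have "localizable (\<lambda>\<rho>. P i \<rho> \<and> (\<forall>i\<in>I. P i \<rho>))"
    by (intro localizable_conj) auto
  then show ?case by (auto elim: localizable_mono)
qed

text \<open>The process stopped at \<open>\<tau> m\<close> is a continuous martingale, so stopping
  it again at \<open>\<rho>\<close> keeps it one, and \<open>min (min t \<rho>) (\<tau> m)\<close>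
  is \<open>min t \<rho>\<close>. Starting at zero disposes of the subtracted
  \<open>L 0\<close>.\<close>

lemma localizable_local_martingale:
  assumes L: "real_local_martingale M F L" and cont: "continuous_proc M L"
    and L0: "\<And>\<omega>. \<omega> \<in> space M \<Longrightarrow> L 0 \<omega> = 0"
  shows "localizable (\<lambda>\<rho>. real_martingale M F (\<lambda>t \<omega>. L (min t (\<rho> \<omega>)) \<omega>))"
proof -
  obtain \<tau> where \<tau>: "\<And>m. stopping_time_R M F (\<tau> m)"
      "\<And>\<omega>. \<omega> \<in> space M \<Longrightarrow> filterlim (\<lambda>m. \<tau> m \<omega>) at_top sequentially"
      "\<And>m. real_martingale M F (\<lambda>t \<omega>. L (min t (\<tau> m \<omega>)) \<omega> - L 0 \<omega>)"
    using L unfolding real_local_martingale_def by blast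
  show ?thesis
    unfolding localizable_def
  proof (intro exI[of _ \<tau>] conjI allI ballI impI)
    fix m \<rho> assume \<rho>: "stopping_time_R M F \<rho>" "\<forall>\<omega>\<in>space M. \<rho> \<omega> \<le> \<tau> m \<omega>"
    have "continuous_proc M (\<lambda>t \<omega>. L (min t (\<tau> m \<omega>)) \<omega> - L 0 \<omega>)"
      unfolding continuous_proc_def
    proof (intro ballI continuous_intros)
      fix \<omega> assume w: "\<omega> \<in> space M"
      have "0 \<le> \<tau> m \<omega>" using \<tau>(1) w by (simp add: stopping_time_R_def)
      moreover have "continuous_on {0..} (\<lambda>t. L t \<omega>)" using cont w by (simp add: continuous_proc_def)
      ultimately show "continuous_on {0..} (\<lambda>t. L (min t (\<tau> m \<omega>)) \<omega>)"
        by (intro continuous_on_compose2[where f="\<lambda>t. min t (\<tau> m \<omega>)" and g="\<lambda>t. L t \<omega>" and t="{0..}"] continuous_intros) auto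
    qed
    from martingale_stopped[OF \<tau>(3) this \<rho>(1)]
    show "real_martingale M F (\<lambda>t \<omega>. L (min t (\<rho> \<omega>)) \<omega>)"
      by (rule real_martingale_cong) (use \<rho>(2) in \<open>auto simp: L0 min.assoc min.absorb1\<close>)
  qed (use \<tau> in auto)
qed

text \<open>The localizing times are the first times at which \<open>|X|\<close> reaches
  \<open>m + 1\<close>, capped at \<open>m\<close>.\<close>

lemma localizable_bounded:
  assumes ad: "adapted_proc F X" and cont: "continuous_proc M X"
    and X0: "\<And>\<omega>. \<omega> \<in> space M \<Longrightarrow> X 0 \<omega> = 0"
  shows "localizable (\<lambda>\<rho>. \<exists>B. \<forall>t\<ge>0. \<forall>\<omega>\<in>space M. \<bar>X (min t (\<rho> \<omega>)) \<omega>\<bar> \<le> B)"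
proof -
  \<comment> \<open>Inserting \<open>real m\<close> makes the set nonempty, so that the infimum is a
    finite time even on paths that never reach the level. The level is positive for
    \<open>m = 0\<close> as well, so a path starting at zero begins below it.\<close>
  define H where "H m \<omega> = insert (real m) {t. 0 \<le> t \<and> real m + 1 \<le> \<bar>X t \<omega>\<bar>}" for m \<omega>
  define \<tau> where "\<tau> m \<omega> = Inf (H m \<omega>)" for m \<omega>
  have c: "continuous_on {0..} (\<lambda>t. X t \<omega>)" if "\<omega> \<in> space M" for \<omega>
    using cont that by (simp add: continuous_proc_def)
  have H0: "H m \<omega> \<noteq> {}" "bdd_below (H m \<omega>)" for m \<omega>
    by (auto simp: H_def intro!: bdd_belowI[of _ 0])
  have \<tau>_in: "\<tau> m \<omega> \<in> H m \<omega>" if "\<omega> \<in> space M" for m \<omega>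
  proof -
    have "closed ({0..} \<inter> (\<lambda>t. \<bar>X t \<omega>\<bar>) -` {real m + 1..})"
      using c[OF that] by (intro continuous_closed_preimage continuous_intros) auto
    also have "{0..} \<inter> (\<lambda>t. \<bar>X t \<omega>\<bar>) -` {real m + 1..} = {t. 0 \<le> t \<and> real m + 1 \<le> \<bar>X t \<omega>\<bar>}"
      by auto
    finally have "closed (H m \<omega>)" by (simp add: H_def)
    then show ?thesis unfolding \<tau>_def using H0 by (intro closed_contains_Inf) auto
  qed
  have \<tau>_le: "t \<in> H m \<omega> \<Longrightarrow> \<tau> m \<omega> \<le> t" for t m \<omega>
    unfolding \<tau>_def using H0 by (intro cInf_lower) auto
  have \<tau>0: "0 \<le> \<tau> m \<omega>" if "\<omega> \<in> space M" for m \<omega>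
    using \<tau>_in[OF that, of m] by (auto simp: H_def)
  have stop: "stopping_time_R M F (\<tau> m)" for m
    unfolding stopping_time_R_def
  proof (intro conjI ballI allI impI \<tau>0)
    fix t :: real assume t: "0 \<le> t"
    show "{\<omega> \<in> space M. \<tau> m \<omega> \<le> t} \<in> sets (F t)"
    proof (cases "real m \<le> t")
      case True
      then have "{\<omega> \<in> space M. \<tau> m \<omega> \<le> t} = space (F t)"
        using \<tau>_le[of "real m" m] by (auto simp: space_F t H_def intro: order_trans)
      then show ?thesis by simp
    next
      case False
      \<comment> \<open>Here \<open>t < m\<close>, so \<open>\<tau> m \<le> t\<close> means a
        genuine hit. It is expressed through countably many values of \<open>X\<close> at grid
        points up to \<open>t\<close>; the slack \<open>inverse (real (Suc j))\<close> is there
        because the hitting time need not be a grid point.\<close>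
      have "\<tau> m \<omega> \<le> t \<longleftrightarrow> (\<forall>j. \<exists>i. \<exists>k\<le>Suc i. real m + 1 - inverse (real (Suc j)) < \<bar>X (grid t i k) \<omega>\<bar>)"
        (is "_ \<longleftrightarrow> ?R") if w: "\<omega> \<in> space M" for \<omega>
      proof
        assume le: "\<tau> m \<omega> \<le> t"
        then have hit: "real m + 1 \<le> \<bar>X (\<tau> m \<omega>) \<omega>\<bar>"
          using \<tau>_in[OF w, of m] False by (auto simp: H_def)
        show ?R
        proof
          fix j
          have "(\<lambda>i. grid t i (stop_index t i (\<tau> m \<omega>))) \<longlonglongrightarrow> \<tau> m \<omega>"
            using grid_stop_index_LIMSEQ[OF t \<tau>0[OF w, of m]] le by (simp add: min.absorb2)
          then have "(\<lambda>i. \<bar>X (grid t i (stop_index t i (\<tau> m \<omega>))) \<omega>\<bar>) \<longlonglongrightarrow> \<bar>X (\<tau> m \<omega>) \<omega>\<bar>"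
            using t \<tau>0[OF w] by (intro tendsto_rabs continuous_on_tendsto_compose[OF c[OF w]]) auto
          moreover have "real m + 1 - inverse (real (Suc j)) < \<bar>X (\<tau> m \<omega>) \<omega>\<bar>"
            using hit by (smt (verit) inverse_positive_iff_positive of_nat_0_less_iff zero_less_Suc)
          ultimately have "\<forall>\<^sub>F i in sequentially. real m + 1 - inverse (real (Suc j)) < \<bar>X (grid t i (stop_index t i (\<tau> m \<omega>))) \<omega>\<bar>"
            by (rule order_tendstoD(1))
          then obtain i where "real m + 1 - inverse (real (Suc j)) < \<bar>X (grid t i (stop_index t i (\<tau> m \<omega>))) \<omega>\<bar>"
            by (auto simp: eventually_sequentially)
          then show "\<exists>i. \<exists>k\<le>Suc i. real m + 1 - inverse (real (Suc j)) < \<bar>X (grid t i k) \<omega>\<bar>"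
            using stop_index_le[OF t \<tau>0[OF w]] by blast
        qed
      next
        \<comment> \<open>The maximum of \<open>|X|\<close> over the compact interval is attained
          and dominates all grid values; letting the slack vanish shows that it reaches the
          level.\<close>
        assume R: ?R
        have "continuous_on {0..t} (\<lambda>s. \<bar>X s \<omega>\<bar>)"
          using continuous_on_subset[OF c[OF w], of "{0..t}"] by (intro continuous_intros) auto
        then obtain s where s: "0 \<le> s" "s \<le> t" and max: "\<And>u. 0 \<le> u \<Longrightarrow> u \<le> t \<Longrightarrow> \<bar>X u \<omega>\<bar> \<le> \<bar>X s \<omega>\<bar>"
          using continuous_attains_sup[of "{0..t}" "\<lambda>s. \<bar>X s \<omega>\<bar>"] t by auto
        have "real m + 1 - inverse (real (Suc j)) \<le> \<bar>X s \<omega>\<bar>" for j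
        proof -
          from R obtain i k where "k \<le> Suc i" "real m + 1 - inverse (real (Suc j)) < \<bar>X (grid t i k) \<omega>\<bar>"
            by blast
          then show ?thesis using max[of "grid t i k"] t by (auto simp: grid_le)
        qed
        moreover have "(\<lambda>j. real m + 1 - inverse (real (Suc j))) \<longlonglongrightarrow> real m + 1 - 0"
          by (intro tendsto_intros LIMSEQ_inverse_real_of_nat)
        ultimately have "real m + 1 \<le> \<bar>X s \<omega>\<bar>"
          using LIMSEQ_le_const2[of "\<lambda>j. real m + 1 - inverse (real (Suc j))" "real m + 1"] by auto
        then show "\<tau> m \<omega> \<le> t"
          using \<tau>_le[of s m \<omega>] s by (auto simp: H_def)
      qed
      then have "{\<omega> \<in> space M. \<tau> m \<omega> \<le> t}
          = {\<omega> \<in> space (F t). \<forall>j. \<exists>i. \<exists>k\<in>{..Suc i}. real m + 1 - inverse (real (Suc j)) < \<bar>X (grid t i k) \<omega>\<bar>}"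
        by (auto simp: space_F t Bex_def)
      also have "\<dots> \<in> sets (F t)"
      proof -
        have [measurable]: "X (grid t i k) \<in> borel_measurable (F t)" if "k \<in> {..Suc i}" for i k
          using ad t that grid_le[OF t, of k i]
          by (intro measurable_F_mono[of "grid t i k" t]) (auto simp: adapted_proc_def)
        show ?thesis by measurable
      qed
      finally show ?thesis .
    qed
  qed
  \<comment> \<open>If the level were exceeded at \<open>u\<close>, the intermediate value theorem
    would give an exact hit strictly before \<open>u\<close>, contradicting
    \<open>u \<le> \<tau> m\<close>.\<close>
  have bound: "\<bar>X u \<omega>\<bar> \<le> real m + 1" if w: "\<omega> \<in> space M" and u: "0 \<le> u" "u \<le> \<tau> m \<omega>" for u m \<omega>
  proof (rule ccontr)
    assume big: "\<not> \<bar>X u \<omega>\<bar> \<le> real m + 1"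
    have "continuous_on {0..u} (\<lambda>s. \<bar>X s \<omega>\<bar>)"
      using continuous_on_subset[OF c[OF w], of "{0..u}"] by (intro continuous_intros) auto
    then obtain v where v: "0 \<le> v" "v \<le> u" "\<bar>X v \<omega>\<bar> = real m + 1"
      using IVT'[of "\<lambda>s. \<bar>X s \<omega>\<bar>" 0 "real m + 1" u] X0[OF w] big u by auto
    then have "v < u" using big by (cases "v = u") auto
    moreover have "\<tau> m \<omega> \<le> v" using v by (intro \<tau>_le) (auto simp: H_def)
    ultimately show False using u by simp
  qed
  show ?thesis
    unfolding localizable_def
  proof (intro exI[of _ \<tau>] conjI allI ballI impI stop)
    fix \<omega> assume w: "\<omega> \<in> space M"
    show "filterlim (\<lambda>m. \<tau> m \<omega>) at_top sequentially"
      unfolding filterlim_at_top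
    proof
      \<comment> \<open>The path is bounded by some \<open>B\<close> on \<open>[0, Z]\<close>, so
        for \<open>m\<close> at least \<open>Z\<close> and \<open>B\<close> neither the cap nor a
        hit occurs before \<open>Z\<close>.\<close>
      fix Z :: real
      have "compact ((\<lambda>s. X s \<omega>) ` {0..Z})"
        using continuous_on_subset[OF c[OF w], of "{0..Z}"] by (intro compact_continuous_image) auto
      then obtain B where B: "\<And>s. 0 \<le> s \<Longrightarrow> s \<le> Z \<Longrightarrow> \<bar>X s \<omega>\<bar> \<le> B"
        using compact_imp_bounded bounded_iff by (metis atLeastAtMost_iff imageI real_norm_def)
      obtain m0 :: nat where m0: "max Z B \<le> real m0" using real_arch_simple by blast
      show "\<forall>\<^sub>F m in sequentially. Z \<le> \<tau> m \<omega>"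
      proof (rule eventually_sequentiallyI[of m0])
        fix m assume "m0 \<le> m"
        then have m: "Z \<le> real m" "B \<le> real m" using m0 by auto
        show "Z \<le> \<tau> m \<omega>"
          unfolding \<tau>_def
        proof (rule cInf_greatest[OF H0(1)])
          fix x assume "x \<in> H m \<omega>"
          then consider "x = real m" | "0 \<le> x" "real m + 1 \<le> \<bar>X x \<omega>\<bar>" by (auto simp: H_def)
          then show "Z \<le> x"
          proof cases
            case 2
            then show ?thesis using B[of x] m by linarith
          qed (use m in simp)
        qed
      qed
    qed
  next
    fix m \<rho> assume \<rho>: "stopping_time_R M F \<rho>" "\<forall>\<omega>\<in>space M. \<rho> \<omega> \<le> \<tau> m \<omega>"
    have "\<bar>X (min t (\<rho> \<omega>)) \<omega>\<bar> \<le> real m + 1" if "0 \<le> t" "\<omega> \<in> space M" for t \<omega>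
      using \<rho> that by (intro bound) (auto simp: stopping_time_R_def min.coboundedI2)
    then show "\<exists>B. \<forall>t\<ge>0. \<forall>\<omega>\<in>space M. \<bar>X (min t (\<rho> \<omega>)) \<omega>\<bar> \<le> B" by blast
  qed
qed

end

section \<open>The norm inequality\<close>

lemma power_tangent_le:
  fixes r s :: real
  assumes "0 \<le> r" "0 \<le> s"
  shows "r ^ Suc p + real (Suc p) * r ^ p * (s - r) \<le> s ^ Suc p"
proof (induction p)
  case (Suc p)
  have "0 \<le> real (Suc p) * r ^ p * (s - r)\<^sup>2"
    using assms by (intro mult_nonneg_nonneg) auto
  also have "\<dots> = s * (r ^ Suc p + real (Suc p) * r ^ p * (s - r))
      - (r ^ Suc (Suc p) + real (Suc (Suc p)) * r ^ Suc p * (s - r))"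
    by (simp add: power2_eq_square algebra_simps)
  also have "s * (r ^ Suc p + real (Suc p) * r ^ p * (s - r)) \<le> s ^ Suc (Suc p)"
    using mult_left_mono[OF Suc.IH assms(2)] by simp
  finally show ?case by simp
qed simp

lemma sum_mult_le_sqrt:
  fixes a b :: "'i \<Rightarrow> real"
  shows "\<bar>\<Sum>j\<in>J. a j * b j\<bar> \<le> sqrt (\<Sum>j\<in>J. (a j)\<^sup>2) * sqrt (\<Sum>j\<in>J. (b j)\<^sup>2)"
  using real_sqrt_le_mono[OF Cauchy_Schwarz_ineq_sum[of a b J]] by (simp add: real_sqrt_mult)

lemma borel_measurable_euclidean_norm:
  fixes f :: "'i \<Rightarrow> 'a \<Rightarrow> real"
  assumes "\<And>j. j \<in> J \<Longrightarrow> f j \<in> borel_measurable M"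
  shows "(\<lambda>\<omega>. sqrt (\<Sum>j\<in>J. (f j \<omega>)\<^sup>2)) \<in> borel_measurable M"
  using assms by (intro measurable_compose[OF _ borel_measurable_sqrt] borel_measurable_sum borel_measurable_power)

text \<open>The coefficients \<open>real (p + 2) * r ^ p * a j\<close> form the gradient of the
  power of the norm at \<open>a\<close>. The exponent \<open>p + 2\<close> keeps them free of
  division, so \<open>r = 0\<close> is no special case. Cauchy-Schwarz reduces the claim to the
  tangent inequality in one variable.\<close>

lemma euclidean_norm_power_subgradient:
  fixes a b :: "'i \<Rightarrow> real" and J :: "'i set"
  defines "r \<equiv> sqrt (\<Sum>j\<in>J. (a j)\<^sup>2)" and "s \<equiv> sqrt (\<Sum>j\<in>J. (b j)\<^sup>2)"
  shows "r ^ (p + 2) + (\<Sum>j\<in>J. real (p + 2) * r ^ p * a j * (b j - a j)) \<le> s ^ (p + 2)"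
proof -
  have nn: "0 \<le> r" "0 \<le> s" by (auto simp: r_def s_def intro!: sum_nonneg)
  have r2: "(\<Sum>j\<in>J. a j * a j) = r * r"
    by (simp add: r_def sum_nonneg power2_eq_square)
  have "(\<Sum>j\<in>J. real (p + 2) * r ^ p * a j * (b j - a j))
      = real (p + 2) * r ^ p * ((\<Sum>j\<in>J. a j * b j) - (\<Sum>j\<in>J. a j * a j))"
    by (simp only: sum_subtractf[symmetric] sum_distrib_left) (simp only: right_diff_distrib mult.assoc)
  also have "\<dots> \<le> real (p + 2) * r ^ p * (r * s - r * r)"
    using sum_mult_le_sqrt[of a b J] nn r2 by (intro mult_left_mono) (auto simp: r_def s_def)
  also have "\<dots> = real (Suc (Suc p)) * r ^ Suc p * (s - r)"
    by (simp add: algebra_simps)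
  finally show ?thesis
    using power_tangent_le[OF nn, of "Suc p"] by simp
qed

text \<open>Infinite moments are allowed: if that of \<open>f\<close> is infinite, so is the
  right-hand side, because \<open>c\<close> is positive. Otherwise both moments are finite and an
  \<open>N\<close>-th root is taken.\<close>

lemma Lp_norm_le_of_moment_le:
  fixes f g :: "'a \<Rightarrow> real"
  assumes N: "0 < N" and c: "0 < c"
    and nn: "\<And>\<omega>. 0 \<le> f \<omega>" "\<And>\<omega>. 0 \<le> g \<omega>"
    and le: "(\<integral>\<^sup>+\<omega>. ennreal (g \<omega> ^ N) \<partial>M) \<le> ennreal (c ^ N) * (\<integral>\<^sup>+\<omega>. ennreal (f \<omega> ^ N) \<partial>M)"
  shows "Lp_norm M (real N) g \<le> ennreal c * Lp_norm M (real N) f"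
proof -
  define If Ig where "If = (\<integral>\<^sup>+\<omega>. ennreal (f \<omega> ^ N) \<partial>M)" and "Ig = (\<integral>\<^sup>+\<omega>. ennreal (g \<omega> ^ N) \<partial>M)"
  have norm: "Lp_norm M (real N) h = (if (\<integral>\<^sup>+\<omega>. ennreal (h \<omega> ^ N) \<partial>M) = \<infinity> then \<infinity>
      else ennreal (enn2real (\<integral>\<^sup>+\<omega>. ennreal (h \<omega> ^ N) \<partial>M) powr (1 / real N)))" if "\<And>\<omega>. 0 \<le> h \<omega>" for h
    unfolding Lp_norm_def Let_def using that N by (simp add: powr_realpow')
  have le': "Ig \<le> ennreal (c ^ N) * If" using le by (simp add: If_def Ig_def)
  show ?thesis
  proof (cases "If = \<infinity>")
    case True
    then have "Lp_norm M (real N) f = \<infinity>" using norm[OF nn(1)] by (simp add: If_def)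
    then show ?thesis using c by (simp add: ennreal_mult_top)
  next
    case False
    then have fin: "ennreal (c ^ N) * If < \<top>"
      by (simp add: ennreal_mult_less_top top.not_eq_extremum)
    then have "Ig \<noteq> \<infinity>" using le' by auto
    have "enn2real Ig \<le> enn2real (ennreal (c ^ N) * If)"
      using le' fin by (rule enn2real_mono)
    also have "\<dots> = c ^ N * enn2real If" using c by (simp add: enn2real_mult)
    finally have "enn2real Ig powr (1 / real N) \<le> (c ^ N * enn2real If) powr (1 / real N)"
      by (intro powr_mono2) auto
    also have "\<dots> = (c ^ N) powr (1 / real N) * enn2real If powr (1 / real N)"
      by (rule powr_mult)
    also have "(c ^ N) powr (1 / real N) = c"
      using c N by (simp add: powr_realpow[symmetric] powr_powr)
    finally have "ennreal (enn2real Ig powr (1 / real N)) \<le> ennreal (c * enn2real If powr (1 / real N))"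
      by (rule ennreal_leI)
    then show ?thesis
      using False \<open>Ig \<noteq> \<infinity>\<close> norm[OF nn(1)] norm[OF nn(2)] c
      by (simp add: If_def Ig_def ennreal_mult)
  qed
qed

section \<open>The moment inequality at a fixed time\<close>

context filtered_prob_space
begin

lemma expectation_sum_squares_power:
  fixes z :: "nat \<Rightarrow> real \<Rightarrow> 'a \<Rightarrow> complex"
  assumes ad: "\<And>j t. j < n \<Longrightarrow> 0 \<le> t \<Longrightarrow> z j t \<in> borel_measurable (F t)"
    and bd: "\<And>j t \<omega>. j < n \<Longrightarrow> 0 \<le> t \<Longrightarrow> \<omega> \<in> space M \<Longrightarrow> norm (z j t \<omega>) \<le> R" and R: "1 \<le> R"
    and orth1: "\<And>j. j < n \<Longrightarrow> orthogonal_increments (z j)"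
    and orth2: "\<And>j l. j < n \<Longrightarrow> l < n \<Longrightarrow> orthogonal_increments (\<lambda>t \<omega>. z j t \<omega> * z l t \<omega>)"
    and cont: "\<And>j \<omega>. j < n \<Longrightarrow> \<omega> \<in> space M \<Longrightarrow> continuous_on {0..} (\<lambda>t. z j t \<omega>)"
    and start: "\<And>j \<omega>. j < n \<Longrightarrow> \<omega> \<in> space M \<Longrightarrow> z j 0 \<omega> = 0"
    and T: "0 \<le> T" and q: "0 < q"
  shows "(\<integral>\<omega>. (\<Sum>j<n. (z j T \<omega>)\<^sup>2) ^ q \<partial>M) = 0"
proof -
  \<comment> \<open>Each factor of the power contributes a square, and the \<open>bool\<close>
    component gives its two copies different indices. Thus \<open>orth2\<close>, which speaks of
    distinct indices, also covers the product of a coordinate with itself.\<close>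
  define I where "I = {..<q} \<times> (UNIV :: bool set)"
  have fin: "finite I" by (simp add: I_def)
  have expand: "(\<Sum>j<n. (z j T \<omega>)\<^sup>2) ^ q = (\<Sum>h\<in>PiE {..<q} (\<lambda>_. {..<n}). \<Prod>p\<in>I. z (h (fst p)) T \<omega>)" for \<omega>
  proof -
    have "(\<Sum>j<n. (z j T \<omega>)\<^sup>2) ^ q = (\<Prod>i<q. \<Sum>j<n. (z j T \<omega>)\<^sup>2)" by simp
    also have "\<dots> = (\<Sum>h\<in>PiE {..<q} (\<lambda>_. {..<n}). \<Prod>i<q. (z (h i) T \<omega>)\<^sup>2)"
      by (rule prod_sum_PiE) auto
    also have "\<dots> = (\<Sum>h\<in>PiE {..<q} (\<lambda>_. {..<n}). \<Prod>p\<in>I. z (h (fst p)) T \<omega>)"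
    proof (rule sum.cong[OF refl])
      fix h
      show "(\<Prod>i<q. (z (h i) T \<omega>)\<^sup>2) = (\<Prod>p\<in>I. z (h (fst p)) T \<omega>)"
        using prod.cartesian_product[of "\<lambda>i _. z (h i) T \<omega>" "UNIV :: bool set" "{..<q}"]
        by (simp add: I_def case_prod_unfold UNIV_bool power2_eq_square)
    qed
    finally show ?thesis .
  qed
  have monomial: "integrable M (\<lambda>\<omega>. \<Prod>p\<in>I. z (h (fst p)) T \<omega>)" "(\<integral>\<omega>. (\<Prod>p\<in>I. z (h (fst p)) T \<omega>) \<partial>M) = 0"
    if h: "h \<in> PiE {..<q} (\<lambda>_. {..<n})" for h
  proof -
    have hn: "p \<in> I \<Longrightarrow> h (fst p) < n" for p using h by (auto simp: I_def PiE_def Pi_def)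
    show "integrable M (\<lambda>\<omega>. \<Prod>p\<in>I. z (h (fst p)) T \<omega>)"
    proof (rule integrable_bounded[where B="\<Prod>p\<in>I. R"])
      show "(\<lambda>\<omega>. \<Prod>p\<in>I. z (h (fst p)) T \<omega>) \<in> borel_measurable M"
        using hn measurable_F[OF T ad[OF _ T]] by (intro borel_measurable_prod) auto
      show "norm (\<Prod>p\<in>I. z (h (fst p)) T \<omega>) \<le> (\<Prod>p\<in>I. R)" if "\<omega> \<in> space M" for \<omega>
        unfolding prod_norm[symmetric] using hn bd[OF _ T that] by (intro prod_mono) auto
    qed
    have "(\<integral>\<omega>. (\<Prod>p\<in>I. z (h (fst p)) T \<omega>) \<partial>M) = (\<integral>\<omega>. (\<Prod>p\<in>I. z (h (fst p)) 0 \<omega>) \<partial>M)"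
      by (rule expectation_prod_eq[where z="\<lambda>p. z (h (fst p))" and R=R, OF fin])
        (use hn ad bd R orth1 orth2 cont T in auto)
    also have "\<dots> = (\<integral>\<omega>. 0 \<partial>M)"
    proof (rule Bochner_Integration.integral_cong[OF refl])
      fix \<omega> assume w: "\<omega> \<in> space M"
      \<comment> \<open>This is where \<open>q > 0\<close> enters: the product has at least one
        factor, so it vanishes at time 0.\<close>
      have "(0, True) \<in> I" using q by (simp add: I_def)
      then show "(\<Prod>p\<in>I. z (h (fst p)) 0 \<omega>) = 0"
        using fin start[OF hn[of "(0, True)"] w] by (intro prod_zero) (auto intro!: bexI[of _ "(0, True)"])
    qed
    finally show "(\<integral>\<omega>. (\<Prod>p\<in>I. z (h (fst p)) T \<omega>) \<partial>M) = 0" by simp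
  qed
  show ?thesis
    unfolding expand using monomial by (subst Bochner_Integration.integral_sum) auto
qed

text \<open>The stopped coordinates are bounded martingales with martingale products, so
  \<open>expectation_sum_squares_power\<close> makes the required power of \<open>V\<close> have
  mean zero, and \<open>cot_moment_bound\<close> applies with the Euclidean norms as
  \<open>a\<close> and \<open>b\<close>. Boundedness also justifies the passage to nonnegative
  integrals.\<close>

lemma stopped_moment_bound:
  fixes Z :: "nat \<Rightarrow> real \<Rightarrow> 'a \<Rightarrow> complex"
  assumes mart: "\<And>j. j < n \<Longrightarrow> real_martingale M F (\<lambda>t \<omega>. Re (Z j t \<omega>))"
      "\<And>j. j < n \<Longrightarrow> real_martingale M F (\<lambda>t \<omega>. Im (Z j t \<omega>))"
    and cont: "\<And>j. j < n \<Longrightarrow> continuous_proc M (\<lambda>t \<omega>. Re (Z j t \<omega>))"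
      "\<And>j. j < n \<Longrightarrow> continuous_proc M (\<lambda>t \<omega>. Im (Z j t \<omega>))"
    and start: "\<And>j \<omega>. j < n \<Longrightarrow> \<omega> \<in> space M \<Longrightarrow> Z j 0 \<omega> = 0"
    and \<rho>: "stopping_time_R M F \<rho>"
    and bounded: "\<And>j. j < n \<Longrightarrow> \<exists>B. \<forall>t\<ge>0. \<forall>\<omega>\<in>space M. \<bar>Re (Z j (min t (\<rho> \<omega>)) \<omega>)\<bar> \<le> B"
      "\<And>j. j < n \<Longrightarrow> \<exists>B. \<forall>t\<ge>0. \<forall>\<omega>\<in>space M. \<bar>Im (Z j (min t (\<rho> \<omega>)) \<omega>)\<bar> \<le> B"
    and prod: "\<And>j l. j < n \<Longrightarrow> l < n \<Longrightarrow>
        real_martingale M F (\<lambda>t \<omega>. Re (Z j (min t (\<rho> \<omega>)) \<omega> * Z l (min t (\<rho> \<omega>)) \<omega>))"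
      "\<And>j l. j < n \<Longrightarrow> l < n \<Longrightarrow>
        real_martingale M F (\<lambda>t \<omega>. Im (Z j (min t (\<rho> \<omega>)) \<omega> * Z l (min t (\<rho> \<omega>)) \<omega>))"
    and T: "0 \<le> T"
  shows "(\<integral>\<^sup>+\<omega>. ennreal (sqrt (\<Sum>j<n. (Im (Z j (min T (\<rho> \<omega>)) \<omega>))\<^sup>2) ^ 2 ^ Suc k) \<partial>M)
    \<le> ennreal (cot (pi / (2 * 2 ^ Suc k)) ^ 2 ^ Suc k)
      * (\<integral>\<^sup>+\<omega>. ennreal (sqrt (\<Sum>j<n. (Re (Z j (min T (\<rho> \<omega>)) \<omega>))\<^sup>2) ^ 2 ^ Suc k) \<partial>M)"
proof -
  define z where "z j t \<omega> = Z j (min t (\<rho> \<omega>)) \<omega>" for j t \<omega>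
  have martz: "real_martingale M F (\<lambda>t \<omega>. Re (z j t \<omega>))" "real_martingale M F (\<lambda>t \<omega>. Im (z j t \<omega>))"
    if "j < n" for j
    unfolding z_def using martingale_stopped[OF mart(1) cont(1) \<rho>] martingale_stopped[OF mart(2) cont(2) \<rho>] that
    by auto
  have adz: "z j t \<in> borel_measurable (F t)" if "j < n" "0 \<le> t" for j t
  proof -
    have [measurable]: "(\<lambda>\<omega>. Re (z j t \<omega>)) \<in> borel_measurable (F t)" "(\<lambda>\<omega>. Im (z j t \<omega>)) \<in> borel_measurable (F t)"
      using martz[OF that(1)] that(2) by (auto simp: real_martingale_def adapted_proc_def)
    show ?thesis by (subst borel_measurable_complex_iff) auto
  qed
  have "\<exists>B. \<forall>j t \<omega>. j < n \<longrightarrow> 0 \<le> t \<longrightarrow> \<omega> \<in> space M \<longrightarrow> norm (z j t \<omega>) \<le> B"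
  proof -
    obtain BR BI where BR: "\<And>j t \<omega>. j < n \<Longrightarrow> 0 \<le> t \<Longrightarrow> \<omega> \<in> space M \<Longrightarrow> \<bar>Re (z j t \<omega>)\<bar> \<le> BR j"
        and BI: "\<And>j t \<omega>. j < n \<Longrightarrow> 0 \<le> t \<Longrightarrow> \<omega> \<in> space M \<Longrightarrow> \<bar>Im (z j t \<omega>)\<bar> \<le> BI j"
      using bounded unfolding z_def by metis
    have "norm (z j t \<omega>) \<le> (\<Sum>i<n. \<bar>BR i\<bar> + \<bar>BI i\<bar>)" if j: "j < n" "0 \<le> t" "\<omega> \<in> space M" for j t \<omega>
    proof -
      have "norm (z j t \<omega>) \<le> \<bar>BR j\<bar> + \<bar>BI j\<bar>"
        using BR[OF j] BI[OF j] cmod_le[of "z j t \<omega>"] by linarith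
      also have "\<dots> \<le> (\<Sum>i<n. \<bar>BR i\<bar> + \<bar>BI i\<bar>)"
        using j by (intro member_le_sum) auto
      finally show ?thesis .
    qed
    then show ?thesis by blast
  qed
  then obtain B where B: "\<And>j t \<omega>. j < n \<Longrightarrow> 0 \<le> t \<Longrightarrow> \<omega> \<in> space M \<Longrightarrow> norm (z j t \<omega>) \<le> B" by blast
  define R where "R = max 1 B"
  have R: "1 \<le> R" and bd: "\<And>j t \<omega>. j < n \<Longrightarrow> 0 \<le> t \<Longrightarrow> \<omega> \<in> space M \<Longrightarrow> norm (z j t \<omega>) \<le> R"
    using B by (auto simp: R_def intro: max.coboundedI2)
  have contz: "continuous_on {0..} (\<lambda>t. z j t \<omega>)" if j: "j < n" and w: "\<omega> \<in> space M" for j \<omega>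
  proof -
    have "0 \<le> \<rho> \<omega>" using \<rho> w by (simp add: stopping_time_R_def)
    have "continuous_on {0..} (\<lambda>t. of_real (Re (Z j t \<omega>)) + \<i> * of_real (Im (Z j t \<omega>)))"
      using cont[OF j] w unfolding continuous_proc_def
      by (intro continuous_on_add continuous_on_mult continuous_on_const continuous_on_of_real) auto
    then have "continuous_on {0..} (\<lambda>t. Z j t \<omega>)"
      by (simp flip: complex_eq)
    then show ?thesis
      unfolding z_def using \<open>0 \<le> \<rho> \<omega>\<close>
      by (intro continuous_on_compose2[where f="\<lambda>t. min t (\<rho> \<omega>)" and g="\<lambda>t. Z j t \<omega>" and t="{0..}"] continuous_intros) auto
  qed
  have startz: "z j 0 \<omega> = 0" if "j < n" "\<omega> \<in> space M" for j \<omega>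
    using start[OF that] \<rho> that by (simp add: z_def stopping_time_R_def)
  define V where "V \<omega> = (\<Sum>j<n. (z j T \<omega>)\<^sup>2)" for \<omega>
  define a where "a \<omega> = sqrt (\<Sum>j<n. (Re (z j T \<omega>))\<^sup>2)" for \<omega>
  define b where "b \<omega> = sqrt (\<Sum>j<n. (Im (z j T \<omega>))\<^sup>2)" for \<omega>
  have zM[measurable]: "j < n \<Longrightarrow> z j T \<in> borel_measurable M" for j
    using measurable_F[OF T adz[OF _ T]] .
  have [measurable]: "V \<in> borel_measurable M"
    unfolding V_def using zM by (intro borel_measurable_sum borel_measurable_power) auto
  have [measurable]: "a \<in> borel_measurable M" "b \<in> borel_measurable M"
    unfolding a_def b_def using zM by (auto intro!: borel_measurable_euclidean_norm
        measurable_compose[OF _ borel_measurable_Re] measurable_compose[OF _ borel_measurable_Im])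
  have nn: "0 \<le> a \<omega>" "0 \<le> b \<omega>" for \<omega>
    by (auto simp: a_def b_def intro!: sum_nonneg)
  have ab: "a \<omega> \<le> sqrt (real n * R\<^sup>2)" "b \<omega> \<le> sqrt (real n * R\<^sup>2)" if w: "\<omega> \<in> space M" for \<omega>
  proof -
    have le: "(Re (z j T \<omega>))\<^sup>2 \<le> R\<^sup>2" "(Im (z j T \<omega>))\<^sup>2 \<le> R\<^sup>2" if "j < n" for j
      using order_trans[OF abs_Re_le_cmod bd[OF that T w]] order_trans[OF abs_Im_le_cmod bd[OF that T w]] R
      by (auto simp: abs_le_square_iff[symmetric])
    show "a \<omega> \<le> sqrt (real n * R\<^sup>2)" "b \<omega> \<le> sqrt (real n * R\<^sup>2)"
      unfolding a_def b_def
      using sum_bounded_above[of "{..<n}" "\<lambda>j. (Re (z j T \<omega>))\<^sup>2" "R\<^sup>2"]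
        sum_bounded_above[of "{..<n}" "\<lambda>j. (Im (z j T \<omega>))\<^sup>2" "R\<^sup>2"] le
      by (auto intro!: real_sqrt_le_mono)
  qed
  define N :: nat where "N = 2 ^ Suc k"
  define C where "C = cot (pi / (2 * 2 ^ Suc k))"
  have int: "integrable M (\<lambda>\<omega>. a \<omega> ^ N)" "integrable M (\<lambda>\<omega>. b \<omega> ^ N)"
    using nn ab by (auto intro!: integrable_bounded[where B="sqrt (real n * R\<^sup>2) ^ N"] power_mono
        simp: power_abs simp del: real_sqrt_mult)
  have "expectation (\<lambda>\<omega>. b \<omega> ^ N) \<le> C ^ N * expectation (\<lambda>\<omega>. a \<omega> ^ N)"
    unfolding N_def C_def
  proof (rule cot_moment_bound[where V=V and B="sqrt (real n * R\<^sup>2)"])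
    fix \<omega> assume w: "\<omega> \<in> space M"
    show "0 \<le> a \<omega> \<and> a \<omega> \<le> sqrt (real n * R\<^sup>2)" "0 \<le> b \<omega> \<and> b \<omega> \<le> sqrt (real n * R\<^sup>2)"
      using nn ab[OF w] by auto
    show "Re (V \<omega>) = (a \<omega>)\<^sup>2 - (b \<omega>)\<^sup>2"
      by (simp add: V_def a_def b_def sum_nonneg sum_subtractf Re_power2)
    have "Im (V \<omega>) = 2 * (\<Sum>j<n. Re (z j T \<omega>) * Im (z j T \<omega>))"
      by (simp add: V_def Im_power2 sum_distrib_left mult.assoc)
    then show "\<bar>Im (V \<omega>)\<bar> \<le> 2 * a \<omega> * b \<omega>"
      using sum_mult_le_sqrt[of "\<lambda>j. Re (z j T \<omega>)" "\<lambda>j. Im (z j T \<omega>)" "{..<n}"]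
      by (simp add: a_def b_def abs_mult)
  next
    have "(\<integral>\<omega>. V \<omega> ^ 2 ^ k \<partial>M) = 0"
      unfolding V_def
    proof (rule expectation_sum_squares_power[where R=R])
      show "orthogonal_increments (z j)" if "j < n" for j
        using martz[OF that] by (rule martingale_orthogonal_increments)
      show "orthogonal_increments (\<lambda>t \<omega>. z j t \<omega> * z l t \<omega>)" if "j < n" "l < n" for j l
        using prod[OF that] unfolding z_def by (rule martingale_orthogonal_increments)
    qed (use adz bd R contz startz T in auto)
    moreover have "integrable M (\<lambda>\<omega>. V \<omega> ^ 2 ^ k)"
    proof (rule integrable_bounded[where B="(real n * R\<^sup>2) ^ 2 ^ k"])
      fix \<omega> assume w: "\<omega> \<in> space M"
      have "norm (V \<omega>) \<le> (\<Sum>j<n. R\<^sup>2)"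
        unfolding V_def using bd[OF _ T w] by (intro sum_norm_le) (auto simp: norm_power intro!: power_mono)
      then show "norm (V \<omega> ^ 2 ^ k) \<le> (real n * R\<^sup>2) ^ 2 ^ k"
        unfolding norm_power by (intro power_mono) auto
    qed measurable
    ultimately show "expectation (\<lambda>\<omega>. Re (V \<omega> ^ 2 ^ k)) = 0"
      by (subst integral_Re) auto
  qed auto
  moreover have "0 \<le> C"
  proof -
    have "(1::real) < 2 ^ Suc k" by (rule one_less_power) auto
    then show ?thesis
      unfolding C_def by (intro less_imp_le cot_pos) (auto simp: field_simps)
  qed
  ultimately have "ennreal (expectation (\<lambda>\<omega>. b \<omega> ^ N)) \<le> ennreal (C ^ N) * ennreal (expectation (\<lambda>\<omega>. a \<omega> ^ N))"
    by (simp add: ennreal_mult'[symmetric] ennreal_leI)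
  then have "(\<integral>\<^sup>+\<omega>. ennreal (b \<omega> ^ N) \<partial>M) \<le> ennreal (C ^ N) * (\<integral>\<^sup>+\<omega>. ennreal (a \<omega> ^ N) \<partial>M)"
    using int nn by (subst (1 2) nn_integral_eq_integral) auto
  then show ?thesis
    unfolding a_def b_def N_def C_def z_def .
qed

text \<open>The gradient of the power of the norm is a subgradient, so that power of the norm is a
  submartingale, possibly with infinite mean. Exponents \<open>2 ^ Suc k\<close> are at least 2 and
  hence of the form \<open>p + 2\<close>.\<close>

lemma stopped_norm_moment_le:
  fixes X :: "nat \<Rightarrow> real \<Rightarrow> 'a \<Rightarrow> real"
  assumes mart: "\<And>j. j < n \<Longrightarrow> real_martingale M F (X j)"
    and cont: "\<And>j. j < n \<Longrightarrow> continuous_proc M (X j)"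
    and \<rho>: "stopping_time_R M F \<rho>" and T: "0 \<le> T"
  shows "(\<integral>\<^sup>+\<omega>. ennreal (sqrt (\<Sum>j<n. (X j (min T (\<rho> \<omega>)) \<omega>)\<^sup>2) ^ (p + 2)) \<partial>M)
    \<le> (\<integral>\<^sup>+\<omega>. ennreal (sqrt (\<Sum>j<n. (X j T \<omega>)\<^sup>2) ^ (p + 2)) \<partial>M)"
proof -
  define r where "r t \<omega> = sqrt (\<Sum>j<n. (X j t \<omega>)\<^sup>2)" for t \<omega>
  have ad: "X j t \<in> borel_measurable (F t)" if "j < n" "0 \<le> t" for j t
    using mart[OF that(1)] that(2) by (simp add: real_martingale_def adapted_proc_def)
  have rF: "r t \<in> borel_measurable (F t)" if "0 \<le> t" for t
    unfolding r_def using ad[OF _ that] by (intro borel_measurable_euclidean_norm) auto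
  have "(\<integral>\<^sup>+\<omega>. ennreal (r (min T (\<rho> \<omega>)) \<omega> ^ (p + 2)) \<partial>M) \<le> (\<integral>\<^sup>+\<omega>. ennreal (r T \<omega> ^ (p + 2)) \<partial>M)"
  proof (rule submartingale_stopped_le[OF \<rho> T, where H="\<lambda>t \<omega>. r t \<omega> ^ (p + 2)"])
    show "adapted_proc F (\<lambda>t \<omega>. r t \<omega> ^ (p + 2))"
      unfolding adapted_proc_def using rF by (auto intro!: borel_measurable_power)
    show "continuous_proc M (\<lambda>t \<omega>. r t \<omega> ^ (p + 2))"
      unfolding continuous_proc_def r_def using cont
      by (intro ballI continuous_intros) (auto simp: continuous_proc_def)
    fix s A assume s: "0 \<le> s" "s \<le> T" "A \<in> sets (F s)"
    show "(\<integral>\<^sup>+\<omega>. indicator A \<omega> * ennreal (r s \<omega> ^ (p + 2)) \<partial>M) \<le> (\<integral>\<^sup>+\<omega>. indicator A \<omega> * ennreal (r T \<omega> ^ (p + 2)) \<partial>M)"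
    proof (rule martingale_subgradient_le[where J="{..<n}" and N=X and s=s and t=T
          and G="\<lambda>j \<omega>. real (p + 2) * r s \<omega> ^ p * X j s \<omega>"])
      show "(\<lambda>\<omega>. r s \<omega> ^ (p + 2)) \<in> borel_measurable (F s)"
        using rF[OF s(1)] by (intro borel_measurable_power)
      show "(\<lambda>\<omega>. r T \<omega> ^ (p + 2)) \<in> borel_measurable M"
        using measurable_F[OF T rF[OF T]] by (intro borel_measurable_power)
      show "(\<lambda>\<omega>. real (p + 2) * r s \<omega> ^ p * X j s \<omega>) \<in> borel_measurable (F s)" if "j \<in> {..<n}" for j
        using rF[OF s(1)] ad[of j s] s that by (intro borel_measurable_times borel_measurable_power) auto
      show "r s \<omega> ^ (p + 2) + (\<Sum>j<n. real (p + 2) * r s \<omega> ^ p * X j s \<omega> * (X j T \<omega> - X j s \<omega>)) \<le> r T \<omega> ^ (p + 2)" for \<omega>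
        unfolding r_def by (rule euclidean_norm_power_subgradient)
    qed (use s mart in \<open>auto simp: r_def sum_nonneg\<close>)
  qed
  then show ?thesis by (simp only: r_def)
qed

lemma moment_bound:
  fixes Z :: "nat \<Rightarrow> real \<Rightarrow> 'a \<Rightarrow> complex"
  assumes mart: "\<And>j. j < n \<Longrightarrow> real_martingale M F (\<lambda>t \<omega>. Re (Z j t \<omega>))"
      "\<And>j. j < n \<Longrightarrow> real_martingale M F (\<lambda>t \<omega>. Im (Z j t \<omega>))"
    and cont: "\<And>j. j < n \<Longrightarrow> continuous_proc M (\<lambda>t \<omega>. Re (Z j t \<omega>))"
      "\<And>j. j < n \<Longrightarrow> continuous_proc M (\<lambda>t \<omega>. Im (Z j t \<omega>))"
    and start: "\<And>j \<omega>. j < n \<Longrightarrow> \<omega> \<in> space M \<Longrightarrow> Z j 0 \<omega> = 0"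
    and orth: "\<And>j l. j < n \<Longrightarrow> l < n \<Longrightarrow> \<exists>A. is_covariation M F (\<lambda>t \<omega>. Re (Z j t \<omega>)) (\<lambda>t \<omega>. Re (Z l t \<omega>)) A \<and>
          is_covariation M F (\<lambda>t \<omega>. Im (Z j t \<omega>)) (\<lambda>t \<omega>. Im (Z l t \<omega>)) A"
      "\<And>j l. j < n \<Longrightarrow> l < n \<Longrightarrow> \<exists>C. is_covariation M F (\<lambda>t \<omega>. Re (Z j t \<omega>)) (\<lambda>t \<omega>. Im (Z l t \<omega>)) C \<and>
          is_covariation M F (\<lambda>t \<omega>. Im (Z j t \<omega>)) (\<lambda>t \<omega>. Re (Z l t \<omega>)) (\<lambda>t \<omega>. - C t \<omega>)"
    and T: "0 \<le> T"
  shows "(\<integral>\<^sup>+\<omega>. ennreal (sqrt (\<Sum>j<n. (Im (Z j T \<omega>))\<^sup>2) ^ 2 ^ Suc k) \<partial>M)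
    \<le> ennreal (cot (pi / (2 * 2 ^ Suc k)) ^ 2 ^ Suc k)
      * (\<integral>\<^sup>+\<omega>. ennreal (sqrt (\<Sum>j<n. (Re (Z j T \<omega>))\<^sup>2) ^ 2 ^ Suc k) \<partial>M)"
proof -
  have cov: "localizable (\<lambda>\<rho>. real_martingale M F (\<lambda>t \<omega>. U (min t (\<rho> \<omega>)) \<omega> * V (min t (\<rho> \<omega>)) \<omega> - A (min t (\<rho> \<omega>)) \<omega>))"
    if A: "is_covariation M F U V A" and UV: "continuous_proc M U" "continuous_proc M V"
      and U0: "\<And>\<omega>. \<omega> \<in> space M \<Longrightarrow> U 0 \<omega> = 0" for U V A
  proof (rule localizable_local_martingale)
    show "real_local_martingale M F (\<lambda>t \<omega>. U t \<omega> * V t \<omega> - A t \<omega>)"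
      using A by (simp add: is_covariation_def)
    show "continuous_proc M (\<lambda>t \<omega>. U t \<omega> * V t \<omega> - A t \<omega>)"
      using A UV unfolding is_covariation_def continuous_proc_def by (auto intro!: continuous_intros)
    show "U 0 \<omega> * V 0 \<omega> - A 0 \<omega> = 0" if "\<omega> \<in> space M" for \<omega>
      using A U0[OF that] that by (simp add: is_covariation_def)
  qed
  define good where "good j l \<rho> \<longleftrightarrow>
      real_martingale M F (\<lambda>t \<omega>. Re (Z j (min t (\<rho> \<omega>)) \<omega> * Z l (min t (\<rho> \<omega>)) \<omega>)) \<and>
      real_martingale M F (\<lambda>t \<omega>. Im (Z j (min t (\<rho> \<omega>)) \<omega> * Z l (min t (\<rho> \<omega>)) \<omega>))" for j l \<rho>
  have good: "localizable (good j l)" if jl: "j < n" "l < n" for j l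
  proof -
    obtain A where A: "is_covariation M F (\<lambda>t \<omega>. Re (Z j t \<omega>)) (\<lambda>t \<omega>. Re (Z l t \<omega>)) A"
        "is_covariation M F (\<lambda>t \<omega>. Im (Z j t \<omega>)) (\<lambda>t \<omega>. Im (Z l t \<omega>)) A"
      using orth(1)[OF jl] by blast
    obtain C where C: "is_covariation M F (\<lambda>t \<omega>. Re (Z j t \<omega>)) (\<lambda>t \<omega>. Im (Z l t \<omega>)) C"
        "is_covariation M F (\<lambda>t \<omega>. Im (Z j t \<omega>)) (\<lambda>t \<omega>. Re (Z l t \<omega>)) (\<lambda>t \<omega>. - C t \<omega>)"
      using orth(2)[OF jl] by blast
    note loc = localizable_conj[OF localizable_conj[OF cov[OF A(1)] cov[OF A(2)]] localizable_conj[OF cov[OF C(1)] cov[OF C(2)]]]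
    show ?thesis
    proof (rule localizable_mono[OF loc])
      fix \<rho> assume *: "(real_martingale M F (\<lambda>t \<omega>. Re (Z j (min t (\<rho> \<omega>)) \<omega>) * Re (Z l (min t (\<rho> \<omega>)) \<omega>) - A (min t (\<rho> \<omega>)) \<omega>) \<and>
         real_martingale M F (\<lambda>t \<omega>. Im (Z j (min t (\<rho> \<omega>)) \<omega>) * Im (Z l (min t (\<rho> \<omega>)) \<omega>) - A (min t (\<rho> \<omega>)) \<omega>)) \<and>
         real_martingale M F (\<lambda>t \<omega>. Re (Z j (min t (\<rho> \<omega>)) \<omega>) * Im (Z l (min t (\<rho> \<omega>)) \<omega>) - C (min t (\<rho> \<omega>)) \<omega>) \<and>
         real_martingale M F (\<lambda>t \<omega>. Im (Z j (min t (\<rho> \<omega>)) \<omega>) * Re (Z l (min t (\<rho> \<omega>)) \<omega>) - - C (min t (\<rho> \<omega>)) \<omega>)"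
      note m = *[THEN conjunct1, THEN conjunct1] *[THEN conjunct1, THEN conjunct2]
        *[THEN conjunct2, THEN conjunct1] *[THEN conjunct2, THEN conjunct2]
      \<comment> \<open>In \<open>Re (Z j * Z l)\<close> the common bracket \<open>A\<close> of the
        real and the imaginary parts cancels; in \<open>Im (Z j * Z l)\<close> the brackets
        \<open>C\<close> and \<open>- C\<close> cancel. The stopped products are thus martingales
        whatever \<open>A\<close> and \<open>C\<close> are.\<close>
      show "good j l \<rho>"
        unfolding good_def
        using real_martingale_diff[OF m(1,2)] real_martingale_add[OF m(3,4)] by simp
    qed (use cont start jl in auto)
  qed
  have bnd: "localizable (\<lambda>\<rho>. \<exists>B. \<forall>t\<ge>0. \<forall>\<omega>\<in>space M. \<bar>Re (Z j (min t (\<rho> \<omega>)) \<omega>)\<bar> \<le> B)"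
      "localizable (\<lambda>\<rho>. \<exists>B. \<forall>t\<ge>0. \<forall>\<omega>\<in>space M. \<bar>Im (Z j (min t (\<rho> \<omega>)) \<omega>)\<bar> \<le> B)" if j: "j < n" for j
    using mart[OF j] cont[OF j] start[OF j]
    by (auto intro!: localizable_bounded[where X="\<lambda>t \<omega>. Re (Z j t \<omega>)"]
        localizable_bounded[where X="\<lambda>t \<omega>. Im (Z j t \<omega>)"] simp: real_martingale_def)
  \<comment> \<open>Finitely many requirements, so a single localizing sequence makes all
    coordinates bounded and all their products martingales.\<close>
  have "localizable (\<lambda>\<rho>. (\<forall>j\<in>{..<n}. \<forall>l\<in>{..<n}. good j l \<rho>) \<and>
      (\<forall>j\<in>{..<n}. (\<exists>B. \<forall>t\<ge>0. \<forall>\<omega>\<in>space M. \<bar>Re (Z j (min t (\<rho> \<omega>)) \<omega>)\<bar> \<le> B) \<and>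
         (\<exists>B. \<forall>t\<ge>0. \<forall>\<omega>\<in>space M. \<bar>Im (Z j (min t (\<rho> \<omega>)) \<omega>)\<bar> \<le> B)))"
    by (intro localizable_conj localizable_ball good bnd) auto
  then obtain \<tau> :: "nat \<Rightarrow> 'a \<Rightarrow> real" where \<tau>: "\<And>m. stopping_time_R M F (\<tau> m)"
      "\<And>\<omega>. \<omega> \<in> space M \<Longrightarrow> filterlim (\<lambda>m. \<tau> m \<omega>) at_top sequentially"
      and \<tau>g: "\<And>m. (\<forall>j\<in>{..<n}. \<forall>l\<in>{..<n}. good j l (\<tau> m)) \<and>
      (\<forall>j\<in>{..<n}. (\<exists>B. \<forall>t\<ge>0. \<forall>\<omega>\<in>space M. \<bar>Re (Z j (min t (\<tau> m \<omega>)) \<omega>)\<bar> \<le> B) \<and>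
         (\<exists>B. \<forall>t\<ge>0. \<forall>\<omega>\<in>space M. \<bar>Im (Z j (min t (\<tau> m \<omega>)) \<omega>)\<bar> \<le> B))"
    by (rule localizableE) (rule that)
  define N :: nat where "N = 2 ^ Suc k"
  have "2 \<le> N" by (simp add: N_def)
  then obtain p where Np: "N = p + 2" by (metis le_iff_add add.commute)
  define b where "b t \<omega> = sqrt (\<Sum>j<n. (Im (Z j t \<omega>))\<^sup>2)" for t \<omega>
  define a where "a t \<omega> = sqrt (\<Sum>j<n. (Re (Z j t \<omega>))\<^sup>2)" for t \<omega>
  have bm: "(\<lambda>\<omega>. b (min T (\<tau> m \<omega>)) \<omega>) \<in> borel_measurable M" for m
  proof -
    have "(\<lambda>\<omega>. Im (Z j (min T (\<tau> m \<omega>)) \<omega>)) \<in> borel_measurable M" if "j < n" for j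
      using measurable_F[OF T measurable_stopped[OF \<tau>(1) T _ cont(2)[OF that]]] mart(2)[OF that]
      by (simp add: real_martingale_def)
    then show ?thesis
      unfolding b_def by (intro borel_measurable_euclidean_norm) auto
  qed
  have "(\<integral>\<^sup>+\<omega>. ennreal (b T \<omega> ^ N) \<partial>M)
      \<le> ennreal (cot (pi / (2 * 2 ^ Suc k)) ^ N) * (\<integral>\<^sup>+\<omega>. ennreal (a T \<omega> ^ N) \<partial>M)"
  proof (rule nn_integral_LIMSEQ_le[where f="\<lambda>m \<omega>. ennreal (b (min T (\<tau> m \<omega>)) \<omega> ^ N)"])
    show "(\<lambda>\<omega>. ennreal (b (min T (\<tau> m \<omega>)) \<omega> ^ N)) \<in> borel_measurable M" for m
      using bm[of m] by measurable
    fix \<omega> assume w: "\<omega> \<in> space M"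
    \<comment> \<open>On each path the stopped value at \<open>T\<close> is eventually the unstopped
      one, so the convergence needs no continuity.\<close>
    have "\<forall>\<^sub>F m in sequentially. T \<le> \<tau> m \<omega>"
      using \<tau>(2)[OF w] by (simp add: filterlim_at_top)
    then show "(\<lambda>m. ennreal (b (min T (\<tau> m \<omega>)) \<omega> ^ N)) \<longlonglongrightarrow> ennreal (b T \<omega> ^ N)"
      by (intro tendsto_eventually) (auto elim!: eventually_mono simp: min.absorb1)
  next
    fix m
    have "(\<integral>\<^sup>+\<omega>. ennreal (b (min T (\<tau> m \<omega>)) \<omega> ^ N) \<partial>M)
        \<le> ennreal (cot (pi / (2 * 2 ^ Suc k)) ^ N) * (\<integral>\<^sup>+\<omega>. ennreal (a (min T (\<tau> m \<omega>)) \<omega> ^ N) \<partial>M)"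
      unfolding a_def b_def N_def using \<tau>g[of m]
      by (intro stopped_moment_bound mart cont start \<tau> T) (auto simp: good_def)
    also have "\<dots> \<le> ennreal (cot (pi / (2 * 2 ^ Suc k)) ^ N) * (\<integral>\<^sup>+\<omega>. ennreal (a T \<omega> ^ N) \<partial>M)"
      unfolding a_def using stopped_norm_moment_le[of n "\<lambda>j t \<omega>. Re (Z j t \<omega>)" "\<tau> m" T p]
      by (intro mult_left_mono) (simp_all add: Np mart cont \<tau> T)
    finally show "(\<integral>\<^sup>+\<omega>. ennreal (b (min T (\<tau> m \<omega>)) \<omega> ^ N) \<partial>M)
        \<le> ennreal (cot (pi / (2 * 2 ^ Suc k)) ^ N) * (\<integral>\<^sup>+\<omega>. ennreal (a T \<omega> ^ N) \<partial>M)" .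
  qed
  then show ?thesis unfolding a_def b_def N_def .
qed

end

theorem theorem4p12:
  fixes M :: "'a measure" and F :: "real \<Rightarrow> 'a measure"
    and n :: nat and Z :: "nat \<Rightarrow> real \<Rightarrow> 'a \<Rightarrow> complex" and k :: nat
  defines "X \<equiv> \<lambda>j t \<omega>. Re (Z j t \<omega>)" and "Y \<equiv> \<lambda>j t \<omega>. Im (Z j t \<omega>)"
  assumes "prob_space M"
    and "usual_filtration M F"
    and mart: "\<forall>j<n. real_martingale M F (X j) \<and> real_martingale M F (Y j)"
    and cont: "\<forall>j<n. continuous_proc M (X j) \<and> continuous_proc M (Y j)"
    and start: "\<forall>j<n. \<forall>\<omega>\<in>space M. Z j 0 \<omega> = 0"
    and conformal: "\<forall>j<n. (\<exists>A. is_covariation M F (X j) (X j) A \<and> is_covariation M F (Y j) (Y j) A)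
                         \<and> is_covariation M F (X j) (Y j) (\<lambda>t \<omega>. 0)"
    and orth: "\<forall>j<n. \<forall>l<n.
                 (\<exists>A. is_covariation M F (X j) (X l) A \<and> is_covariation M F (Y j) (Y l) A) \<and>
                 (\<exists>C. is_covariation M F (X j) (Y l) C \<and>
                      is_covariation M F (Y j) (X l) (\<lambda>t \<omega>. - C t \<omega>))"
    and "k \<ge> 1"
  shows "proc_norm M (2 ^ k) (\<lambda>t \<omega>. sqrt (\<Sum>j<n. (Y j t \<omega>)\<^sup>2))
           \<le> ennreal (cot (pi / (2 * 2 ^ k))) * proc_norm M (2 ^ k) (\<lambda>t \<omega>. sqrt (\<Sum>j<n. (X j t \<omega>)\<^sup>2))"
proof -
  interpret prob_space M by fact
  interpret filtered_prob_space M F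
  proof
    note usual = \<open>usual_filtration M F\<close>[unfolded usual_filtration_def]
    show "subalgebra M (F t)" if "0 \<le> t" for t
      using usual[THEN conjunct1] that by simp
    show "sets (F s) \<subseteq> sets (F t)" if "0 \<le> s" "s \<le> t" for s t
      using usual[THEN conjunct2, THEN conjunct1] that by simp
  qed
  obtain i where k: "k = Suc i"
    using \<open>k \<ge> 1\<close> by (cases k) auto
  \<comment> \<open>\<open>Lp_norm\<close> takes a real exponent, whereas the moments are natural
    powers.\<close>
  have two: "(2::real) ^ k = real (2 ^ k)" by simp
  have "(1::real) < 2 ^ k" unfolding k by (rule one_less_power) auto
  then have c: "0 < cot (pi / (2 * 2 ^ k))"
    by (intro cot_pos) (auto simp: field_simps)
  show ?thesis
    unfolding proc_norm_def
  proof (rule SUP_least)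
    fix t :: real assume t: "t \<in> {0<..}"
    have "Lp_norm M (real (2 ^ k)) (\<lambda>\<omega>. sqrt (\<Sum>j<n. (Y j t \<omega>)\<^sup>2))
        \<le> ennreal (cot (pi / (2 * 2 ^ k))) * Lp_norm M (real (2 ^ k)) (\<lambda>\<omega>. sqrt (\<Sum>j<n. (X j t \<omega>)\<^sup>2))"
    proof (rule Lp_norm_le_of_moment_le)
      show "(\<integral>\<^sup>+\<omega>. ennreal (sqrt (\<Sum>j<n. (Y j t \<omega>)\<^sup>2) ^ 2 ^ k) \<partial>M)
          \<le> ennreal (cot (pi / (2 * 2 ^ k)) ^ 2 ^ k) * (\<integral>\<^sup>+\<omega>. ennreal (sqrt (\<Sum>j<n. (X j t \<omega>)\<^sup>2) ^ 2 ^ k) \<partial>M)"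
        unfolding X_def Y_def k
        by (rule moment_bound) (use mart cont start orth t in \<open>auto simp: X_def Y_def\<close>)
    qed (use c in \<open>auto intro!: sum_nonneg\<close>)
    also have "\<dots> \<le> ennreal (cot (pi / (2 * 2 ^ k)))
        * (SUP t\<in>{0<..}. Lp_norm M (real (2 ^ k)) (\<lambda>\<omega>. sqrt (\<Sum>j<n. (X j t \<omega>)\<^sup>2)))"
      using t by (intro mult_left_mono SUP_upper) auto
    finally show "Lp_norm M (2 ^ k) (\<lambda>\<omega>. sqrt (\<Sum>j<n. (Y j t \<omega>)\<^sup>2))
        \<le> ennreal (cot (pi / (2 * 2 ^ k))) * (SUP t\<in>{0<..}. Lp_norm M (2 ^ k) (\<lambda>\<omega>. sqrt (\<Sum>j<n. (X j t \<omega>)\<^sup>2)))"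
      by (simp only: two)
  qed
qed

end
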